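(* Let $H$ be a finite-dimensional Hilbert space, let $n\ge 1$, and let $R,G:H\Rightarrow W_L;W_R$ be two nondegenerate measurements in $\mathbf{2Hilb}$ (the "red" and the "green" one) with outcomes in $\mathbf{Hilb}^n$. The following are equivalent: 1. (Physical complementarity) There is a controlled phase $\phi:W_R;W_L\Rightarrow W_R;W_L$ such that, as 2-cells $H\Rightarrow W_L;W_R;W_L;W_R$, $$\bigl(\mathrm{id}_{W_L;W_R};(G\cdot R^\dagger)\bigr)\cdot(\mathrm{id}_{W_L};\mathrm{Copy};\mathrm{id}_{W_R})\cdot R=\frac1{\sqrt n}\,(\mathrm{id}_{W_L};\phi;\mathrm{id}_{W_R})\cdot(R;\mathrm{Create}).$$ 2. The 2-cell $\sqrt n\;G\cdot R^\dagger:W_L;W_R\Rightarrow W_L;W_R$ is horizontally unitary. 3. (Coecke–Duncan condition) With $(\mu_R,\eta_R)$ and $(\mu_G,\eta_G)$ the multiplication and unit of the commutative $\dagger$-Frobenius algebras on $H$ induced by $R$ and $G$, and $\delta_R=\mu_R^\dagger$, $\delta_G=\mu_G^\dagger$, $\epsilon_G=\eta_G^\dagger$, $$n\;\mu_R\circ(S\otimes\mathrm{id}_H)\circ\delta_G=\eta_R\circ\epsilon_G,\qquad\text{where } S=\bigl(\mathrm{id}_H\otimes(\epsilon_G\circ\mu_G)\bigr)\circ\bigl((\delta_R\circ\eta_R)\otimes\mathrm{id}_H\bigr):H\to H.$$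
   Context: $\mathbf{2Hilb}$ is the 2-category of finite-dimensional 2-Hilbert spaces in matrix form: objects are $\mathbf{Hilb}^n$, $n\in\mathbb{N}$; a 1-cell $\mathbf{Hilb}^n\to\mathbf{Hilb}^m$ is an $m\times n$ matrix of finite-dimensional Hilbert spaces, composed by matrix multiplication with $\oplus$ and $\otimes$; a 2-cell $F\Rightarrow G$ is a matrix of linear maps $F_{i,j}\to G_{i,j}$; vertical composition $\cdot$ is entrywise and horizontal composition is induced by $\oplus$ and $\otimes$; $\dagger$ takes entrywise adjoints, and a 2-cell is unitary if it is inverse to its $\dagger$. $I=\mathbf{Hilb}$ is the monoidal unit; a 1-cell $I\to I$ is a Hilbert space, 2-cells between such are linear maps. $X;Y$ denotes "first $X$, then $Y$" for 1-cells, and the corresponding horizontal composite for 2-cells; coherence isomorphisms are suppressed. The canonical witness of $\mathbf{Hilb}^n$: $W_L:\mathbf{Hilb}\to\mathbf{Hilb}^n$ and $W_R:\mathbf{Hilb}^n\to\mathbf{Hilb}$ are the column and row matrices with $n$ entries $\mathbb{C}$; $\mathrm{Create}:\mathrm{id}_I\Rightarrow W_L;W_R$ is the map $\mathbb{C}\to\mathbb{C}^n$, $1\mapsto(1,\ldots,1)$; $\mathrm{Copy}:\mathrm{id}_{\mathbf{Hilb}^n}\Rightarrow W_R;W_L$ has diagonal entries $1:\mathbb{C}\to\mathbb{C}$ and off-diagonal entries $0\to\mathbb{C}$; $\mathrm{Compare}=\mathrm{Copy}^\dagger$. A nondegenerate measurement on $H$ with outcomes in $\mathbf{Hilb}^n$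 is a unitary 2-cell $H\Rightarrow W_L;W_R$. A controlled phase is a unitary 2-cell $W_R;W_L\Rightarrow W_R;W_L$, i.e. an $n\times n$ matrix of complex numbers of modulus $1$. A 2-cell $K:W_L;W_R\Rightarrow W_L;W_R$ is horizontally unitary if the 2-cell obtained by bending its upper-left and lower-right wires, $$(\mathrm{Compare};\mathrm{id}_{W_R;W_L})\cdot(\mathrm{id}_{W_R};K;\mathrm{id}_{W_L})\cdot(\mathrm{id}_{W_R;W_L};\mathrm{Copy}):\ W_R;W_L\Rightarrow W_R;W_L,$$ is unitary. The $\dagger$-Frobenius algebra on $H$ induced by a nondegenerate measurement $M:H\Rightarrow W_L;W_R$ has multiplication $\mu_M=M^\dagger\cdot(\mathrm{id}_{W_L};\mathrm{Compare};\mathrm{id}_{W_R})\cdot(M;M):H\otimes H\to H$ and unit $\eta_M=M^\dagger\cdot\mathrm{Create}:\mathbb{C}\to H$. *)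

theory Defs
  imports Complex_Main "HOL-Library.Function_Algebras"
begin

section \<open>Finite-dimensional Hilbert spaces\<close>

class complex_vector = ab_group_add +
  fixes scaleC :: "complex \<Rightarrow> 'a \<Rightarrow> 'a"  (infixr \<open>*\<^sub>C\<close> 75)
  assumes scaleC_add_right: "a *\<^sub>C (x + y) = a *\<^sub>C x + a *\<^sub>C y"
    and scaleC_add_left: "(a + b) *\<^sub>C x = a *\<^sub>C x + b *\<^sub>C x"
    and scaleC_scaleC: "a *\<^sub>C (b *\<^sub>C x) = (a * b) *\<^sub>C x"
    and scaleC_one: "1 *\<^sub>C x = x"

global_interpretation complex_vector:
  vector_space "scaleC :: complex \<Rightarrow> 'a \<Rightarrow> 'a::complex_vector"
  defines csubspace = complex_vector.subspace
    and cspan = complex_vector.span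
  by unfold_locales (auto intro: scaleC_add_right scaleC_add_left scaleC_scaleC scaleC_one)

instantiation complex :: complex_vector
begin
definition scaleC_complex :: "complex \<Rightarrow> complex \<Rightarrow> complex" where "scaleC_complex = (*)"
instance by standard (simp_all add: scaleC_complex_def algebra_simps)
end

instantiation "fun" :: (type, complex_vector) complex_vector
begin
definition scaleC_fun :: "complex \<Rightarrow> ('a \<Rightarrow> 'b) \<Rightarrow> 'a \<Rightarrow> 'b"
  where "scaleC_fun c f = (\<lambda>x. c *\<^sub>C f x)"
instance
  by standard (simp_all add: scaleC_fun_def fun_eq_iff scaleC_add_right scaleC_add_left
      scaleC_scaleC scaleC_one)
end

text \<open>
  A Hilbert space is a finite-dimensional complex subspace of an ambient type together with an
  inner product, which is linear in its second argument. (The subspaces are needed since the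
  entries of one matrix of Hilbert spaces share a type but differ in dimension.)
\<close>

record 'a hilb =
  hcarrier :: "'a set"
  hinner :: "'a \<Rightarrow> 'a \<Rightarrow> complex"

locale hilbert_space =
  fixes V :: "'a::complex_vector hilb"
  assumes subspace: "csubspace (hcarrier V)"
    and finite_dim: "\<exists>B. finite B \<and> cspan B = hcarrier V"
    and inner_add: "\<lbrakk>x \<in> hcarrier V; y \<in> hcarrier V; z \<in> hcarrier V\<rbrakk>
      \<Longrightarrow> hinner V x (y + z) = hinner V x y + hinner V x z"
    and inner_scale: "\<lbrakk>x \<in> hcarrier V; y \<in> hcarrier V\<rbrakk>
      \<Longrightarrow> hinner V x (c *\<^sub>C y) = c * hinner V x y"
    and inner_commute: "\<lbrakk>x \<in> hcarrier V; y \<in> hcarrier V\<rbrakk>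
      \<Longrightarrow> hinner V y x = cnj (hinner V x y)"
    and inner_pos: "\<lbrakk>x \<in> hcarrier V; x \<noteq> 0\<rbrakk> \<Longrightarrow> 0 < Re (hinner V x x)"

definition linear_map ::
  "'a::complex_vector hilb \<Rightarrow> 'b::complex_vector hilb \<Rightarrow> ('a \<Rightarrow> 'b) \<Rightarrow> bool" where
  "linear_map V W f \<longleftrightarrow>
     (\<forall>x\<in>hcarrier V. f x \<in> hcarrier W) \<and>
     (\<forall>x\<in>hcarrier V. \<forall>y\<in>hcarrier V. f (x + y) = f x + f y) \<and>
     (\<forall>c. \<forall>x\<in>hcarrier V. f (c *\<^sub>C x) = c *\<^sub>C f x)"

definition adj :: "'a hilb \<Rightarrow> 'b hilb \<Rightarrow> ('a \<Rightarrow> 'b) \<Rightarrow> 'b \<Rightarrow> 'a" where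
  "adj V W f y =
     (THE x. x \<in> hcarrier V \<and> (\<forall>v\<in>hcarrier V. hinner V x v = hinner W y (f v)))"

definition onb_of :: "'a::complex_vector hilb \<Rightarrow> 'a set \<Rightarrow> bool" where
  "onb_of V B \<longleftrightarrow> finite B \<and> cspan B = hcarrier V \<and>
     (\<forall>e\<in>B. \<forall>f\<in>B. hinner V e f = (if e = f then 1 else 0))"

definition some_onb :: "'a::complex_vector hilb \<Rightarrow> 'a set" where
  "some_onb V = (SOME B. onb_of V B)"

definition complex_hilb :: "complex hilb" where
  "complex_hilb = \<lparr>hcarrier = UNIV, hinner = (\<lambda>x y. cnj x * y)\<rparr>"

definition zero_hilb :: "complex hilb" where
  "zero_hilb = \<lparr>hcarrier = {0}, hinner = (\<lambda>x y. cnj x * y)\<rparr>"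

text \<open>The direct sum of \<open>V 0, \<dots>, V (n - 1)\<close>, and the inclusion of its \<open>j\<close>-th summand.\<close>

definition dsum :: "nat \<Rightarrow> (nat \<Rightarrow> 'a::zero hilb) \<Rightarrow> (nat \<Rightarrow> 'a) hilb" where
  "dsum n V = \<lparr>hcarrier = {v. (\<forall>j<n. v j \<in> hcarrier (V j)) \<and> (\<forall>j\<ge>n. v j = 0)},
               hinner = (\<lambda>v w. \<Sum>j<n. hinner (V j) (v j) (w j))\<rparr>"

definition incl :: "nat \<Rightarrow> 'a::zero \<Rightarrow> nat \<Rightarrow> 'a" where
  "incl j x = (\<lambda>k. if k = j then x else 0)"

text \<open>
  The tensor product \<open>V \<otimes> W\<close>, realised basis-independently as the space of forms on \<open>V \<times> W\<close> that
  are conjugate-linear in both arguments; \<open>u \<otimes> v\<close> is the form \<open>(x, y) \<mapsto> \<langle>x, u\<rangle> \<langle>y, v\<rangle>\<close>.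
  The inner product does not depend on the orthonormal bases and satisfies
  \<open>\<langle>u \<otimes> v, u' \<otimes> v'\<rangle> = \<langle>u, u'\<rangle> \<langle>v, v'\<rangle>\<close> (lemma \<open>inner_pure\<close> below).
\<close>

definition tensor ::
  "'a::complex_vector hilb \<Rightarrow> 'b::complex_vector hilb \<Rightarrow> ('a \<Rightarrow> 'b \<Rightarrow> complex) hilb" where
  "tensor V W = \<lparr>hcarrier = {t.
       (\<forall>x y. x \<notin> hcarrier V \<or> y \<notin> hcarrier W \<longrightarrow> t x y = 0) \<and>
       (\<forall>x\<in>hcarrier V. \<forall>x'\<in>hcarrier V. \<forall>y\<in>hcarrier W. t (x + x') y = t x y + t x' y) \<and>
       (\<forall>x\<in>hcarrier V. \<forall>y\<in>hcarrier W. \<forall>y'\<in>hcarrier W. t x (y + y') = t x y + t x y') \<and>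
       (\<forall>c. \<forall>x\<in>hcarrier V. \<forall>y\<in>hcarrier W. t (c *\<^sub>C x) y = cnj c * t x y) \<and>
       (\<forall>c. \<forall>x\<in>hcarrier V. \<forall>y\<in>hcarrier W. t x (c *\<^sub>C y) = cnj c * t x y)},
     hinner = (\<lambda>s t. \<Sum>e\<in>some_onb V. \<Sum>f\<in>some_onb W. cnj (s e f) * t e f)\<rparr>"

definition pure :: "'a hilb \<Rightarrow> 'b hilb \<Rightarrow> 'a \<Rightarrow> 'b \<Rightarrow> 'a \<Rightarrow> 'b \<Rightarrow> complex" where
  "pure V W u v = (\<lambda>x y. if x \<in> hcarrier V \<and> y \<in> hcarrier W
                          then hinner V x u * hinner W y v else 0)"

text \<open>
  \<open>f \<otimes> g\<close> for \<open>f : V \<rightarrow> V'\<close> and \<open>g : W \<rightarrow> W'\<close>. As forms, \<open>\<langle>x', f u\<rangle> \<langle>y', g v\<rangle> = \<langle>f\<^sup>\<dagger> x', u\<rangle> \<langle>g\<^sup>\<dagger> y', v\<rangle>\<close>,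
  so \<open>f \<otimes> g\<close> is precomposition with the adjoints. See lemma \<open>tensor_map_pure\<close> below.
\<close>

definition tensor_map ::
  "'a hilb \<Rightarrow> 'a' hilb \<Rightarrow> 'b hilb \<Rightarrow> 'b' hilb \<Rightarrow> ('a \<Rightarrow> 'a') \<Rightarrow> ('b \<Rightarrow> 'b')
   \<Rightarrow> ('a \<Rightarrow> 'b \<Rightarrow> complex) \<Rightarrow> 'a' \<Rightarrow> 'b' \<Rightarrow> complex" where
  "tensor_map V V' W W' f g t =
     (\<lambda>x' y'. if x' \<in> hcarrier V' \<and> y' \<in> hcarrier W'
               then t (adj V V' f x') (adj W W' g y') else 0)"

context hilbert_space
begin

lemma zero_closed: "0 \<in> hcarrier V"
  using subspace complex_vector.subspace_0 by blast

lemma add_closed: "x \<in> hcarrier V \<Longrightarrow> y \<in> hcarrier V \<Longrightarrow> x + y \<in> hcarrier V"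
  using subspace complex_vector.subspace_add by blast

lemma diff_closed: "x \<in> hcarrier V \<Longrightarrow> y \<in> hcarrier V \<Longrightarrow> x - y \<in> hcarrier V"
  using subspace complex_vector.subspace_diff by blast

lemma scale_closed: "x \<in> hcarrier V \<Longrightarrow> c *\<^sub>C x \<in> hcarrier V"
  using subspace complex_vector.subspace_scale by blast

lemma sum_closed: "(\<And>i. i \<in> I \<Longrightarrow> f i \<in> hcarrier V) \<Longrightarrow> sum f I \<in> hcarrier V"
  using subspace complex_vector.subspace_sum by blast

lemma inner_add_left:
  "\<lbrakk>x \<in> hcarrier V; y \<in> hcarrier V; z \<in> hcarrier V\<rbrakk>
   \<Longrightarrow> hinner V (x + y) z = hinner V x z + hinner V y z"
  by (metis add_closed complex_cnj_add inner_add inner_commute)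

lemma inner_scale_left:
  "\<lbrakk>x \<in> hcarrier V; y \<in> hcarrier V\<rbrakk> \<Longrightarrow> hinner V (c *\<^sub>C x) y = cnj c * hinner V x y"
  by (metis scale_closed complex_cnj_mult inner_scale inner_commute)

lemma inner_zero: "x \<in> hcarrier V \<Longrightarrow> hinner V x 0 = 0"
  using inner_scale[of x 0 0] zero_closed by simp

lemma inner_sum:
  assumes "x \<in> hcarrier V" and "\<And>i. i \<in> I \<Longrightarrow> f i \<in> hcarrier V"
  shows "hinner V x (sum f I) = (\<Sum>i\<in>I. hinner V x (f i))"
  using assms(2)
  by (induction I rule: infinite_finite_induct)
    (simp_all add: assms(1) inner_zero inner_add sum_closed)

lemma inner_diff:
  assumes "x \<in> hcarrier V" "y \<in> hcarrier V" "z \<in> hcarrier V"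
  shows "hinner V x (y - z) = hinner V x y - hinner V x z"
  using inner_add[OF assms(1) diff_closed[OF assms(2,3)] assms(3)] by simp

lemma inner_sum_left:
  assumes "x \<in> hcarrier V" and "\<And>i. i \<in> I \<Longrightarrow> f i \<in> hcarrier V"
  shows "hinner V (sum f I) x = (\<Sum>i\<in>I. hinner V (f i) x)"
proof -
  have "hinner V (sum f I) x = cnj (hinner V x (sum f I))"
    by (intro inner_commute assms sum_closed)
  also have "\<dots> = (\<Sum>i\<in>I. cnj (hinner V x (f i)))"
    by (simp add: inner_sum assms)
  also have "\<dots> = (\<Sum>i\<in>I. hinner V (f i) x)"
    by (intro sum.cong refl) (metis assms inner_commute)
  finally show ?thesis .
qed

lemma gram_schmidt:
  assumes "finite B" "B \<subseteq> hcarrier V"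
  shows "\<exists>E. finite E \<and> cspan E = cspan B \<and>
    (\<forall>e\<in>E. \<forall>f\<in>E. hinner V e f = (if e = f then 1 else 0))"
  using assms
proof (induction B rule: finite_induct)
  case empty
  show ?case by (intro exI[of _ "{}"]) simp
next
  case (insert b B)
  then obtain E where E: "finite E" "cspan E = cspan B"
    "\<And>e f. e \<in> E \<Longrightarrow> f \<in> E \<Longrightarrow> hinner V e f = (if e = f then 1 else 0)" by auto
  have EV: "E \<subseteq> hcarrier V"
    using E(2) insert.prems complex_vector.span_superset[of E]
      complex_vector.span_minimal[OF _ subspace, of B] by auto
  have bV: "b \<in> hcarrier V" using insert.prems by simp
  define p where "p = (\<Sum>e\<in>E. hinner V e b *\<^sub>C e)"
  define w where "w = b - p"
  have pE: "p \<in> cspan E"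
    unfolding p_def
    by (intro complex_vector.span_sum complex_vector.span_scale complex_vector.span_base)
  have pV: "p \<in> hcarrier V"
    unfolding p_def by (intro sum_closed scale_closed) (use EV in auto)
  have wV: "w \<in> hcarrier V" unfolding w_def by (intro diff_closed bV pV)
  have orth: "hinner V e w = 0" if e: "e \<in> E" for e
  proof -
    have eV: "e \<in> hcarrier V" using e EV by auto
    have "hinner V e p = (\<Sum>f\<in>E. hinner V e (hinner V f b *\<^sub>C f))"
      unfolding p_def by (intro inner_sum eV scale_closed) (use EV in auto)
    also have "\<dots> = (\<Sum>f\<in>E. if e = f then hinner V e b else 0)"
      using EV by (intro sum.cong refl) (auto simp: inner_scale eV E(3) e)
    also have "\<dots> = hinner V e b" using E(1) e by simp
    finally show ?thesis unfolding w_def by (simp add: inner_diff eV bV pV)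
  qed
  have spanb: "cspan (insert b B) = cspan (insert b E)"
    using E(2) by (simp add: complex_vector.span_insert)
  show ?case
  proof (cases "w = 0")
    case True
    then have "b \<in> cspan E" using pE unfolding w_def by simp
    then have "cspan (insert b E) = cspan E" by (rule complex_vector.span_redundant)
    then show ?thesis using E spanb by metis
  next
    case False
    define r where "r = Re (hinner V w w)"
    have r: "0 < r" unfolding r_def using inner_pos wV False by auto
    have ww: "hinner V w w = of_real r"
      using inner_commute[OF wV wV] unfolding r_def by (simp add: complex_eq_iff)
    define c :: complex where "c = of_real (1 / sqrt r)"
    define e' where "e' = c *\<^sub>C w"
    have e'V: "e' \<in> hcarrier V" unfolding e'_def by (intro scale_closed wV)
    have n1: "hinner V e' e' = 1"
    proof -
      have "hinner V e' e' = cnj c * c * of_real r"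
        unfolding e'_def by (simp add: inner_scale inner_scale_left wV scale_closed ww)
      also have "\<dots> = of_real (1 / sqrt r * (1 / sqrt r) * r)"
        by (simp only: c_def complex_cnj_complex_of_real of_real_mult)
      also have "1 / sqrt r * (1 / sqrt r) * r = 1" using r by simp
      finally show ?thesis by simp
    qed
    have o1: "hinner V e e' = 0" if "e \<in> E" for e
      using orth[OF that] EV that unfolding e'_def by (auto simp: inner_scale wV)
    have o2: "hinner V e' e = 0" if "e \<in> E" for e
      using o1[OF that] inner_commute[of e e'] that EV e'V by auto
    have ne: "e' \<notin> E" using n1 o1 by force
    have c0: "c \<noteq> 0" unfolding c_def using r by simp
    have wb: "w = inverse c *\<^sub>C e'" unfolding e'_def using c0
      by (simp add: scaleC_scaleC scaleC_one)
    have "e' \<in> cspan (insert b E)"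
      unfolding e'_def w_def
      by (intro complex_vector.span_scale complex_vector.span_diff)
        (use pE complex_vector.span_mono[of E "insert b E"] in
          \<open>auto intro: complex_vector.span_base\<close>)
    moreover have "b \<in> cspan (insert e' E)"
    proof -
      have "b = inverse c *\<^sub>C e' + p" using wb unfolding w_def by (simp add: algebra_simps)
      also have "\<dots> \<in> cspan (insert e' E)"
        by (intro complex_vector.span_scale complex_vector.span_add)
          (use pE complex_vector.span_mono[of E "insert e' E"] in
            \<open>auto intro: complex_vector.span_base\<close>)
      finally show ?thesis .
    qed
    ultimately have "cspan (insert e' E) = cspan (insert b E)"
      by (auto simp: complex_vector.span_eq intro: complex_vector.span_base)
    then have "finite (insert e' E) \<and> cspan (insert e' E) = cspan (insert b B) \<and>
      (\<forall>e\<in>insert e' E. \<forall>f\<in>insert e' E. hinner V e f = (if e = f then 1 else 0))"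
      using E n1 o1 o2 ne spanb by auto
    then show ?thesis by blast
  qed
qed

lemma onb_of_some_onb: "onb_of V (some_onb V)"
proof -
  obtain B where B: "finite B" "cspan B = hcarrier V" using finite_dim by blast
  then have "B \<subseteq> hcarrier V" using complex_vector.span_superset[of B] by auto
  from gram_schmidt[OF B(1) this] show ?thesis
    unfolding some_onb_def using B by (intro someI_ex[of "onb_of V"]) (auto simp: onb_of_def)
qed

lemma onb_expand:
  assumes B: "onb_of V B" and x: "x \<in> hcarrier V"
  shows "x = (\<Sum>e\<in>B. hinner V e x *\<^sub>C e)"
proof -
  have fin: "finite B" and sp: "cspan B = hcarrier V"
    and on: "\<And>e f. e \<in> B \<Longrightarrow> f \<in> B \<Longrightarrow> hinner V e f = (if e = f then 1 else 0)"
    using B by (auto simp: onb_of_def)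
  have BV: "B \<subseteq> hcarrier V" using complex_vector.span_superset[of B] sp by auto
  obtain c where c: "x = (\<Sum>e\<in>B. c e *\<^sub>C e)"
    using x sp complex_vector.span_finite[OF fin] by auto
  have "hinner V f x = c f" if f: "f \<in> B" for f
  proof -
    have fV: "f \<in> hcarrier V" using f BV by auto
    have "hinner V f x = (\<Sum>e\<in>B. hinner V f (c e *\<^sub>C e))"
      unfolding c by (intro inner_sum fV scale_closed) (use BV in auto)
    also have "\<dots> = (\<Sum>e\<in>B. if f = e then c f else 0)"
      using BV by (intro sum.cong refl) (auto simp: inner_scale fV on f)
    also have "\<dots> = c f" using fin f by simp
    finally show ?thesis .
  qed
  then show ?thesis using c by simp
qed

lemma some_onb_closed: "e \<in> some_onb V \<Longrightarrow> e \<in> hcarrier V"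
  using onb_of_some_onb complex_vector.span_superset[of "some_onb V"] by (auto simp: onb_of_def)

lemma parseval:
  assumes x: "x \<in> hcarrier V" and y: "y \<in> hcarrier V"
  shows "(\<Sum>e\<in>some_onb V. hinner V x e * hinner V e y) = hinner V x y"
proof -
  have "hinner V x y = hinner V x (\<Sum>e\<in>some_onb V. hinner V e y *\<^sub>C e)"
    using onb_expand[OF onb_of_some_onb y] by simp
  also have "\<dots> = (\<Sum>e\<in>some_onb V. hinner V x (hinner V e y *\<^sub>C e))"
    by (intro inner_sum x scale_closed some_onb_closed)
  also have "\<dots> = (\<Sum>e\<in>some_onb V. hinner V x e * hinner V e y)"
    by (intro sum.cong refl) (simp add: inner_scale x some_onb_closed)
  finally show ?thesis by simp
qed

lemma inner_eqI:
  assumes "x \<in> hcarrier V" "y \<in> hcarrier V"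
    and "\<And>v. v \<in> hcarrier V \<Longrightarrow> hinner V x v = hinner V y v"
  shows "x = y"
proof -
  have "hinner V (x - y) (x - y) = 0"
    using inner_add_left[of "x - y" y "x - y"] assms by (simp add: diff_closed)
  then show ?thesis using inner_pos[of "x - y"] assms by (auto simp: diff_closed)
qed

end

lemma adj_works:
  assumes "hilbert_space V" "hilbert_space W" and f: "linear_map V W f"
    and y: "y \<in> hcarrier W"
  shows adj_closed: "adj V W f y \<in> hcarrier V"
    and adj_inner: "v \<in> hcarrier V \<Longrightarrow> hinner V (adj V W f y) v = hinner W y (f v)"
proof -
  interpret V: hilbert_space V by fact
  interpret W: hilbert_space W by fact
  have fV: "f x \<in> hcarrier W" if "x \<in> hcarrier V" for x
    using f that by (simp add: linear_map_def)
  have fscale: "f (c *\<^sub>C x) = c *\<^sub>C f x" if "x \<in> hcarrier V" for c x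
    using f that by (simp add: linear_map_def)
  have f0: "f 0 = 0" using fscale[OF V.zero_closed, of 0] by simp
  have fsum: "f (sum g I) = (\<Sum>i\<in>I. f (g i))"
    if "\<And>i. i \<in> I \<Longrightarrow> g i \<in> hcarrier V" for g :: "'a \<Rightarrow> 'a" and I
    using that f
    by (induction I rule: infinite_finite_induct)
      (simp_all add: f0 linear_map_def V.sum_closed)
  define x where "x = (\<Sum>e\<in>some_onb V. cnj (hinner W y (f e)) *\<^sub>C e)"
  have xV: "x \<in> hcarrier V"
    unfolding x_def by (intro V.sum_closed V.scale_closed V.some_onb_closed)
  have x: "hinner V x v = hinner W y (f v)" if v: "v \<in> hcarrier V" for v
  proof -
    have "hinner V x v = (\<Sum>e\<in>some_onb V. hinner W y (f e) * hinner V e v)"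
      unfolding x_def
      by (subst V.inner_sum_left)
        (simp_all add: v V.scale_closed V.some_onb_closed V.inner_scale_left)
    also have "\<dots> = (\<Sum>e\<in>some_onb V. hinner W y (f (hinner V e v *\<^sub>C e)))"
      by (intro sum.cong refl)
        (simp add: fscale V.some_onb_closed W.inner_scale y fV)
    also have "\<dots> = hinner W y (f (\<Sum>e\<in>some_onb V. hinner V e v *\<^sub>C e))"
      by (subst fsum) (simp_all add: V.some_onb_closed V.scale_closed W.inner_sum y fV)
    finally show ?thesis using V.onb_expand[OF V.onb_of_some_onb v] by simp
  qed
  have "adj V W f y = x"
    unfolding adj_def
  proof (rule the_equality)
    show "x \<in> hcarrier V \<and> (\<forall>v\<in>hcarrier V. hinner V x v = hinner W y (f v))"
      using xV x by blast
    show "z = x" if "z \<in> hcarrier V \<and> (\<forall>v\<in>hcarrier V. hinner V z v = hinner W y (f v))" for z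
      using that x xV by (intro V.inner_eqI) auto
  qed
  then show "adj V W f y \<in> hcarrier V"
    and "v \<in> hcarrier V \<Longrightarrow> hinner V (adj V W f y) v = hinner W y (f v)"
    using x xV by auto
qed

lemma pure_closed:
  assumes "hilbert_space V" "hilbert_space W" "u \<in> hcarrier V" "v \<in> hcarrier W"
  shows "pure V W u v \<in> hcarrier (tensor V W)"
proof -
  interpret V: hilbert_space V by fact
  interpret W: hilbert_space W by fact
  show ?thesis
    using assms
    by (simp add: tensor_def pure_def V.inner_add_left W.inner_add_left V.inner_scale_left
        W.inner_scale_left V.add_closed W.add_closed V.scale_closed W.scale_closed algebra_simps)
qed

lemma inner_pure:
  assumes "hilbert_space V" "hilbert_space W"
    and "u \<in> hcarrier V" "v \<in> hcarrier W" "u' \<in> hcarrier V" "v' \<in> hcarrier W"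
  shows "hinner (tensor V W) (pure V W u v) (pure V W u' v') = hinner V u u' * hinner W v v'"
proof -
  interpret V: hilbert_space V by fact
  interpret W: hilbert_space W by fact
  have "hinner (tensor V W) (pure V W u v) (pure V W u' v') =
      (\<Sum>e\<in>some_onb V. \<Sum>f\<in>some_onb W.
         (hinner V u e * hinner V e u') * (hinner W v f * hinner W f v'))"
    using assms(3-6)
    by (simp add: tensor_def pure_def V.some_onb_closed W.some_onb_closed
        V.inner_commute[of u] W.inner_commute[of v] mult_ac)
  also have "\<dots> = hinner V u u' * hinner W v v'"
    using assms(3-6) by (simp add: sum_product[symmetric] V.parseval W.parseval)
  finally show ?thesis .
qed

lemma tensor_map_pure:
  assumes "hilbert_space V" "hilbert_space V'" "hilbert_space W" "hilbert_space W'"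
    and "linear_map V V' f" "linear_map W W' g" and "u \<in> hcarrier V" "v \<in> hcarrier W"
  shows "tensor_map V V' W W' f g (pure V W u v) = pure V' W' (f u) (g v)"
  using assms by (auto simp: tensor_map_def pure_def adj_closed adj_inner fun_eq_iff)


section \<open>The 2-category 2Hilb\<close>

text \<open>
  The object \<open>Hilb\<^sup>n\<close> is represented by \<open>n\<close>. A 1-cell \<open>Hilb\<^sup>n \<rightarrow> Hilb\<^sup>m\<close> has \<open>src1 = n\<close>,
  \<open>tgt1 = m\<close>, and entry \<open>entry1 F i j\<close> in row \<open>i < m\<close> and column \<open>j < n\<close>.
\<close>

record 'a cell1 =
  src1 :: nat
  tgt1 :: nat
  entry1 :: "nat \<Rightarrow> nat \<Rightarrow> 'a hilb"

definition is_cell1 :: "'a::complex_vector cell1 \<Rightarrow> bool" where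
  "is_cell1 F \<longleftrightarrow> (\<forall>i<tgt1 F. \<forall>j<src1 F. hilbert_space (entry1 F i j))"

definition id1 :: "nat \<Rightarrow> complex cell1" where
  "id1 n = \<lparr>src1 = n, tgt1 = n, entry1 = (\<lambda>i j. if i = j then complex_hilb else zero_hilb)\<rparr>"

text \<open>
  First \<open>F\<close>, then \<open>G\<close>. Within each summand the factor from \<open>F\<close> is written first, so that for
  Hilbert spaces \<open>H, K : I \<rightarrow> I\<close> the composite is \<open>H \<otimes> K\<close> in this order.
\<close>

definition comp1 :: "'a::complex_vector cell1 \<Rightarrow> 'b::complex_vector cell1
    \<Rightarrow> (nat \<Rightarrow> 'a \<Rightarrow> 'b \<Rightarrow> complex) cell1"  (infixl \<open>\<Zcomp>\<^sub>1\<close> 70) where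
  "F \<Zcomp>\<^sub>1 G = \<lparr>src1 = src1 F, tgt1 = tgt1 G,
     entry1 = (\<lambda>i k. dsum (tgt1 F) (\<lambda>j. tensor (entry1 F j k) (entry1 G i j)))\<rparr>"

record ('a, 'b) cell2 =
  src2 :: "'a cell1"
  tgt2 :: "'b cell1"
  entry2 :: "nat \<Rightarrow> nat \<Rightarrow> 'a \<Rightarrow> 'b"

definition is_cell2 :: "('a::complex_vector, 'b::complex_vector) cell2
    \<Rightarrow> 'a cell1 \<Rightarrow> 'b cell1 \<Rightarrow> bool"  (\<open>(_ :\<^sub>2/ _ \<Rightarrow>/ _)\<close> [51, 51, 51] 50) where
  "A :\<^sub>2 F \<Rightarrow> G \<longleftrightarrow> src2 A = F \<and> tgt2 A = G \<and> is_cell1 F \<and> is_cell1 G \<and>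
     src1 F = src1 G \<and> tgt1 F = tgt1 G \<and>
     (\<forall>i<tgt1 F. \<forall>j<src1 F. linear_map (entry1 F i j) (entry1 G i j) (entry2 A i j))"

text \<open>
  Equality of 2-cells: functions representing a linear map are compared on its domain only,
  and entries only within the bounds of the matrix.
\<close>

definition eq2 :: "('a, 'b) cell2 \<Rightarrow> ('a, 'b) cell2 \<Rightarrow> bool"  (infix \<open>\<approx>\<^sub>2\<close> 50) where
  "A \<approx>\<^sub>2 B \<longleftrightarrow> src2 A = src2 B \<and> tgt2 A = tgt2 B \<and>
     (\<forall>i<tgt1 (src2 A). \<forall>j<src1 (src2 A). \<forall>x\<in>hcarrier (entry1 (src2 A) i j).
        entry2 A i j x = entry2 B i j x)"

definition id2 :: "'a cell1 \<Rightarrow> ('a, 'a) cell2" where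
  "id2 F = \<lparr>src2 = F, tgt2 = F, entry2 = (\<lambda>i j x. x)\<rparr>"

text \<open>Vertical composition: \<open>B \<cdot> A\<close> is first \<open>A\<close>, then \<open>B\<close>.\<close>

definition vcomp :: "('b, 'c) cell2 \<Rightarrow> ('a, 'b) cell2 \<Rightarrow> ('a, 'c) cell2"
    (infixr \<open>\<cdot>\<close> 60) where
  "B \<cdot> A = \<lparr>src2 = src2 A, tgt2 = tgt2 B, entry2 = (\<lambda>i j. entry2 B i j \<circ> entry2 A i j)\<rparr>"

definition hcomp :: "('a::complex_vector, 'a'::complex_vector) cell2
    \<Rightarrow> ('b::complex_vector, 'b'::complex_vector) cell2
    \<Rightarrow> (nat \<Rightarrow> 'a \<Rightarrow> 'b \<Rightarrow> complex, nat \<Rightarrow> 'a' \<Rightarrow> 'b' \<Rightarrow> complex) cell2"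
    (infixl \<open>\<Zcomp>\<^sub>2\<close> 70) where
  "A \<Zcomp>\<^sub>2 B = \<lparr>src2 = src2 A \<Zcomp>\<^sub>1 src2 B, tgt2 = tgt2 A \<Zcomp>\<^sub>1 tgt2 B,
     entry2 = (\<lambda>i k t j.
       if j < tgt1 (src2 A)
       then tensor_map (entry1 (src2 A) j k) (entry1 (tgt2 A) j k)
                       (entry1 (src2 B) i j) (entry1 (tgt2 B) i j)
                       (entry2 A j k) (entry2 B i j) (t j)
       else 0)\<rparr>"

definition dagger :: "('a, 'b) cell2 \<Rightarrow> ('b, 'a) cell2"  (\<open>(_\<^sup>\<dagger>)\<close> [1000] 999) where
  "A\<^sup>\<dagger> = \<lparr>src2 = tgt2 A, tgt2 = src2 A,
     entry2 = (\<lambda>i j. adj (entry1 (src2 A) i j) (entry1 (tgt2 A) i j) (entry2 A i j))\<rparr>"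

definition scale2 :: "complex \<Rightarrow> ('a, 'b::complex_vector) cell2 \<Rightarrow> ('a, 'b) cell2"
    (infixr \<open>*\<^sub>2\<close> 55) where
  "c *\<^sub>2 A = A\<lparr>entry2 := (\<lambda>i j x. c *\<^sub>C entry2 A i j x)\<rparr>"

definition unitary2 :: "('a::complex_vector, 'b::complex_vector) cell2 \<Rightarrow> bool" where
  "unitary2 A \<longleftrightarrow> A :\<^sub>2 src2 A \<Rightarrow> tgt2 A \<and>
     A\<^sup>\<dagger> \<cdot> A \<approx>\<^sub>2 id2 (src2 A) \<and> A \<cdot> A\<^sup>\<dagger> \<approx>\<^sub>2 id2 (tgt2 A)"


subsection \<open>Coherence isomorphisms\<close>

text \<open>
  All of these are unitary, so their inverses are written as daggers. The unitors
  \<open>F \<rightarrow> F \<Zcomp> id\<close> and \<open>F \<rightarrow> id \<Zcomp> F\<close> are \<open>x \<mapsto> x \<otimes> 1\<close> and \<open>x \<mapsto> 1 \<otimes> x\<close>.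
\<close>

definition runit :: "'a::complex_vector cell1
    \<Rightarrow> ('a, nat \<Rightarrow> 'a \<Rightarrow> complex \<Rightarrow> complex) cell2" where
  "runit F = \<lparr>src2 = F, tgt2 = F \<Zcomp>\<^sub>1 id1 (tgt1 F),
     entry2 = (\<lambda>i k x. incl i (pure (entry1 F i k) complex_hilb x 1))\<rparr>"

definition lunit :: "'a::complex_vector cell1
    \<Rightarrow> ('a, nat \<Rightarrow> complex \<Rightarrow> 'a \<Rightarrow> complex) cell2" where
  "lunit F = \<lparr>src2 = F, tgt2 = id1 (src1 F) \<Zcomp>\<^sub>1 F,
     entry2 = (\<lambda>i k x. incl k (pure complex_hilb (entry1 F i k) 1 x))\<rparr>"

text \<open>
  The associator \<open>(F \<Zcomp> G) \<Zcomp> K \<rightarrow> F \<Zcomp> (G \<Zcomp> K)\<close> sends \<open>(x \<otimes> y) \<otimes> z\<close> to \<open>x \<otimes> (y \<otimes> z)\<close> in the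
  corresponding summands (lemma \<open>assoc_pure\<close> below). As a form, the image of \<open>t\<close> is
  \<open>(x, u) \<mapsto> \<langle>u, t(x \<otimes> -, -)\<rangle>\<close>.
\<close>

definition assoc :: "'a::complex_vector cell1 \<Rightarrow> 'b::complex_vector cell1
    \<Rightarrow> 'c::complex_vector cell1
    \<Rightarrow> (nat \<Rightarrow> (nat \<Rightarrow> 'a \<Rightarrow> 'b \<Rightarrow> complex) \<Rightarrow> 'c \<Rightarrow> complex,
        nat \<Rightarrow> 'a \<Rightarrow> (nat \<Rightarrow> 'b \<Rightarrow> 'c \<Rightarrow> complex) \<Rightarrow> complex) cell2" where
  "assoc F G K = \<lparr>src2 = (F \<Zcomp>\<^sub>1 G) \<Zcomp>\<^sub>1 K, tgt2 = F \<Zcomp>\<^sub>1 (G \<Zcomp>\<^sub>1 K),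
     entry2 = (\<lambda>i l t j x u.
       if j < tgt1 F \<and> x \<in> hcarrier (entry1 F j l) \<and> u \<in> hcarrier (entry1 (G \<Zcomp>\<^sub>1 K) i j)
       then hinner (entry1 (G \<Zcomp>\<^sub>1 K) i j) u
              (\<lambda>k y z. t k (incl j (pure (entry1 F j l) (entry1 G k j) x y)) z)
       else 0)\<rparr>"
lemma assoc_pure:
  assumes cells: "is_cell1 F" "is_cell1 G" "is_cell1 K" "src1 G = tgt1 F" "src1 K = tgt1 G"
    and bounds: "j < tgt1 F" "k < tgt1 G" "l < src1 F" "i < tgt1 K"
    and x: "x \<in> hcarrier (entry1 F j l)" and y: "y \<in> hcarrier (entry1 G k j)"
    and z: "z \<in> hcarrier (entry1 K i k)"
  shows "entry2 (assoc F G K) i l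
           (incl k (pure (entry1 (F \<Zcomp>\<^sub>1 G) k l) (entry1 K i k)
                      (incl j (pure (entry1 F j l) (entry1 G k j) x y)) z)) =
         incl j (pure (entry1 F j l) (entry1 (G \<Zcomp>\<^sub>1 K) i j) x
                   (incl k (pure (entry1 G k j) (entry1 K i k) y z)))"
    (is "?L = ?R")
proof (intro ext)
  fix j' x' u
  have hF: "hilbert_space (entry1 F j l)" if "j < tgt1 F" for j
    using cells bounds that by (auto simp: is_cell1_def)
  have hG: "hilbert_space (entry1 G k j)" if "j < tgt1 F" for j
    using cells bounds that by (auto simp: is_cell1_def)
  have hK: "hilbert_space (entry1 K i k)"
    using cells bounds by (auto simp: is_cell1_def)
  let ?t = "incl k (pure (entry1 (F \<Zcomp>\<^sub>1 G) k l) (entry1 K i k)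
              (incl j (pure (entry1 F j l) (entry1 G k j) x y)) z)"
  let ?yz = "incl k (pure (entry1 G k j) (entry1 K i k) y z)"
  show "?L j' x' u = ?R j' x' u"
  proof (cases "j' < tgt1 F \<and> x' \<in> hcarrier (entry1 F j' l)
                \<and> u \<in> hcarrier (entry1 (G \<Zcomp>\<^sub>1 K) i j')")
    case False
    then show ?thesis using bounds by (auto simp: assoc_def incl_def pure_def)
  next
    case True
    have closed: "incl j' (pure (entry1 F j' l) (entry1 G k j') x' e)
        \<in> hcarrier (entry1 (F \<Zcomp>\<^sub>1 G) k l)" if "e \<in> hcarrier (entry1 G k j')" for e
    proof -
      have "0 \<in> hcarrier (tensor (entry1 F m l) (entry1 G k m))" for m
        by (simp add: tensor_def)
      then show ?thesis
        using that True by (auto simp: comp1_def dsum_def incl_def intro!: pure_closed hF hG)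
    qed
    have ip: "hinner (entry1 (F \<Zcomp>\<^sub>1 G) k l) (incl j' (pure (entry1 F j' l) (entry1 G k j') x' e))
          (incl j (pure (entry1 F j l) (entry1 G k j) x y)) =
        (if j' = j then hinner (entry1 F j l) x' x * hinner (entry1 G k j) e y else 0)"
      if e: "e \<in> hcarrier (entry1 G k j')" for e
    proof -
      have "hinner (entry1 (F \<Zcomp>\<^sub>1 G) k l)
          (incl j' (pure (entry1 F j' l) (entry1 G k j') x' e))
          (incl j (pure (entry1 F j l) (entry1 G k j) x y)) =
        (\<Sum>m<tgt1 F. if m = j then (if j' = j then
           hinner (tensor (entry1 F j l) (entry1 G k j))
             (pure (entry1 F j l) (entry1 G k j) x' e)
             (pure (entry1 F j l) (entry1 G k j) x y) else 0) else 0)"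
        unfolding comp1_def dsum_def cell1.simps hilb.simps
        by (intro sum.cong refl) (auto simp: incl_def tensor_def)
      then show ?thesis using bounds e True x y
        by (auto simp: inner_pure hF hG)
    qed
    have "?L j' x' u = hinner (entry1 (G \<Zcomp>\<^sub>1 K) i j') u
        (\<lambda>m e f. ?t m (incl j' (pure (entry1 F j' l) (entry1 G m j') x' e)) f)"
      using True by (simp add: assoc_def)
    also have "\<dots> = (\<Sum>m<tgt1 G. if m = k then
         (\<Sum>e\<in>some_onb (entry1 G k j'). \<Sum>f\<in>some_onb (entry1 K i k).
            cnj (u k e f) * (if j' = j then hinner (entry1 F j l) x' x *
              hinner (entry1 G k j) e y * hinner (entry1 K i k) f z else 0)) else 0)"
      unfolding comp1_def[of G K] dsum_def tensor_def cell1.simps hilb.simps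
    proof (intro sum.cong refl, goal_cases)
      case (1 m)
      show ?case
      proof (cases "m = k")
        case [simp]: True
        have "?t k (incl j' (pure (entry1 F j' l) (entry1 G k j') x' e)) f =
            (if j' = j then hinner (entry1 F j l) x' x *
              hinner (entry1 G k j) e y * hinner (entry1 K i k) f z else 0)"
          if "e \<in> some_onb (entry1 G k j')" "f \<in> some_onb (entry1 K i k)" for e f
        proof -
          have "e \<in> hcarrier (entry1 G k j')"
            using that \<open>j' < tgt1 F \<and> _\<close> by (blast intro: hilbert_space.some_onb_closed hG)
          moreover have "f \<in> hcarrier (entry1 K i k)"
            using that by (blast intro: hilbert_space.some_onb_closed hK)
          ultimately show ?thesis
            by (simp add: incl_def[of k] pure_def[of "entry1 (F \<Zcomp>\<^sub>1 G) k l"] closed ip)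
        qed
        then show ?thesis by (simp cong: sum.cong)
      qed (simp add: incl_def)
    qed
    also have "\<dots> = ?R j' x' u"
    proof (cases "j' = j")
      case [simp]: True
      have "hinner (entry1 (G \<Zcomp>\<^sub>1 K) i j) u ?yz = (\<Sum>m<tgt1 G. if m = k then
         (\<Sum>e\<in>some_onb (entry1 G k j). \<Sum>f\<in>some_onb (entry1 K i k).
            cnj (u k e f) * (hinner (entry1 G k j) e y * hinner (entry1 K i k) f z)) else 0)"
        unfolding comp1_def dsum_def tensor_def cell1.simps hilb.simps
      proof (intro sum.cong refl, goal_cases)
        case (1 m)
        show ?case
        proof (cases "m = k")
          case [simp]: True
          show ?thesis
            by (simp, intro sum.cong refl)
              (simp add: incl_def pure_def hilbert_space.some_onb_closed[OF hG[OF bounds(1)]]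
                hilbert_space.some_onb_closed[OF hK])
        qed (simp add: incl_def)
      qed
      then show ?thesis
        using bounds \<open>j' < tgt1 F \<and> _\<close>
        by (simp add: incl_def[of j] pure_def[of "entry1 F j l"] sum_distrib_left mult_ac)
    qed (simp add: incl_def)
    finally show ?thesis .
  qed
qed


text \<open>The isomorphism \<open>(F \<Zcomp> G) \<Zcomp> (K \<Zcomp> L) \<rightarrow> (F \<Zcomp> (G \<Zcomp> K)) \<Zcomp> L\<close>.\<close>

definition group_middle where
  "group_middle F G K L = (assoc F G K \<Zcomp>\<^sub>2 id2 L) \<cdot> (assoc (F \<Zcomp>\<^sub>1 G) K L)\<^sup>\<dagger>"


section \<open>Measurements and complementarity\<close>

text \<open>A Hilbert space as a 1-cell \<open>I \<rightarrow> I\<close>.\<close>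

definition of_hilb :: "'a hilb \<Rightarrow> 'a cell1" where
  "of_hilb H = \<lparr>src1 = 1, tgt1 = 1, entry1 = (\<lambda>i j. H)\<rparr>"

definition W_L :: "nat \<Rightarrow> complex cell1" where
  "W_L n = \<lparr>src1 = 1, tgt1 = n, entry1 = (\<lambda>i j. complex_hilb)\<rparr>"

definition W_R :: "nat \<Rightarrow> complex cell1" where
  "W_R n = \<lparr>src1 = n, tgt1 = 1, entry1 = (\<lambda>i j. complex_hilb)\<rparr>"

abbreviation W_LR :: "nat \<Rightarrow> (nat \<Rightarrow> complex \<Rightarrow> complex \<Rightarrow> complex) cell1" where
  "W_LR n \<equiv> W_L n \<Zcomp>\<^sub>1 W_R n"

abbreviation W_RL :: "nat \<Rightarrow> (nat \<Rightarrow> complex \<Rightarrow> complex \<Rightarrow> complex) cell1" where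
  "W_RL n \<equiv> W_R n \<Zcomp>\<^sub>1 W_L n"

text \<open>
  The entry of \<open>W_L \<Zcomp> W_R\<close> is the \<open>n\<close>-fold direct sum of \<open>\<complex> \<otimes> \<complex>\<close>, and every entry of
  \<open>W_R \<Zcomp> W_L\<close> is a single summand \<open>\<complex> \<otimes> \<complex>\<close>; here \<open>\<complex> \<otimes> \<complex>\<close> is identified with \<open>\<complex>\<close> by
  \<open>1 \<otimes> 1 \<mapsto> 1\<close>.
\<close>

definition Create :: "nat \<Rightarrow> (complex, nat \<Rightarrow> complex \<Rightarrow> complex \<Rightarrow> complex) cell2" where
  "Create n = \<lparr>src2 = id1 1, tgt2 = W_LR n,
     entry2 = (\<lambda>i j c k. if k < n then pure complex_hilb complex_hilb c 1 else 0)\<rparr>"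

definition Copy :: "nat \<Rightarrow> (complex, nat \<Rightarrow> complex \<Rightarrow> complex \<Rightarrow> complex) cell2" where
  "Copy n = \<lparr>src2 = id1 n, tgt2 = W_RL n,
     entry2 = (\<lambda>i j c. if i = j then incl 0 (pure complex_hilb complex_hilb c 1) else 0)\<rparr>"

definition Compare :: "nat \<Rightarrow> (nat \<Rightarrow> complex \<Rightarrow> complex \<Rightarrow> complex, complex) cell2" where
  "Compare n = (Copy n)\<^sup>\<dagger>"

definition nondegenerate_measurement :: "nat \<Rightarrow> 'h::complex_vector hilb
    \<Rightarrow> ('h, nat \<Rightarrow> complex \<Rightarrow> complex \<Rightarrow> complex) cell2 \<Rightarrow> bool" where
  "nondegenerate_measurement n H M \<longleftrightarrow> M :\<^sub>2 of_hilb H \<Rightarrow> W_LR n \<and> unitary2 M"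

definition controlled_phase :: "nat \<Rightarrow> (nat \<Rightarrow> complex \<Rightarrow> complex \<Rightarrow> complex,
    nat \<Rightarrow> complex \<Rightarrow> complex \<Rightarrow> complex) cell2 \<Rightarrow> bool" where
  "controlled_phase n \<phi> \<longleftrightarrow> \<phi> :\<^sub>2 W_RL n \<Rightarrow> W_RL n \<and> unitary2 \<phi>"

definition bend :: "nat \<Rightarrow> (nat \<Rightarrow> complex \<Rightarrow> complex \<Rightarrow> complex,
    nat \<Rightarrow> complex \<Rightarrow> complex \<Rightarrow> complex) cell2
    \<Rightarrow> (nat \<Rightarrow> complex \<Rightarrow> complex \<Rightarrow> complex, nat \<Rightarrow> complex \<Rightarrow> complex \<Rightarrow> complex) cell2" where
  "bend n K =
     (lunit (W_RL n))\<^sup>\<dagger>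
     \<cdot> (Compare n \<Zcomp>\<^sub>2 id2 (W_RL n))
     \<cdot> (group_middle (W_R n) (W_L n) (W_R n) (W_L n))\<^sup>\<dagger>
     \<cdot> (id2 (W_R n) \<Zcomp>\<^sub>2 K \<Zcomp>\<^sub>2 id2 (W_L n))
     \<cdot> group_middle (W_R n) (W_L n) (W_R n) (W_L n)
     \<cdot> (id2 (W_RL n) \<Zcomp>\<^sub>2 Copy n)
     \<cdot> runit (W_RL n)"

definition horizontally_unitary :: "nat \<Rightarrow> (nat \<Rightarrow> complex \<Rightarrow> complex \<Rightarrow> complex,
    nat \<Rightarrow> complex \<Rightarrow> complex \<Rightarrow> complex) cell2 \<Rightarrow> bool" where
  "horizontally_unitary n K \<longleftrightarrow> K :\<^sub>2 W_LR n \<Rightarrow> W_LR n \<and> unitary2 (bend n K)"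

text \<open>\<open>physically_complementary n H R G \<phi>\<close> is the equation between 2-cells
  \<open>H \<Rightarrow> (W_L \<Zcomp> W_R) \<Zcomp> (W_L \<Zcomp> W_R)\<close> for the controlled phase \<open>\<phi>\<close>.\<close>

definition physically_complementary where
  "physically_complementary n H R G \<phi> \<longleftrightarrow>
     (id2 (W_LR n) \<Zcomp>\<^sub>2 (G \<cdot> R\<^sup>\<dagger>))
     \<cdot> (group_middle (W_L n) (W_R n) (W_L n) (W_R n))\<^sup>\<dagger>
     \<cdot> (id2 (W_L n) \<Zcomp>\<^sub>2 Copy n \<Zcomp>\<^sub>2 id2 (W_R n))
     \<cdot> (runit (W_L n) \<Zcomp>\<^sub>2 id2 (W_R n))
     \<cdot> R
     \<approx>\<^sub>2 complex_of_real (1 / sqrt (real n)) *\<^sub>2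
       (group_middle (W_L n) (W_R n) (W_L n) (W_R n))\<^sup>\<dagger>
       \<cdot> (id2 (W_L n) \<Zcomp>\<^sub>2 \<phi> \<Zcomp>\<^sub>2 id2 (W_R n))
       \<cdot> group_middle (W_L n) (W_R n) (W_L n) (W_R n)
       \<cdot> (R \<Zcomp>\<^sub>2 Create n)
       \<cdot> runit (of_hilb H)"

subsection \<open>The induced Frobenius algebra\<close>

definition frob_mult :: "nat \<Rightarrow> ('h::complex_vector, nat \<Rightarrow> complex \<Rightarrow> complex \<Rightarrow> complex) cell2
    \<Rightarrow> (nat \<Rightarrow> 'h \<Rightarrow> 'h \<Rightarrow> complex, 'h) cell2" where
  "frob_mult n M =
     M\<^sup>\<dagger>
     \<cdot> ((runit (W_L n))\<^sup>\<dagger> \<Zcomp>\<^sub>2 id2 (W_R n))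
     \<cdot> (id2 (W_L n) \<Zcomp>\<^sub>2 Compare n \<Zcomp>\<^sub>2 id2 (W_R n))
     \<cdot> group_middle (W_L n) (W_R n) (W_L n) (W_R n)
     \<cdot> (M \<Zcomp>\<^sub>2 M)"

definition frob_unit :: "nat \<Rightarrow> ('h::complex_vector, nat \<Rightarrow> complex \<Rightarrow> complex \<Rightarrow> complex) cell2
    \<Rightarrow> (complex, 'h) cell2" where
  "frob_unit n M = M\<^sup>\<dagger> \<cdot> Create n"

abbreviation frob_comult where "frob_comult n M \<equiv> (frob_mult n M)\<^sup>\<dagger>"
abbreviation frob_counit where "frob_counit n M \<equiv> (frob_unit n M)\<^sup>\<dagger>"

text \<open>The map \<open>S\<close> of the Coecke--Duncan condition, \<open>H \<otimes> K\<close> being \<open>H \<Zcomp> K\<close> for 1-cells \<open>I \<rightarrow> I\<close>.\<close>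

definition cd_map :: "nat \<Rightarrow> 'h::complex_vector hilb
    \<Rightarrow> ('h, nat \<Rightarrow> complex \<Rightarrow> complex \<Rightarrow> complex) cell2
    \<Rightarrow> ('h, nat \<Rightarrow> complex \<Rightarrow> complex \<Rightarrow> complex) cell2 \<Rightarrow> ('h, 'h) cell2" where
  "cd_map n H R G =
     (runit (of_hilb H))\<^sup>\<dagger>
     \<cdot> (id2 (of_hilb H) \<Zcomp>\<^sub>2 (frob_counit n G \<cdot> frob_mult n G))
     \<cdot> assoc (of_hilb H) (of_hilb H) (of_hilb H)
     \<cdot> ((frob_comult n R \<cdot> frob_unit n R) \<Zcomp>\<^sub>2 id2 (of_hilb H))
     \<cdot> lunit (of_hilb H)"

definition coecke_duncan where
  "coecke_duncan n H R G \<longleftrightarrow>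
     complex_of_nat n *\<^sub>2
       frob_mult n R \<cdot> (cd_map n H R G \<Zcomp>\<^sub>2 id2 (of_hilb H)) \<cdot> frob_comult n G
     \<approx>\<^sub>2 frob_unit n R \<cdot> frob_counit n G"

end

theory Submission
  imports Defs
begin

text \<open>
  A nondegenerate measurement is an orthonormal basis in disguise: the preimages of the standard
  basis of \<open>W_L \<Zcomp> W_R = \<complex>\<^sup>n\<close> under \<open>M\<close> form an orthonormal basis of \<open>H\<close>, and every \<open>n\<close>-element
  orthonormal basis arises in this way. Let \<open>r\<^sub>i\<close> and \<open>g\<^sub>k\<close> be the bases belonging to \<open>R\<close> and \<open>G\<close>.
  Each of the three conditions is shown to say that the bases are mutually unbiased:
  \<open>n |\<langle>g\<^sub>k, r\<^sub>i\<rangle>|\<^sup>2 = 1\<close> for all \<open>i\<close> and \<open>k\<close>.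

  \<^item> Every entry of \<open>W_R \<Zcomp> W_L\<close> is one-dimensional, so an endomorphism of it is a matrix of scalars,
    and it is unitary exactly if all these scalars have modulus 1 (\<open>unitary2_iff_coeff\<close>).
    Bending turns the linear map \<open>K\<close> on \<open>\<complex>\<^sup>n\<close> into the matrix of its own matrix elements
    (\<open>coeff_bend\<close>), and those of \<open>\<surd>n G R\<^sup>\<dagger>\<close> are \<open>\<surd>n \<langle>g\<^sub>k, r\<^sub>i\<rangle>\<close>.

  \<^item> In the equation of physical complementarity both sides send \<open>r\<^sub>j\<close> to a combination of the
    vectors \<open>e\<^sub>j \<otimes> e\<^sub>i\<close>, with coefficients \<open>\<langle>g\<^sub>i, r\<^sub>j\<rangle>\<close> on the left and \<open>\<phi>\<^sub>i\<^sub>j / \<surd>n\<close> on the right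
    (\<open>physically_complementary_iff\<close>). So \<open>\<phi>\<close> is forced, and it is a controlled phase exactly if
    the bases are mutually unbiased.

  \<^item> The algebra induced by \<open>M\<close> multiplies its basis by \<open>m\<^sub>i m\<^sub>j = \<delta>\<^sub>i\<^sub>j m\<^sub>i\<close>, hence its comultiplication
    copies the \<open>m\<^sub>i\<close>. Its unit is their sum, hence its counit sends each of them to 1. This gives
    \<open>S g\<^sub>k = \<Sum>\<^sub>i \<langle>g\<^sub>k, r\<^sub>i\<rangle> r\<^sub>i\<close> (\<open>cd_map_outcome\<close>), and the two sides of the Coecke--Duncan
    condition send \<open>g\<^sub>k\<close> to \<open>n \<Sum>\<^sub>i |\<langle>g\<^sub>k, r\<^sub>i\<rangle>|\<^sup>2 r\<^sub>i\<close> and to \<open>\<Sum>\<^sub>i r\<^sub>i\<close> (\<open>coecke_duncan_iff\<close>).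

  What makes these computations possible is that every 2-cell involved is linear, and that the
  entries of composite 1-cells are spanned by elementary tensors lying in a single summand
  (\<open>span_comp1\<close>). On such tensors horizontal composites act factorwise (\<open>hcomp_tens\<close>) and the
  coherence isomorphisms merely move brackets (\<open>group_middle_tens\<close>). Daggers are evaluated by
  comparing inner products with a spanning set (\<open>dagger_eqI\<close>).
\<close>

section \<open>Linear maps and spanning sets\<close>

lemma sum_apply: "(\<Sum>k\<in>I. f k) x = (\<Sum>k\<in>I. f k x)"
  for f :: "'i \<Rightarrow> 'a \<Rightarrow> 'b::comm_monoid_add"
  by (induction I rule: infinite_finite_induct) simp_all

lemma linear_map_closed: "linear_map V W f \<Longrightarrow> x \<in> hcarrier V \<Longrightarrow> f x \<in> hcarrier W"
  by (simp add: linear_map_def)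

lemma linear_map_add:
  "linear_map V W f \<Longrightarrow> x \<in> hcarrier V \<Longrightarrow> y \<in> hcarrier V \<Longrightarrow> f (x + y) = f x + f y"
  by (simp add: linear_map_def)

lemma linear_map_scale:
  "linear_map V W f \<Longrightarrow> x \<in> hcarrier V \<Longrightarrow> f (c *\<^sub>C x) = c *\<^sub>C f x"
  by (simp add: linear_map_def)

lemma linear_map_zero:
  assumes "hilbert_space V" "linear_map V W f"
  shows "f 0 = 0"
  using linear_map_scale[OF assms(2) hilbert_space.zero_closed[OF assms(1)], of 0] by simp

lemma linear_map_sum:
  assumes V: "hilbert_space V" and f: "linear_map V W f"
    and x: "\<And>i. i \<in> I \<Longrightarrow> x i \<in> hcarrier V"
  shows "f (\<Sum>i\<in>I. x i) = (\<Sum>i\<in>I. f (x i))"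
  using x
  by (induction I rule: infinite_finite_induct)
    (simp_all add: linear_map_zero[OF V f] linear_map_add[OF f] hilbert_space.sum_closed[OF V])

lemma linear_map_lincomb:
  assumes V: "hilbert_space V" and f: "linear_map V W f"
    and x: "\<And>i. i \<in> I \<Longrightarrow> x i \<in> hcarrier V"
  shows "f (\<Sum>i\<in>I. c i *\<^sub>C x i) = (\<Sum>i\<in>I. c i *\<^sub>C f (x i))"
  by (simp add: linear_map_sum[OF V f] linear_map_scale[OF f] hilbert_space.scale_closed[OF V] x)

lemma linear_map_comp:
  "linear_map U V f \<Longrightarrow> linear_map V W g \<Longrightarrow> linear_map U W (\<lambda>x. g (f x))"
  by (simp add: linear_map_def)

lemma linear_map_id: "linear_map V V (\<lambda>x. x)"
  by (simp add: linear_map_def)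

text \<open>Here \<open>0\<close> is the zero function; it is the off-diagonal entry of \<open>Copy\<close>.\<close>

lemma linear_map_0: "hilbert_space W \<Longrightarrow> linear_map V W 0"
  by (simp add: linear_map_def hilbert_space.zero_closed complex_vector.scale_zero_right)

lemma linear_map_scaled:
  "hilbert_space W \<Longrightarrow> linear_map V W f \<Longrightarrow> linear_map V W (\<lambda>x. c *\<^sub>C f x)"
  by (simp add: linear_map_def hilbert_space.scale_closed scaleC_add_right scaleC_scaleC mult.commute)

lemma linear_map_sum_fun:
  assumes W: "hilbert_space W" and f: "\<And>k. k \<in> I \<Longrightarrow> linear_map V W (f k)"
  shows "linear_map V W (\<lambda>x. \<Sum>k\<in>I. f k x)"
proof -
  have "(\<Sum>k\<in>I. f k x) \<in> hcarrier W" if "x \<in> hcarrier V" for x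
    using f that by (intro hilbert_space.sum_closed[OF W]) (simp add: linear_map_def)
  moreover have "(\<Sum>k\<in>I. f k (x + y)) = (\<Sum>k\<in>I. f k x) + (\<Sum>k\<in>I. f k y)"
    if "x \<in> hcarrier V" "y \<in> hcarrier V" for x y
    using f that by (simp add: linear_map_def sum.distrib[symmetric])
  moreover have "(\<Sum>k\<in>I. f k (c *\<^sub>C x)) = c *\<^sub>C (\<Sum>k\<in>I. f k x)" if "x \<in> hcarrier V" for c x
    using f that by (simp add: linear_map_def complex_vector.scale_sum_right)
  ultimately show ?thesis by (simp add: linear_map_def)
qed

text \<open>The adjoint is linear because \<open>adj_inner\<close> determines it: additivity and homogeneity hold
  after pairing with an arbitrary vector, and vectors with the same pairings are equal.\<close>

lemma linear_map_adj:
  assumes V: "hilbert_space V" and W: "hilbert_space W" and f: "linear_map V W f"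
  shows "linear_map W V (adj V W f)"
proof -
  interpret V: hilbert_space V by fact
  interpret W: hilbert_space W by fact
  note [simp] = adj_closed[OF V W f] adj_inner[OF V W f] linear_map_closed[OF f]
    W.add_closed V.add_closed W.scale_closed V.scale_closed
  show ?thesis
    unfolding linear_map_def
  proof (intro conjI ballI allI)
    fix y z c assume [simp]: "y \<in> hcarrier W" "z \<in> hcarrier W"
    show "adj V W f (y + z) = adj V W f y + adj V W f z"
      by (rule V.inner_eqI) (simp_all add: V.inner_add_left W.inner_add_left)
    show "adj V W f (c *\<^sub>C y) = c *\<^sub>C adj V W f y"
      by (rule V.inner_eqI) (simp_all add: V.inner_scale_left W.inner_scale_left)
  qed simp
qed

lemma spanning_subset: "cspan S = hcarrier V \<Longrightarrow> S \<subseteq> hcarrier V"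
  using complex_vector.span_superset[of S] by simp

text \<open>The set on which two linear maps agree is a subspace, so it contains the span of any of its
  subsets.\<close>

lemma span_eqI:
  assumes V: "hilbert_space V" and S: "cspan S = hcarrier V" and x: "x \<in> hcarrier V"
    and f: "linear_map V W f" and g: "linear_map V W g"
    and eq: "\<And>s. s \<in> S \<Longrightarrow> f s = g s"
  shows "f x = g x"
proof -
  interpret V: hilbert_space V by fact
  have "csubspace {x \<in> hcarrier V. f x = g x}"
    by (rule complex_vector.subspaceI)
      (auto simp: V.zero_closed V.add_closed V.scale_closed linear_map_add[OF f]
        linear_map_add[OF g] linear_map_scale[OF f] linear_map_scale[OF g]
        linear_map_zero[OF V f] linear_map_zero[OF V g])
  then have "cspan S \<subseteq> {x \<in> hcarrier V. f x = g x}"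
    by (rule complex_vector.span_minimal[rotated]) (use eq spanning_subset[OF S] in auto)
  then show ?thesis using S x by auto
qed

text \<open>This is how a spanning set of a composite space is obtained from spanning sets of its parts,
  one inclusion or one tensor factor at a time.\<close>

lemma linear_preimage_span:
  assumes V: "hilbert_space V" and f: "linear_map V W f" and S: "cspan S = hcarrier V"
    and T: "\<And>s. s \<in> S \<Longrightarrow> f s \<in> cspan T" and x: "x \<in> hcarrier V"
  shows "f x \<in> cspan T"
proof -
  interpret V: hilbert_space V by fact
  have "csubspace {x \<in> hcarrier V. f x \<in> cspan T}"
    by (rule complex_vector.subspaceI)
      (auto simp: V.zero_closed V.add_closed V.scale_closed linear_map_zero[OF V f]
        linear_map_add[OF f] linear_map_scale[OF f] complex_vector.span_zero
        complex_vector.span_add complex_vector.span_scale)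
  then have "cspan S \<subseteq> {x \<in> hcarrier V. f x \<in> cspan T}"
    by (rule complex_vector.span_minimal[rotated]) (use T spanning_subset[OF S] in auto)
  then show ?thesis using S x by auto
qed

text \<open>Both sides of the hypothesis are linear in \<open>s\<close>, so it extends from \<open>S\<close> to the whole space, where
  it characterises the adjoint. This is the means by which daggers are evaluated.\<close>

lemma adj_eqI:
  assumes V: "hilbert_space V" and W: "hilbert_space W" and f: "linear_map V W f"
    and S: "cspan S = hcarrier V" and x: "x \<in> hcarrier V" and y: "y \<in> hcarrier W"
    and eq: "\<And>s. s \<in> S \<Longrightarrow> hinner V x s = hinner W y (f s)"
  shows "adj V W f y = x"
proof -
  interpret V: hilbert_space V by fact
  interpret W: hilbert_space W by fact
  have 1: "linear_map V complex_hilb (hinner V x)"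
    using x by (simp add: linear_map_def complex_hilb_def V.inner_add V.inner_scale scaleC_complex_def)
  have 2: "linear_map V complex_hilb (\<lambda>v. hinner W y (f v))"
    using y linear_map_closed[OF f]
    by (simp add: linear_map_def complex_hilb_def W.inner_add W.inner_scale scaleC_complex_def
        linear_map_add[OF f] linear_map_scale[OF f])
  show ?thesis
    by (rule V.inner_eqI)
      (use span_eqI[OF V S _ 1 2 eq] x in \<open>auto simp: adj_closed[OF V W f y] adj_inner[OF V W f y]\<close>)
qed

section \<open>Direct sums and tensor products of Hilbert spaces\<close>

lemma span_complex: "cspan {1} = hcarrier complex_hilb"
  by (auto simp: complex_hilb_def complex_vector.span_singleton scaleC_complex_def)

lemma hilbert_space_complex: "hilbert_space complex_hilb"
proof
  show "csubspace (hcarrier complex_hilb)"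
    by (rule complex_vector.subspaceI) (auto simp: complex_hilb_def)
  show "\<exists>B. finite B \<and> cspan B = hcarrier complex_hilb"
    by (intro exI[of _ "{1}"]) (simp add: span_complex)
qed (auto simp: complex_hilb_def scaleC_complex_def algebra_simps complex_eq_iff
    add_pos_nonneg add_nonneg_pos sum_power2_gt_zero_iff power2_eq_square[symmetric])

lemma hilbert_space_zero: "hilbert_space zero_hilb"
proof
  show "\<exists>B. finite B \<and> cspan B = hcarrier zero_hilb"
    by (intro exI[of _ "{}"]) (simp add: zero_hilb_def)
qed (auto simp: zero_hilb_def)

lemma incl_add: "incl j (x + y) = incl j x + incl j (y::'a::monoid_add)"
  by (auto simp: incl_def fun_eq_iff)

lemma incl_scale: "incl j (c *\<^sub>C x) = c *\<^sub>C incl j x"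
  by (auto simp: incl_def fun_eq_iff scaleC_fun_def)

lemma incl_closed:
  assumes "\<And>j. j < n \<Longrightarrow> hilbert_space (V j)" "j < n" "x \<in> hcarrier (V j)"
  shows "incl j x \<in> hcarrier (dsum n V)"
  using assms by (auto simp: dsum_def incl_def hilbert_space.zero_closed)

lemma linear_map_incl:
  assumes "\<And>j. j < n \<Longrightarrow> hilbert_space (V j)" "j < n"
  shows "linear_map (V j) (dsum n V) (incl j)"
  using incl_closed[of n V j] assms by (simp add: linear_map_def incl_add incl_scale)

lemma inner_incl:
  assumes V: "\<And>j. j < n \<Longrightarrow> hilbert_space (V j)" and "j < n" "k < n"
    "x \<in> hcarrier (V j)" "y \<in> hcarrier (V k)"
  shows "hinner (dsum n V) (incl j x) (incl k y) = (if j = k then hinner (V j) x y else 0)"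
proof -
  have "hinner (dsum n V) (incl j x) (incl k y)
      = (\<Sum>m<n. if m = j then hinner (V j) x (incl k y j) else 0)"
    unfolding dsum_def hilb.simps
  proof (intro sum.cong refl)
    fix m assume m: "m \<in> {..<n}"
    interpret hilbert_space "V m" using V m by simp
    have "incl k y m \<in> hcarrier (V m)" using assms by (auto simp: incl_def zero_closed)
    then have "hinner (V m) 0 (incl k y m) = 0"
      using inner_commute[of "incl k y m" 0] by (simp add: inner_zero zero_closed)
    then show "hinner (V m) (incl j x m) (incl k y m)
        = (if m = j then hinner (V j) x (incl k y j) else 0)"
      by (simp add: incl_def)
  qed
  also have "\<dots> = (if j = k then hinner (V j) x y else 0)"
    using assms by (auto simp: incl_def hilbert_space.inner_zero)
  finally show ?thesis .
qed

lemma subspace_dsum: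
  assumes V: "\<And>j. j < n \<Longrightarrow> hilbert_space (V j)"
  shows "csubspace (hcarrier (dsum n V))"
  by (rule complex_vector.subspaceI)
    (auto simp: dsum_def V hilbert_space.zero_closed hilbert_space.add_closed
      hilbert_space.scale_closed scaleC_fun_def complex_vector.scale_zero_right)

text \<open>An element of the sum is the sum of its components.\<close>

lemma span_dsum:
  assumes V: "\<And>j. j < n \<Longrightarrow> hilbert_space (V j)"
    and S: "\<And>j. j < n \<Longrightarrow> cspan (S j) = hcarrier (V j)"
  shows "cspan {incl j x | j x. j < n \<and> x \<in> S j} = hcarrier (dsum n V)" (is "cspan ?T = _")
proof
  show "cspan ?T \<subseteq> hcarrier (dsum n V)"
    by (rule complex_vector.span_minimal[OF _ subspace_dsum[OF V]])
      (use spanning_subset[OF S] in \<open>auto intro!: incl_closed V\<close>)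
  show "hcarrier (dsum n V) \<subseteq> cspan ?T"
  proof
    fix v assume v: "v \<in> hcarrier (dsum n V)"
    have "incl j x \<in> cspan ?T" if j: "j < n" and x: "x \<in> hcarrier (V j)" for j x
      by (rule linear_preimage_span[OF V[OF j] linear_map_incl[of n V, OF V j] S[OF j] _ x])
        (use j in \<open>auto intro!: complex_vector.span_base\<close>)
    then have "(\<Sum>j<n. incl j (v j)) \<in> cspan ?T"
      using v by (intro complex_vector.span_sum) (auto simp: dsum_def)
    moreover have "(\<Sum>j<n. incl j (v j)) = v"
    proof
      fix k
      have "(\<Sum>j<n. incl j (v j)) k = (\<Sum>j<n. incl j (v j) k)" by (rule sum_apply)
      also have "\<dots> = v k" using v by (simp add: incl_def dsum_def)
      finally show "(\<Sum>j<n. incl j (v j)) k = v k" .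
    qed
    ultimately show "v \<in> cspan ?T" by simp
  qed
qed

lemma hilbert_space_dsum:
  assumes V: "\<And>j. j < n \<Longrightarrow> hilbert_space (V j)"
  shows "hilbert_space (dsum n V)"
proof
  show "csubspace (hcarrier (dsum n V))" using subspace_dsum[OF V] .
  have onb: "onb_of (V j) (some_onb (V j))" if "j < n" for j
    using hilbert_space.onb_of_some_onb[OF V[OF that]] .
  have "{incl j x | j x. j < n \<and> x \<in> some_onb (V j)} = (\<Union>j<n. incl j ` some_onb (V j))" by auto
  then have "finite {incl j x | j x. j < n \<and> x \<in> some_onb (V j)}"
    using onb by (auto simp: onb_of_def)
  moreover have "cspan {incl j x | j x. j < n \<and> x \<in> some_onb (V j)} = hcarrier (dsum n V)"
    by (rule span_dsum[OF V]) (use onb in \<open>auto simp: onb_of_def\<close>)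
  ultimately show "\<exists>B. finite B \<and> cspan B = hcarrier (dsum n V)" by blast
next
  fix x assume x: "x \<in> hcarrier (dsum n V)" "x \<noteq> 0"
  then obtain k where k: "x k \<noteq> 0" by (auto simp: fun_eq_iff)
  with x have kn: "k < n" by (auto simp: dsum_def leI)
  \<comment> \<open>Positivity in a summand excludes the zero vector, but some components of \<open>x\<close> may vanish.\<close>
  have ge: "0 \<le> Re (hinner (V j) (x j) (x j))" if "j < n" for j
  proof (cases "x j = 0")
    case True
    then show ?thesis using hilbert_space.inner_zero[OF V hilbert_space.zero_closed[OF V]] that by simp
  next
    case False
    then show ?thesis using hilbert_space.inner_pos[OF V[OF that], of "x j"] x that
      by (auto simp: dsum_def)
  qed
  have "0 < (\<Sum>j<n. Re (hinner (V j) (x j) (x j)))"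
    by (rule sum_pos2[of _ k]) (use kn k ge x hilbert_space.inner_pos[OF V[OF kn], of "x k"] in \<open>auto simp: dsum_def\<close>)
  then show "0 < Re (hinner (dsum n V) x x)" by (simp add: dsum_def)
next
  fix x y assume "x \<in> hcarrier (dsum n V)" "y \<in> hcarrier (dsum n V)"
  then show "hinner (dsum n V) y x = cnj (hinner (dsum n V) x y)"
    by (simp add: dsum_def) (intro sum.cong refl, metis V lessThan_iff hilbert_space.inner_commute)
qed (simp_all add: dsum_def hilbert_space.inner_add[OF V] hilbert_space.inner_scale[OF V]
    sum.distrib scaleC_fun_def sum_distrib_left)

lemma tensor_carrier_iff:
  "t \<in> hcarrier (tensor V W) \<longleftrightarrow>
       (\<forall>x y. x \<notin> hcarrier V \<or> y \<notin> hcarrier W \<longrightarrow> t x y = 0) \<and>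
       (\<forall>x\<in>hcarrier V. \<forall>x'\<in>hcarrier V. \<forall>y\<in>hcarrier W. t (x + x') y = t x y + t x' y) \<and>
       (\<forall>x\<in>hcarrier V. \<forall>y\<in>hcarrier W. \<forall>y'\<in>hcarrier W. t x (y + y') = t x y + t x y') \<and>
       (\<forall>c. \<forall>x\<in>hcarrier V. \<forall>y\<in>hcarrier W. t (c *\<^sub>C x) y = cnj c * t x y) \<and>
       (\<forall>c. \<forall>x\<in>hcarrier V. \<forall>y\<in>hcarrier W. t x (c *\<^sub>C y) = cnj c * t x y)"
  by (simp add: tensor_def)

lemma tensor_add_left:
  "t \<in> hcarrier (tensor V W) \<Longrightarrow> x \<in> hcarrier V \<Longrightarrow> x' \<in> hcarrier V \<Longrightarrow> y \<in> hcarrier W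
    \<Longrightarrow> t (x + x') y = t x y + t x' y"
  unfolding tensor_carrier_iff by metis

lemma tensor_scale_left:
  "t \<in> hcarrier (tensor V W) \<Longrightarrow> x \<in> hcarrier V \<Longrightarrow> y \<in> hcarrier W \<Longrightarrow> t (c *\<^sub>C x) y = cnj c * t x y"
  unfolding tensor_carrier_iff by metis

lemma inner_tensor:
  "hinner (tensor V W) s t = (\<Sum>e\<in>some_onb V. \<Sum>f\<in>some_onb W. cnj (s e f) * t e f)"
  by (simp add: tensor_def)

lemma subspace_tensor:
  assumes "hilbert_space V" "hilbert_space W"
  shows "csubspace (hcarrier (tensor V W))"
proof -
  interpret V: hilbert_space V by fact
  interpret W: hilbert_space W by fact
  show ?thesis
    by (rule complex_vector.subspaceI)
      (auto simp: tensor_carrier_iff scaleC_fun_def scaleC_complex_def algebra_simps)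
qed

text \<open>A form is determined by its values on orthonormal bases: expand both arguments and use
  conjugate-linearity. The coefficients \<open>t e f\<close> then turn up in front of the elementary tensors,
  because \<open>cnj \<langle>e, x\<rangle> cnj \<langle>f, y\<rangle> = \<langle>x, e\<rangle> \<langle>y, f\<rangle>\<close> is the value of the form \<open>e \<otimes> f\<close> at \<open>(x, y)\<close>.\<close>

lemma pure_expansion:
  assumes "hilbert_space V" "hilbert_space W" and t: "t \<in> hcarrier (tensor V W)"
  shows "t = (\<Sum>e\<in>some_onb V. \<Sum>f\<in>some_onb W. t e f *\<^sub>C pure V W e f)"
proof (intro ext)
  interpret V: hilbert_space V by fact
  interpret W: hilbert_space W by fact
  fix x y
  have R: "(\<Sum>e\<in>some_onb V. \<Sum>f\<in>some_onb W. t e f *\<^sub>C pure V W e f) x y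
      = (\<Sum>e\<in>some_onb V. \<Sum>f\<in>some_onb W. t e f * pure V W e f x y)"
    by (simp add: sum_apply scaleC_fun_def scaleC_complex_def)
  show "t x y = (\<Sum>e\<in>some_onb V. \<Sum>f\<in>some_onb W. t e f *\<^sub>C pure V W e f) x y"
  proof (cases "x \<in> hcarrier V \<and> y \<in> hcarrier W")
    case False
    then have "pure V W e f x y = 0" "t x y = 0" for e f
      using t by (auto simp: tensor_carrier_iff pure_def)
    then show ?thesis by (simp add: R)
  next
    case True
    have suml: "t (\<Sum>e\<in>E. a e *\<^sub>C g e) y = (\<Sum>e\<in>E. cnj (a e) * t (g e) y)"
      if "\<And>e. e \<in> E \<Longrightarrow> g e \<in> hcarrier V" "y \<in> hcarrier W" for E :: "'a set" and g a y
    proof -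
      have "t (0 *\<^sub>C 0) y = 0" using t that(2) V.zero_closed by (simp add: tensor_carrier_iff del: complex_vector.scale_zero_left complex_vector.scale_zero_right)
      then have "t 0 y = 0" by simp
      with that(1) show ?thesis
        by (induction E rule: infinite_finite_induct)
          (use t that(2) in \<open>simp_all add: tensor_carrier_iff V.scale_closed V.sum_closed\<close>)
    qed
    have sumr: "t x (\<Sum>e\<in>E. a e *\<^sub>C g e) = (\<Sum>e\<in>E. cnj (a e) * t x (g e))"
      if "\<And>e. e \<in> E \<Longrightarrow> g e \<in> hcarrier W" "x \<in> hcarrier V" for E :: "'b set" and g a x
    proof -
      have "t x (0 *\<^sub>C 0) = 0" using t that(2) W.zero_closed by (simp add: tensor_carrier_iff del: complex_vector.scale_zero_left complex_vector.scale_zero_right)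
      then have "t x 0 = 0" by simp
      with that(1) show ?thesis
        by (induction E rule: infinite_finite_induct)
          (use t that(2) in \<open>simp_all add: tensor_carrier_iff W.scale_closed W.sum_closed\<close>)
    qed
    have "t x y = t (\<Sum>e\<in>some_onb V. hinner V e x *\<^sub>C e) (\<Sum>f\<in>some_onb W. hinner W f y *\<^sub>C f)"
      using V.onb_expand[OF V.onb_of_some_onb] W.onb_expand[OF W.onb_of_some_onb] True by simp
    also have "\<dots> = (\<Sum>e\<in>some_onb V. \<Sum>f\<in>some_onb W.
        cnj (hinner V e x) * (cnj (hinner W f y) * t e f))"
      by (subst suml) (auto simp: sumr V.some_onb_closed W.some_onb_closed W.sum_closed
          W.scale_closed sum_distrib_left)
    also have "\<dots> = (\<Sum>e\<in>some_onb V. \<Sum>f\<in>some_onb W. t e f * pure V W e f x y)"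
      using True by (intro sum.cong refl)
        (simp add: pure_def V.inner_commute[of _ x] W.inner_commute[of _ y] V.some_onb_closed W.some_onb_closed)
    finally show ?thesis by (simp add: R)
  qed
qed

lemma linear_map_pure_left:
  assumes "hilbert_space V" "hilbert_space W" "y \<in> hcarrier W"
  shows "linear_map V (tensor V W) (\<lambda>x. pure V W x y)"
proof -
  interpret V: hilbert_space V by fact
  show ?thesis
    using assms by (auto simp: linear_map_def pure_closed)
     (auto simp: pure_def fun_eq_iff V.inner_add V.inner_scale scaleC_fun_def scaleC_complex_def algebra_simps)
qed

lemma linear_map_pure_right:
  assumes "hilbert_space V" "hilbert_space W" "x \<in> hcarrier V"
  shows "linear_map W (tensor V W) (pure V W x)"
proof -
  interpret W: hilbert_space W by fact
  show ?thesis
    using assms by (auto simp: linear_map_def pure_closed)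
     (auto simp: pure_def fun_eq_iff W.inner_add W.inner_scale scaleC_fun_def scaleC_complex_def algebra_simps)
qed

text \<open>Since \<open>x \<otimes> y\<close> is linear in each factor, every elementary tensor lies in the span of those with
  factors from \<open>S\<close> and \<open>T\<close>, and by \<open>pure_expansion\<close> elementary tensors span.\<close>

lemma span_tensor:
  assumes V: "hilbert_space V" and W: "hilbert_space W"
    and S: "cspan S = hcarrier V" and T: "cspan T = hcarrier W"
  shows "cspan {pure V W x y | x y. x \<in> S \<and> y \<in> T} = hcarrier (tensor V W)" (is "cspan ?P = _")
proof
  interpret V: hilbert_space V by fact
  interpret W: hilbert_space W by fact
  show "cspan ?P \<subseteq> hcarrier (tensor V W)"
    by (rule complex_vector.span_minimal[OF _ subspace_tensor[OF V W]])
      (use spanning_subset[OF S] spanning_subset[OF T] in \<open>auto intro!: pure_closed V W\<close>)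
  have 1: "pure V W x y \<in> cspan ?P" if "x \<in> hcarrier V" "y \<in> T" for x y
    by (rule linear_preimage_span[OF V linear_map_pure_left[OF V W] S])
      (use that spanning_subset[OF T] in \<open>auto intro!: complex_vector.span_base\<close>)
  have 2: "pure V W x y \<in> cspan ?P" if "x \<in> hcarrier V" "y \<in> hcarrier W" for x y
    by (rule linear_preimage_span[OF W linear_map_pure_right[OF V W] T]) (use that 1 in auto)
  have "(\<Sum>e\<in>some_onb V. \<Sum>f\<in>some_onb W. t e f *\<^sub>C pure V W e f) \<in> cspan ?P" for t
    by (intro 2 complex_vector.span_sum complex_vector.span_scale V.some_onb_closed W.some_onb_closed)
  then show "hcarrier (tensor V W) \<subseteq> cspan ?P"
    by (intro subsetI) (rule ssubst[OF pure_expansion[OF V W]])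
qed

text \<open>For a form \<open>t\<close> the value \<open>\<langle>t, t\<rangle>\<close> is the sum of all \<open>|t e f|\<^sup>2\<close> over two orthonormal bases, and by
  \<open>pure_expansion\<close> these values vanish simultaneously only for \<open>t = 0\<close>.\<close>

lemma hilbert_space_tensor:
  assumes V: "hilbert_space V" and W: "hilbert_space W"
  shows "hilbert_space (tensor V W)"
proof
  interpret V: hilbert_space V by fact
  interpret W: hilbert_space W by fact
  have onb: "finite (some_onb V)" "finite (some_onb W)" "cspan (some_onb V) = hcarrier V"
    "cspan (some_onb W) = hcarrier W"
    using V.onb_of_some_onb W.onb_of_some_onb by (auto simp: onb_of_def)
  show "csubspace (hcarrier (tensor V W))" using subspace_tensor[OF V W] .
  have "{pure V W x y | x y. x \<in> some_onb V \<and> y \<in> some_onb W}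
      = (\<lambda>(x, y). pure V W x y) ` (some_onb V \<times> some_onb W)" by auto
  then have "finite {pure V W x y | x y. x \<in> some_onb V \<and> y \<in> some_onb W}"
    using onb by simp
  then show "\<exists>B. finite B \<and> cspan B = hcarrier (tensor V W)"
    using span_tensor[OF V W onb(3,4)] by blast
  fix t assume t: "t \<in> hcarrier (tensor V W)" "t \<noteq> 0"
  have "\<exists>e\<in>some_onb V. \<exists>f\<in>some_onb W. t e f \<noteq> 0"
  proof (rule ccontr)
    assume "\<not> ?thesis"
    then have "(\<Sum>e\<in>some_onb V. \<Sum>f\<in>some_onb W. t e f *\<^sub>C pure V W e f) = 0" by simp
    then show False using pure_expansion[OF V W t(1)] t(2) by simp
  qed
  then obtain e f where ef: "e \<in> some_onb V" "f \<in> some_onb W" "t e f \<noteq> 0" by blast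
  have "0 < (\<Sum>e\<in>some_onb V. \<Sum>f\<in>some_onb W. (cmod (t e f))\<^sup>2)"
    by (intro sum_pos2[of _ e] sum_nonneg sum_pos2[of _ f]) (use onb ef in auto)
  moreover have "Re (cnj z * z) = (cmod z)\<^sup>2" for z
    unfolding cmod_power2 by (simp add: power2_eq_square)
  ultimately show "0 < Re (hinner (tensor V W) t t)"
    by (simp only: inner_tensor Re_sum)
next
  fix r s t :: "'a \<Rightarrow> 'b \<Rightarrow> complex" and c
  show "hinner (tensor V W) r (s + t) = hinner (tensor V W) r s + hinner (tensor V W) r t"
    unfolding inner_tensor sum.distrib[symmetric]
    by (intro sum.cong refl) (simp add: distrib_left)
  show "hinner (tensor V W) r (c *\<^sub>C s) = c * hinner (tensor V W) r s"
    unfolding inner_tensor sum_distrib_left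
    by (intro sum.cong refl) (simp add: scaleC_fun_def scaleC_complex_def)
  show "hinner (tensor V W) s r = cnj (hinner (tensor V W) r s)"
    unfolding inner_tensor cnj_sum by (intro sum.cong refl) simp
qed

text \<open>\<open>f \<otimes> g\<close> precomposes a form with the adjoints of \<open>f\<close> and \<open>g\<close>; these are linear, so the result is
  conjugate-linear in both arguments again.\<close>

lemma linear_map_tensor_map:
  assumes V: "hilbert_space V" "hilbert_space V'" "hilbert_space W" "hilbert_space W'"
    and f: "linear_map V V' f" and g: "linear_map W W' g"
  shows "linear_map (tensor V W) (tensor V' W') (tensor_map V V' W W' f g)"
proof -
  note adjf = linear_map_adj[OF V(1,2) f] and adjg = linear_map_adj[OF V(3,4) g]
  have "tensor_map V V' W W' f g t \<in> hcarrier (tensor V' W')"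
    if t: "t \<in> hcarrier (tensor V W)" for t
  proof -
    let ?s = "tensor_map V V' W W' f g t"
    have addl: "t (x + x') y = t x y + t x' y"
      if "x \<in> hcarrier V" "x' \<in> hcarrier V" "y \<in> hcarrier W" for x x' y
      using t that unfolding tensor_carrier_iff by metis
    have addr: "t x (y + y') = t x y + t x y'"
      if "x \<in> hcarrier V" "y \<in> hcarrier W" "y' \<in> hcarrier W" for x y y'
      using t that unfolding tensor_carrier_iff by metis
    have scale: "t (c *\<^sub>C x) y = cnj c * t x y" "t x (c *\<^sub>C y) = cnj c * t x y"
      if "x \<in> hcarrier V" "y \<in> hcarrier W" for c x y
      using t that unfolding tensor_carrier_iff by metis+
    note closed = linear_map_closed[OF adjf] linear_map_closed[OF adjg]
    have s: "?s x y = t (adj V V' f x) (adj W W' g y)"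
      if "x \<in> hcarrier V'" "y \<in> hcarrier W'" for x y
      using that by (simp add: tensor_map_def)
    show ?thesis
      unfolding tensor_carrier_iff
    proof (intro conjI allI ballI impI)
      fix x y assume "x \<notin> hcarrier V' \<or> y \<notin> hcarrier W'"
      then show "?s x y = 0" by (auto simp: tensor_map_def)
    qed (simp_all add: s closed addl addr scale linear_map_add[OF adjf] linear_map_add[OF adjg]
        linear_map_scale[OF adjf] linear_map_scale[OF adjg]
        hilbert_space.add_closed[OF V(2)] hilbert_space.add_closed[OF V(4)]
        hilbert_space.scale_closed[OF V(2)] hilbert_space.scale_closed[OF V(4)])
  qed
  then show ?thesis
    unfolding linear_map_def
    by (auto simp: tensor_map_def fun_eq_iff scaleC_fun_def)
qed

section \<open>Composition of cells on elementary tensors\<close>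

lemma comp1_sel [simp]: "src1 (F \<Zcomp>\<^sub>1 G) = src1 F" "tgt1 (F \<Zcomp>\<^sub>1 G) = tgt1 G"
  by (simp_all add: comp1_def)

lemma entry1_comp1:
  "entry1 (F \<Zcomp>\<^sub>1 G) i k = dsum (tgt1 F) (\<lambda>j. tensor (entry1 F j k) (entry1 G i j))"
  by (simp add: comp1_def)

lemma hilbert_entry1:
  "is_cell1 F \<Longrightarrow> i < tgt1 F \<Longrightarrow> j < src1 F \<Longrightarrow> hilbert_space (entry1 F i j)"
  by (simp add: is_cell1_def)

lemma is_cell1_comp1 [simp]:
  assumes "is_cell1 F" "is_cell1 G" "src1 G = tgt1 F"
  shows "is_cell1 (F \<Zcomp>\<^sub>1 G)"
  unfolding is_cell1_def entry1_comp1 using assms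
  by (auto intro!: hilbert_space_dsum hilbert_space_tensor hilbert_entry1)

text \<open>The elementary tensor \<open>x \<otimes> y\<close> in the \<open>j\<close>-th summand of the entry of \<open>F \<Zcomp> G\<close> in row \<open>i\<close> and column \<open>k\<close>.\<close>

definition tens :: "'a::complex_vector cell1 \<Rightarrow> 'b::complex_vector cell1 \<Rightarrow> nat \<Rightarrow> nat \<Rightarrow> nat
    \<Rightarrow> 'a \<Rightarrow> 'b \<Rightarrow> nat \<Rightarrow> 'a \<Rightarrow> 'b \<Rightarrow> complex" where
  "tens F G i k j x y = incl j (pure (entry1 F j k) (entry1 G i j) x y)"

text \<open>The calculus of elementary tensors on which all later computations rest: they are linear in
  each factor, different summands are orthogonal, and they span.\<close>

lemma
  assumes FG: "is_cell1 F" "is_cell1 G" "src1 G = tgt1 F" and ik: "i < tgt1 G" "k < src1 F"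
  shows linear_map_tens_left: "j < tgt1 F \<Longrightarrow> y \<in> hcarrier (entry1 G i j)
      \<Longrightarrow> linear_map (entry1 F j k) (entry1 (F \<Zcomp>\<^sub>1 G) i k) (\<lambda>x. tens F G i k j x y)"
    and linear_map_tens_right: "j < tgt1 F \<Longrightarrow> x \<in> hcarrier (entry1 F j k)
      \<Longrightarrow> linear_map (entry1 G i j) (entry1 (F \<Zcomp>\<^sub>1 G) i k) (tens F G i k j x)"
    and tens_closed: "j < tgt1 F \<Longrightarrow> x \<in> hcarrier (entry1 F j k) \<Longrightarrow> y \<in> hcarrier (entry1 G i j)
      \<Longrightarrow> tens F G i k j x y \<in> hcarrier (entry1 (F \<Zcomp>\<^sub>1 G) i k)"
    and inner_tens: "\<lbrakk>j < tgt1 F; x \<in> hcarrier (entry1 F j k); y \<in> hcarrier (entry1 G i j);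
        j' < tgt1 F; x' \<in> hcarrier (entry1 F j' k); y' \<in> hcarrier (entry1 G i j')\<rbrakk>
      \<Longrightarrow> hinner (entry1 (F \<Zcomp>\<^sub>1 G) i k) (tens F G i k j x y) (tens F G i k j' x' y') =
          (if j = j' then hinner (entry1 F j k) x x' * hinner (entry1 G i j) y y' else 0)"
    and span_comp1: "\<lbrakk>\<And>j. j < tgt1 F \<Longrightarrow> cspan (S j) = hcarrier (entry1 F j k);
        \<And>j. j < tgt1 F \<Longrightarrow> cspan (T j) = hcarrier (entry1 G i j)\<rbrakk>
      \<Longrightarrow> cspan {tens F G i k j x y | j x y. j < tgt1 F \<and> x \<in> S j \<and> y \<in> T j}
          = hcarrier (entry1 (F \<Zcomp>\<^sub>1 G) i k)"
proof -
  have F: "hilbert_space (entry1 F j k)" and G: "hilbert_space (entry1 G i j)"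
    and T: "hilbert_space (tensor (entry1 F j k) (entry1 G i j))" if "j < tgt1 F" for j
    using FG ik that by (auto intro!: hilbert_entry1 hilbert_space_tensor)
  show closed: "tens F G i k j x y \<in> hcarrier (entry1 (F \<Zcomp>\<^sub>1 G) i k)"
    if "j < tgt1 F" "x \<in> hcarrier (entry1 F j k)" "y \<in> hcarrier (entry1 G i j)" for j x y
    unfolding tens_def entry1_comp1 using that by (auto intro!: incl_closed T pure_closed F G)
  show "linear_map (entry1 F j k) (entry1 (F \<Zcomp>\<^sub>1 G) i k) (\<lambda>x. tens F G i k j x y)"
    if "j < tgt1 F" "y \<in> hcarrier (entry1 G i j)"
    using linear_map_pure_left[OF F[OF that(1)] G[OF that(1)] that(2)] closed that
    by (simp add: linear_map_def tens_def incl_add incl_scale)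
  show "linear_map (entry1 G i j) (entry1 (F \<Zcomp>\<^sub>1 G) i k) (tens F G i k j x)"
    if "j < tgt1 F" "x \<in> hcarrier (entry1 F j k)"
    using linear_map_pure_right[OF F[OF that(1)] G[OF that(1)] that(2)] closed that
    by (simp add: linear_map_def tens_def incl_add incl_scale)
  show "hinner (entry1 (F \<Zcomp>\<^sub>1 G) i k) (tens F G i k j x y) (tens F G i k j' x' y') =
      (if j = j' then hinner (entry1 F j k) x x' * hinner (entry1 G i j) y y' else 0)"
    if "j < tgt1 F" "x \<in> hcarrier (entry1 F j k)" "y \<in> hcarrier (entry1 G i j)"
      "j' < tgt1 F" "x' \<in> hcarrier (entry1 F j' k)" "y' \<in> hcarrier (entry1 G i j')"
    unfolding tens_def entry1_comp1
    using that by (subst inner_incl) (auto simp: T pure_closed F G inner_pure)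
  assume S: "\<And>j. j < tgt1 F \<Longrightarrow> cspan (S j) = hcarrier (entry1 F j k)"
    "\<And>j. j < tgt1 F \<Longrightarrow> cspan (T j) = hcarrier (entry1 G i j)"
  have "{tens F G i k j x y | j x y. j < tgt1 F \<and> x \<in> S j \<and> y \<in> T j} =
    {incl j t | j t. j < tgt1 F
      \<and> t \<in> {pure (entry1 F j k) (entry1 G i j) x y | x y. x \<in> S j \<and> y \<in> T j}}"
    unfolding tens_def by blast
  then show "cspan {tens F G i k j x y | j x y. j < tgt1 F \<and> x \<in> S j \<and> y \<in> T j}
      = hcarrier (entry1 (F \<Zcomp>\<^sub>1 G) i k)"
    unfolding entry1_comp1 by (simp only:) (intro span_dsum span_tensor T F G S)
qed

lemma span_hcarrier: "hilbert_space V \<Longrightarrow> cspan (hcarrier V) = hcarrier V"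
  by (rule iffD2[OF complex_vector.span_eq_iff]) (rule hilbert_space.subspace)

lemma inner_comp1:
  "hinner (entry1 (F \<Zcomp>\<^sub>1 G) i k) s t = (\<Sum>j<tgt1 F. \<Sum>e\<in>some_onb (entry1 F j k).
     \<Sum>f\<in>some_onb (entry1 G i j). cnj (s j e f) * t j e f)"
  by (simp add: comp1_def dsum_def tensor_def)

text \<open>The equations of sources and targets are oriented so that every bound refers to \<open>F\<close>.\<close>

lemma is_cell2_dest:
  assumes "A :\<^sub>2 F \<Rightarrow> G"
  shows "src2 A = F" "tgt2 A = G" "is_cell1 F" "is_cell1 G" "src1 G = src1 F" "tgt1 G = tgt1 F"
    and "\<And>i j. i < tgt1 F \<Longrightarrow> j < src1 F \<Longrightarrow> linear_map (entry1 F i j) (entry1 G i j) (entry2 A i j)"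
    and "\<And>i j x. i < tgt1 F \<Longrightarrow> j < src1 F \<Longrightarrow> x \<in> hcarrier (entry1 F i j)
      \<Longrightarrow> entry2 A i j x \<in> hcarrier (entry1 G i j)"
  using assms by (auto simp: is_cell2_def linear_map_def)

lemma cell2_id2: "is_cell1 F \<Longrightarrow> id2 F :\<^sub>2 F \<Rightarrow> F"
  by (simp add: is_cell2_def id2_def linear_map_id)

lemma cell2_vcomp:
  assumes A: "A :\<^sub>2 F \<Rightarrow> G" and B: "B :\<^sub>2 G \<Rightarrow> K"
  shows "B \<cdot> A :\<^sub>2 F \<Rightarrow> K"
proof -
  note AB = is_cell2_dest[OF A] is_cell2_dest[OF B]
  have "linear_map (entry1 F i j) (entry1 K i j) (\<lambda>x. entry2 B i j (entry2 A i j x))"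
    if "i < tgt1 F" "j < src1 F" for i j
    by (rule linear_map_comp[OF is_cell2_dest(7)[OF A] is_cell2_dest(7)[OF B]]) (use that AB in simp_all)
  then show ?thesis by (simp add: is_cell2_def vcomp_def o_def AB)
qed

lemma cell2_dagger: "A :\<^sub>2 F \<Rightarrow> G \<Longrightarrow> A\<^sup>\<dagger> :\<^sub>2 G \<Rightarrow> F"
  by (auto simp: is_cell2_def dagger_def intro!: linear_map_adj hilbert_entry1)

lemma cell2_scale: "A :\<^sub>2 F \<Rightarrow> G \<Longrightarrow> c *\<^sub>2 A :\<^sub>2 F \<Rightarrow> G"
  by (auto simp: is_cell2_def scale2_def intro!: linear_map_scaled hilbert_entry1)

lemma cell2_hcomp:
  assumes A: "A :\<^sub>2 F \<Rightarrow> F'" and B: "B :\<^sub>2 G \<Rightarrow> G'" and "src1 G = tgt1 F"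
  shows "A \<Zcomp>\<^sub>2 B :\<^sub>2 F \<Zcomp>\<^sub>1 G \<Rightarrow> F' \<Zcomp>\<^sub>1 G'"
proof -
  note AB = is_cell2_dest[OF A] is_cell2_dest[OF B] and [simp] = \<open>src1 G = tgt1 F\<close>
  have "linear_map (entry1 (F \<Zcomp>\<^sub>1 G) i k) (entry1 (F' \<Zcomp>\<^sub>1 G') i k) (entry2 (A \<Zcomp>\<^sub>2 B) i k)"
    if "i < tgt1 G" "k < src1 F" for i k
  proof -
    have lin: "linear_map (tensor (entry1 F j k) (entry1 G i j)) (tensor (entry1 F' j k) (entry1 G' i j))
      (tensor_map (entry1 F j k) (entry1 F' j k) (entry1 G i j) (entry1 G' i j)
         (entry2 A j k) (entry2 B i j))" if "j < tgt1 F" for j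
      using that \<open>i < tgt1 G\<close> \<open>k < src1 F\<close> AB by (intro linear_map_tensor_map hilbert_entry1) auto
    show ?thesis
      unfolding entry1_comp1 linear_map_def dsum_def hcomp_def
      using lin by (auto simp: AB linear_map_def fun_eq_iff scaleC_fun_def)
  qed
  then show ?thesis using AB by (simp add: is_cell2_def hcomp_def)
qed

text \<open>All components of the tensor other than the \<open>j\<close>-th vanish and stay zero; the \<open>j\<close>-th one is
  \<open>tensor_map_pure\<close>.\<close>

lemma hcomp_tens:
  assumes A: "A :\<^sub>2 F \<Rightarrow> F'" and B: "B :\<^sub>2 G \<Rightarrow> G'" and "src1 G = tgt1 F"
    and "i < tgt1 G" "k < src1 F" "j < tgt1 F"
    and "x \<in> hcarrier (entry1 F j k)" "y \<in> hcarrier (entry1 G i j)"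
  shows "entry2 (A \<Zcomp>\<^sub>2 B) i k (tens F G i k j x y) = tens F' G' i k j (entry2 A j k x) (entry2 B i j y)"
proof -
  note AB = is_cell2_dest[OF A] is_cell2_dest[OF B]
  have "tensor_map (entry1 F j k) (entry1 F' j k) (entry1 G i j) (entry1 G' i j) (entry2 A j k)
       (entry2 B i j) (pure (entry1 F j k) (entry1 G i j) x y)
     = pure (entry1 F' j k) (entry1 G' i j) (entry2 A j k x) (entry2 B i j y)"
    using assms AB by (intro tensor_map_pure) (auto intro!: hilbert_entry1)
  moreover have "tensor_map V V' W W' f g 0 = 0" for V :: "'a hilb" and V' :: "'b hilb"
      and W :: "'c hilb" and W' :: "'d hilb" and f g
    by (simp add: tensor_map_def fun_eq_iff)
  ultimately show ?thesis
    using assms(6) by (auto simp: hcomp_def tens_def incl_def AB fun_eq_iff)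
qed

lemma entry2_simps [simp]:
  "entry2 (id2 F) i j x = x"
  "entry2 (B \<cdot> A) i j x = entry2 B i j (entry2 A i j x)"
  "entry2 (c *\<^sub>2 A) i j x = c *\<^sub>C entry2 A i j x"
  by (simp_all add: id2_def vcomp_def scale2_def)

lemma entry2_dagger:
  "A :\<^sub>2 F \<Rightarrow> G \<Longrightarrow> entry2 (A\<^sup>\<dagger>) i j = adj (entry1 F i j) (entry1 G i j) (entry2 A i j)"
  by (simp add: dagger_def is_cell2_def)

lemma dagger_eqI:
  assumes A: "A :\<^sub>2 F \<Rightarrow> G" and ij: "i < tgt1 F" "j < src1 F"
    and S: "cspan S = hcarrier (entry1 F i j)"
    and "x \<in> hcarrier (entry1 F i j)" "y \<in> hcarrier (entry1 G i j)"
    and "\<And>s. s \<in> S \<Longrightarrow> hinner (entry1 F i j) x s = hinner (entry1 G i j) y (entry2 A i j s)"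
  shows "entry2 (A\<^sup>\<dagger>) i j y = x"
proof -
  have "i < tgt1 G" "j < src1 G" using ij is_cell2_dest(5,6)[OF A] by simp_all
  then show ?thesis
    unfolding entry2_dagger[OF A]
    by (intro adj_eqI[OF _ _ _ S] hilbert_entry1 is_cell2_dest[OF A] assms)
qed

text \<open>This reduces an equation of 2-cells to equations of vectors.\<close>

lemma eq2_iff_on_spans:
  assumes A: "A :\<^sub>2 F \<Rightarrow> G" and B: "B :\<^sub>2 F \<Rightarrow> G"
    and S: "\<And>i j. i < tgt1 F \<Longrightarrow> j < src1 F \<Longrightarrow> cspan (S i j) = hcarrier (entry1 F i j)"
  shows "A \<approx>\<^sub>2 B \<longleftrightarrow> (\<forall>i<tgt1 F. \<forall>j<src1 F. \<forall>x\<in>S i j. entry2 A i j x = entry2 B i j x)"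
proof
  assume AB: "A \<approx>\<^sub>2 B"
  have "entry2 A i j x = entry2 B i j x" if "i < tgt1 F" "j < src1 F" "x \<in> S i j" for i j x
    using AB[unfolded eq2_def is_cell2_dest(1)[OF A]] that(1,2)
      subsetD[OF spanning_subset[OF S[OF that(1,2)]] that(3)] by blast
  then show "\<forall>i<tgt1 F. \<forall>j<src1 F. \<forall>x\<in>S i j. entry2 A i j x = entry2 B i j x" by simp
next
  assume AB: "\<forall>i<tgt1 F. \<forall>j<src1 F. \<forall>x\<in>S i j. entry2 A i j x = entry2 B i j x"
  have "entry2 A i j x = entry2 B i j x"
    if "i < tgt1 F" "j < src1 F" "x \<in> hcarrier (entry1 F i j)" for i j x
    by (rule span_eqI[OF hilbert_entry1[OF is_cell2_dest(3)[OF A] that(1,2)] S[OF that(1,2)] that(3)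
          is_cell2_dest(7)[OF A that(1,2)] is_cell2_dest(7)[OF B that(1,2)]])
      (use that(1,2) AB in blast)
  then show "A \<approx>\<^sub>2 B"
    unfolding eq2_def is_cell2_dest(1,2)[OF A] is_cell2_dest(1,2)[OF B] by blast
qed

section \<open>Coherence isomorphisms on elementary tensors\<close>

lemma id1_sel [simp]: "src1 (id1 n) = n" "tgt1 (id1 n) = n"
  by (simp_all add: id1_def)

lemma entry1_id1: "entry1 (id1 n) i j = (if i = j then complex_hilb else zero_hilb)"
  by (simp add: id1_def)

lemma is_cell1_id1 [simp]: "is_cell1 (id1 n)"
  by (simp add: is_cell1_def entry1_id1 hilbert_space_complex hilbert_space_zero)

lemma complex_hilb_sel [simp]: "hcarrier complex_hilb = UNIV" "hinner complex_hilb x y = cnj x * y"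
  unfolding complex_hilb_def hilb.simps by (rule refl)+

lemma entry2_runit: "entry2 (runit F) i k x = tens F (id1 (tgt1 F)) i k i x 1"
  by (simp add: runit_def tens_def entry1_id1)

lemma entry2_lunit: "entry2 (lunit F) i k x = tens (id1 (src1 F)) F i k k 1 x"
  by (simp add: lunit_def tens_def entry1_id1)

lemma cell2_runit: "is_cell1 F \<Longrightarrow> m = tgt1 F \<Longrightarrow> runit F :\<^sub>2 F \<Rightarrow> F \<Zcomp>\<^sub>1 id1 m"
  using linear_map_tens_left[of F "id1 m" _ _ _ 1]
  by (simp add: is_cell2_def entry2_runit[abs_def] entry1_id1) (simp add: runit_def)

lemma cell2_lunit:
  assumes F: "is_cell1 F" and m: "m = src1 F"
  shows "lunit F :\<^sub>2 F \<Rightarrow> id1 m \<Zcomp>\<^sub>1 F"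
proof -
  have "linear_map (entry1 F i k) (entry1 (id1 m \<Zcomp>\<^sub>1 F) i k) (entry2 (lunit F) i k)"
    if "i < tgt1 F" "k < src1 F" for i k
    using linear_map_tens_right[of "id1 m" F i k k 1] F that
    unfolding entry2_lunit[abs_def] m by (simp add: entry1_id1)
  then show ?thesis
    unfolding is_cell2_def using F m by (simp add: lunit_def)
qed

text \<open>Since \<open>\<langle>x \<otimes> c, s \<otimes> 1\<rangle> = \<langle>x, s\<rangle> cnj c = \<langle>c x, s\<rangle>\<close>, the adjoint of \<open>s \<mapsto> s \<otimes> 1\<close> multiplies the
  two factors.\<close>

lemma runit_dagger_tens:
  assumes F: "is_cell1 F" and "i < tgt1 F" "k < src1 F" "x \<in> hcarrier (entry1 F i k)"
  shows "entry2 ((runit F)\<^sup>\<dagger>) i k (tens F (id1 (tgt1 F)) i k i x c) = c *\<^sub>C x"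
proof (rule dagger_eqI[OF cell2_runit[OF F refl]])
  show "cspan (hcarrier (entry1 F i k)) = hcarrier (entry1 F i k)"
    by (intro span_hcarrier hilbert_entry1 assms)
  show "hinner (entry1 F i k) (c *\<^sub>C x) s
      = hinner (entry1 (F \<Zcomp>\<^sub>1 id1 (tgt1 F)) i k) (tens F (id1 (tgt1 F)) i k i x c) (entry2 (runit F) i k s)"
    if "s \<in> hcarrier (entry1 F i k)" for s
    using assms that
    by (simp add: entry2_runit inner_tens entry1_id1
        hilbert_space.inner_scale_left[OF hilbert_entry1[OF F assms(2,3)]])
next
  show "c *\<^sub>C x \<in> hcarrier (entry1 F i k)"
    by (intro hilbert_space.scale_closed[OF hilbert_entry1[OF F]] assms)
  show "tens F (id1 (tgt1 F)) i k i x c \<in> hcarrier (entry1 (F \<Zcomp>\<^sub>1 id1 (tgt1 F)) i k)"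
    using assms by (intro tens_closed) (simp_all add: entry1_id1)
qed (use assms in simp_all)

lemma lunit_dagger_tens:
  assumes F: "is_cell1 F" and "i < tgt1 F" "k < src1 F" "x \<in> hcarrier (entry1 F i k)"
  shows "entry2 ((lunit F)\<^sup>\<dagger>) i k (tens (id1 (src1 F)) F i k k c x) = c *\<^sub>C x"
proof (rule dagger_eqI[OF cell2_lunit[OF F refl]])
  show "cspan (hcarrier (entry1 F i k)) = hcarrier (entry1 F i k)"
    by (intro span_hcarrier hilbert_entry1 assms)
  show "hinner (entry1 F i k) (c *\<^sub>C x) s
      = hinner (entry1 (id1 (src1 F) \<Zcomp>\<^sub>1 F) i k) (tens (id1 (src1 F)) F i k k c x) (entry2 (lunit F) i k s)"
    if "s \<in> hcarrier (entry1 F i k)" for s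
    using assms that
    by (simp add: entry2_lunit inner_tens entry1_id1
        hilbert_space.inner_scale_left[OF hilbert_entry1[OF F assms(2,3)]])
next
  show "c *\<^sub>C x \<in> hcarrier (entry1 F i k)"
    by (intro hilbert_space.scale_closed[OF hilbert_entry1[OF F]] assms)
  show "tens (id1 (src1 F)) F i k k c x \<in> hcarrier (entry1 (id1 (src1 F) \<Zcomp>\<^sub>1 F) i k)"
    using assms by (intro tens_closed) (simp_all add: entry1_id1)
qed (use assms in simp_all)

lemma entry2_assoc:
  assumes "j < tgt1 F" "x \<in> hcarrier (entry1 F j l)" "u \<in> hcarrier (entry1 (G \<Zcomp>\<^sub>1 K) i j)"
  shows "entry2 (assoc F G K) i l t j x u
    = hinner (entry1 (G \<Zcomp>\<^sub>1 K) i j) u (\<lambda>k y z. t k (tens F G k l j x y) z)"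
  using assms by (simp add: assoc_def tens_def)

text \<open>
  The value of \<open>assoc\<close> is a form given by an inner product, which in orthonormal bases is a finite sum
  of values of \<open>t\<close> (fact \<open>form\<close> in the proof). Linearity in \<open>t\<close> and conjugate-linearity in \<open>u\<close> can be
  read off from this sum. Conjugate-linearity in \<open>x\<close> is inherited from the first argument of \<open>t\<close>,
  into which \<open>x\<close> enters linearly through an elementary tensor.
\<close>

lemma cell2_assoc:
  assumes F: "is_cell1 F" and G: "is_cell1 G" and K: "is_cell1 K"
    and FG: "src1 G = tgt1 F" and GK: "src1 K = tgt1 G"
  shows "assoc F G K :\<^sub>2 F \<Zcomp>\<^sub>1 G \<Zcomp>\<^sub>1 K \<Rightarrow> F \<Zcomp>\<^sub>1 (G \<Zcomp>\<^sub>1 K)"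
proof -
  have "linear_map (entry1 (F \<Zcomp>\<^sub>1 G \<Zcomp>\<^sub>1 K) i l) (entry1 (F \<Zcomp>\<^sub>1 (G \<Zcomp>\<^sub>1 K)) i l) (entry2 (assoc F G K) i l)"
    if i: "i < tgt1 K" and l: "l < src1 F" for i l
  proof -
    let ?a = "entry2 (assoc F G K) i l"
    have GKc: "is_cell1 (G \<Zcomp>\<^sub>1 K)" using G K GK by simp
    have D: "hilbert_space (entry1 (G \<Zcomp>\<^sub>1 K) i j)" if "j < tgt1 F" for j
      using GKc i FG that by (intro hilbert_entry1) simp_all
    have Fh: "hilbert_space (entry1 F j l)" if "j < tgt1 F" for j
      by (intro hilbert_entry1 F l that)
    have Gh: "hilbert_space (entry1 G k j)" if "k < tgt1 G" "j < tgt1 F" for j k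
      using G FG that by (intro hilbert_entry1) simp_all
    have Kh: "hilbert_space (entry1 K i k)" if "k < tgt1 G" for k
      using K GK i that by (intro hilbert_entry1) simp_all
    have outside: "?a t j x u = 0"
      if "\<not> (j < tgt1 F \<and> x \<in> hcarrier (entry1 F j l) \<and> u \<in> hcarrier (entry1 (G \<Zcomp>\<^sub>1 K) i j))"
      for t j x u
      using that by (auto simp: assoc_def)
    have form: "?a t j x u = (\<Sum>k<tgt1 G. \<Sum>e\<in>some_onb (entry1 G k j). \<Sum>f\<in>some_onb (entry1 K i k).
        cnj (u k e f) * t k (tens F G k l j x e) f)"
      if "j < tgt1 F" "x \<in> hcarrier (entry1 F j l)" "u \<in> hcarrier (entry1 (G \<Zcomp>\<^sub>1 K) i j)" for t j x u
      by (simp only: entry2_assoc[OF that] inner_comp1)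
    have add: "?a (s + t) = ?a s + ?a t" for s t
    proof (intro ext)
      fix j x u
      show "?a (s + t) j x u = (?a s + ?a t) j x u"
      proof (cases "j < tgt1 F \<and> x \<in> hcarrier (entry1 F j l) \<and> u \<in> hcarrier (entry1 (G \<Zcomp>\<^sub>1 K) i j)")
        case True
        then show ?thesis by (simp add: form distrib_left sum.distrib)
      qed (simp add: outside)
    qed
    have scale: "?a (c *\<^sub>C t) = c *\<^sub>C ?a t" for c t
    proof (intro ext)
      fix j x u
      show "?a (c *\<^sub>C t) j x u = (c *\<^sub>C ?a t) j x u"
      proof (cases "j < tgt1 F \<and> x \<in> hcarrier (entry1 F j l) \<and> u \<in> hcarrier (entry1 (G \<Zcomp>\<^sub>1 K) i j)")
        case True
        then show ?thesis
          by (simp add: form scaleC_fun_def scaleC_complex_def sum_distrib_left mult.left_commute)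
      qed (simp add: outside scaleC_fun_def scaleC_complex_def)
    qed
    have closed: "?a t \<in> hcarrier (entry1 (F \<Zcomp>\<^sub>1 (G \<Zcomp>\<^sub>1 K)) i l)"
      if t: "t \<in> hcarrier (entry1 (F \<Zcomp>\<^sub>1 G \<Zcomp>\<^sub>1 K) i l)" for t
    proof -
      have tk: "t k \<in> hcarrier (tensor (entry1 (F \<Zcomp>\<^sub>1 G) k l) (entry1 K i k))" if "k < tgt1 G" for k
        using t that unfolding entry1_comp1[of "F \<Zcomp>\<^sub>1 G"] by (simp add: dsum_def)
      have "?a t j \<in> hcarrier (tensor (entry1 F j l) (entry1 (G \<Zcomp>\<^sub>1 K) i j))" if j: "j < tgt1 F" for j
        unfolding tensor_carrier_iff
      proof (intro conjI allI ballI impI)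
        fix x u assume "x \<notin> hcarrier (entry1 F j l) \<or> u \<notin> hcarrier (entry1 (G \<Zcomp>\<^sub>1 K) i j)"
        then show "?a t j x u = 0" using outside by blast
      next
        fix x x' u
        assume x: "x \<in> hcarrier (entry1 F j l)" "x' \<in> hcarrier (entry1 F j l)"
          and u: "u \<in> hcarrier (entry1 (G \<Zcomp>\<^sub>1 K) i j)"
        have "t k (tens F G k l j (x + x') e) f = t k (tens F G k l j x e) f + t k (tens F G k l j x' e) f"
          if "k < tgt1 G" "e \<in> some_onb (entry1 G k j)" "f \<in> some_onb (entry1 K i k)" for k e f
        proof -
          have e: "e \<in> hcarrier (entry1 G k j)" and f: "f \<in> hcarrier (entry1 K i k)"
            using that hilbert_space.some_onb_closed Gh Kh j by blast+
          show ?thesis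
            using linear_map_add[OF linear_map_tens_left[OF F G FG that(1) l j e] x]
            by (simp add: tensor_add_left[OF tk[OF that(1)]] tens_closed[OF F G FG that(1) l j] x e f)
        qed
        then show "?a t j (x + x') u = ?a t j x u + ?a t j x' u"
          by (simp add: form j x u hilbert_space.add_closed[OF Fh[OF j]] distrib_left sum.distrib)
      next
        fix c x u
        assume x: "x \<in> hcarrier (entry1 F j l)" and u: "u \<in> hcarrier (entry1 (G \<Zcomp>\<^sub>1 K) i j)"
        have "t k (tens F G k l j (c *\<^sub>C x) e) f = cnj c * t k (tens F G k l j x e) f"
          if "k < tgt1 G" "e \<in> some_onb (entry1 G k j)" "f \<in> some_onb (entry1 K i k)" for k e f
        proof -
          have e: "e \<in> hcarrier (entry1 G k j)" and f: "f \<in> hcarrier (entry1 K i k)"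
            using that hilbert_space.some_onb_closed Gh Kh j by blast+
          show ?thesis
            using linear_map_scale[OF linear_map_tens_left[OF F G FG that(1) l j e] x]
            by (simp add: tensor_scale_left[OF tk[OF that(1)]] tens_closed[OF F G FG that(1) l j] x e f)
        qed
        then show "?a t j (c *\<^sub>C x) u = cnj c * ?a t j x u"
          by (simp add: form j x u hilbert_space.scale_closed[OF Fh[OF j]] sum_distrib_left
              mult.left_commute)
        show "?a t j x (c *\<^sub>C u) = cnj c * ?a t j x u"
          by (simp add: entry2_assoc j x u hilbert_space.scale_closed[OF D[OF j]])
            (simp add: inner_comp1 scaleC_fun_def scaleC_complex_def sum_distrib_left mult.assoc)
      next
        fix x u u'
        assume x: "x \<in> hcarrier (entry1 F j l)" and u: "u \<in> hcarrier (entry1 (G \<Zcomp>\<^sub>1 K) i j)"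
          "u' \<in> hcarrier (entry1 (G \<Zcomp>\<^sub>1 K) i j)"
        show "?a t j x (u + u') = ?a t j x u + ?a t j x u'"
          by (simp add: entry2_assoc j x u hilbert_space.add_closed[OF D[OF j]])
            (simp add: inner_comp1 distrib_right sum.distrib)
      qed
      then show ?thesis
        using outside by (auto simp: entry1_comp1[of F "G \<Zcomp>\<^sub>1 K"] dsum_def fun_eq_iff)
    qed
    show ?thesis unfolding linear_map_def using add scale closed by blast
  qed
  then show ?thesis
    using assms by (simp add: is_cell2_def) (simp add: assoc_def)
qed

lemma assoc_tens:
  assumes "is_cell1 F" "is_cell1 G" "is_cell1 K" "src1 G = tgt1 F" "src1 K = tgt1 G"
    "j < tgt1 F" "k < tgt1 G" "l < src1 F" "i < tgt1 K"
    "x \<in> hcarrier (entry1 F j l)" "y \<in> hcarrier (entry1 G k j)" "z \<in> hcarrier (entry1 K i k)"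
  shows "entry2 (assoc F G K) i l (tens (F \<Zcomp>\<^sub>1 G) K i l k (tens F G k l j x y) z) =
    tens F (G \<Zcomp>\<^sub>1 K) i l j x (tens G K i j k y z)"
  unfolding tens_def using assms by (rule assoc_pure)

text \<open>On triple tensors the associator preserves inner products: both bracketings give
  \<open>\<langle>x, x'\<rangle> \<langle>y, y'\<rangle> \<langle>z, z'\<rangle>\<close> if the summands agree, and 0 otherwise. As triple tensors span, the
  adjoint reverses the associator on its image.\<close>

lemma assoc_dagger_tens:
  assumes F: "is_cell1 F" and G: "is_cell1 G" and K: "is_cell1 K"
    and FG: "src1 G = tgt1 F" and GK: "src1 K = tgt1 G"
    and b: "j < tgt1 F" "k < tgt1 G" "l < src1 F" "i < tgt1 K"
    and x: "x \<in> hcarrier (entry1 F j l)" and y: "y \<in> hcarrier (entry1 G k j)"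
    and z: "z \<in> hcarrier (entry1 K i k)"
  shows "entry2 ((assoc F G K)\<^sup>\<dagger>) i l (tens F (G \<Zcomp>\<^sub>1 K) i l j x (tens G K i j k y z)) =
    tens (F \<Zcomp>\<^sub>1 G) K i l k (tens F G k l j x y) z"
proof (rule dagger_eqI[OF cell2_assoc[OF F G K FG GK]])
  note [simp] = F G K FG GK b x y z
  let ?P = "\<lambda>k. {tens F G k l j x y | j x y.
      j < tgt1 F \<and> x \<in> hcarrier (entry1 F j l) \<and> y \<in> hcarrier (entry1 G k j)}"
  let ?S = "{tens (F \<Zcomp>\<^sub>1 G) K i l k a z | k a z. k < tgt1 (F \<Zcomp>\<^sub>1 G) \<and> a \<in> ?P k \<and> z \<in> hcarrier (entry1 K i k)}"
  show "cspan ?S = hcarrier (entry1 (F \<Zcomp>\<^sub>1 G \<Zcomp>\<^sub>1 K) i l)"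
    by (intro span_comp1 span_hcarrier hilbert_entry1) simp_all
  show "tens (F \<Zcomp>\<^sub>1 G) K i l k (tens F G k l j x y) z \<in> hcarrier (entry1 (F \<Zcomp>\<^sub>1 G \<Zcomp>\<^sub>1 K) i l)"
    by (intro tens_closed) simp_all
  show "tens F (G \<Zcomp>\<^sub>1 K) i l j x (tens G K i j k y z) \<in> hcarrier (entry1 (F \<Zcomp>\<^sub>1 (G \<Zcomp>\<^sub>1 K)) i l)"
    by (intro tens_closed) simp_all
  fix s assume "s \<in> ?S"
  then obtain k' j' x' y' z' where s: "s = tens (F \<Zcomp>\<^sub>1 G) K i l k' (tens F G k' l j' x' y') z'"
    and b': "k' < tgt1 G" "j' < tgt1 F" "x' \<in> hcarrier (entry1 F j' l)"
      "y' \<in> hcarrier (entry1 G k' j')" "z' \<in> hcarrier (entry1 K i k')"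
    by auto
  show "hinner (entry1 (F \<Zcomp>\<^sub>1 G \<Zcomp>\<^sub>1 K) i l) (tens (F \<Zcomp>\<^sub>1 G) K i l k (tens F G k l j x y) z) s =
      hinner (entry1 (F \<Zcomp>\<^sub>1 (G \<Zcomp>\<^sub>1 K)) i l) (tens F (G \<Zcomp>\<^sub>1 K) i l j x (tens G K i j k y z))
        (entry2 (assoc F G K) i l s)"
    unfolding s using b'
    by (cases "k' = k"; cases "j' = j") (simp_all add: assoc_tens inner_tens tens_closed)
qed (use b in simp_all)

lemma cell2_group_middle:
  assumes "is_cell1 F" "is_cell1 G" "is_cell1 K" "is_cell1 L"
    and "src1 G = tgt1 F" "src1 K = tgt1 G" "src1 L = tgt1 K"
  shows "group_middle F G K L :\<^sub>2 F \<Zcomp>\<^sub>1 G \<Zcomp>\<^sub>1 (K \<Zcomp>\<^sub>1 L) \<Rightarrow> F \<Zcomp>\<^sub>1 (G \<Zcomp>\<^sub>1 K) \<Zcomp>\<^sub>1 L"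
  unfolding group_middle_def
  by (rule cell2_vcomp[OF cell2_dagger[OF cell2_assoc] cell2_hcomp[OF cell2_assoc cell2_id2]])
    (use assms in simp_all)

text \<open>The first equation follows the two associators; the second is the argument of
  \<open>assoc_dagger_tens\<close> again, for fourfold tensors.\<close>

lemma
  assumes [simp]: "is_cell1 F" "is_cell1 G" "is_cell1 K" "is_cell1 L"
    "src1 G = tgt1 F" "src1 K = tgt1 G" "src1 L = tgt1 K" "i < tgt1 L" "l < src1 F"
    and b [simp]: "j < tgt1 F" "k < tgt1 G" "m < tgt1 K"
    "x \<in> hcarrier (entry1 F j l)" "y \<in> hcarrier (entry1 G k j)"
    "z \<in> hcarrier (entry1 K m k)" "w \<in> hcarrier (entry1 L i m)"
  shows group_middle_tens:
      "entry2 (group_middle F G K L) i l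
         (tens (F \<Zcomp>\<^sub>1 G) (K \<Zcomp>\<^sub>1 L) i l k (tens F G k l j x y) (tens K L i k m z w)) =
       tens (F \<Zcomp>\<^sub>1 (G \<Zcomp>\<^sub>1 K)) L i l m (tens F (G \<Zcomp>\<^sub>1 K) m l j x (tens G K m j k y z)) w"
    and group_middle_dagger_tens:
      "entry2 ((group_middle F G K L)\<^sup>\<dagger>) i l
         (tens (F \<Zcomp>\<^sub>1 (G \<Zcomp>\<^sub>1 K)) L i l m (tens F (G \<Zcomp>\<^sub>1 K) m l j x (tens G K m j k y z)) w) =
       tens (F \<Zcomp>\<^sub>1 G) (K \<Zcomp>\<^sub>1 L) i l k (tens F G k l j x y) (tens K L i k m z w)"
proof -
  \<comment> \<open>Stated for all indices and vectors, as the second equation needs it on a whole spanning set.\<close>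
  have gm: "entry2 (group_middle F G K L) i l
         (tens (F \<Zcomp>\<^sub>1 G) (K \<Zcomp>\<^sub>1 L) i l k (tens F G k l j x y) (tens K L i k m z w)) =
       tens (F \<Zcomp>\<^sub>1 (G \<Zcomp>\<^sub>1 K)) L i l m (tens F (G \<Zcomp>\<^sub>1 K) m l j x (tens G K m j k y z)) w"
    if [simp]: "j < tgt1 F" "k < tgt1 G" "m < tgt1 K"
      "x \<in> hcarrier (entry1 F j l)" "y \<in> hcarrier (entry1 G k j)"
      "z \<in> hcarrier (entry1 K m k)" "w \<in> hcarrier (entry1 L i m)" for j k m x y z w
    unfolding group_middle_def
    by (simp add: assoc_dagger_tens tens_closed hcomp_tens[OF cell2_assoc cell2_id2] assoc_tens)
  show "entry2 (group_middle F G K L) i l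
         (tens (F \<Zcomp>\<^sub>1 G) (K \<Zcomp>\<^sub>1 L) i l k (tens F G k l j x y) (tens K L i k m z w)) =
       tens (F \<Zcomp>\<^sub>1 (G \<Zcomp>\<^sub>1 K)) L i l m (tens F (G \<Zcomp>\<^sub>1 K) m l j x (tens G K m j k y z)) w"
    by (rule gm[OF b])
  let ?P = "\<lambda>k. {tens F G k l j x y | j x y.
      j < tgt1 F \<and> x \<in> hcarrier (entry1 F j l) \<and> y \<in> hcarrier (entry1 G k j)}"
  let ?Q = "\<lambda>k. {tens K L i k m z w | m z w.
      m < tgt1 K \<and> z \<in> hcarrier (entry1 K m k) \<and> w \<in> hcarrier (entry1 L i m)}"
  let ?S = "{tens (F \<Zcomp>\<^sub>1 G) (K \<Zcomp>\<^sub>1 L) i l k a c | k a c. k < tgt1 (F \<Zcomp>\<^sub>1 G) \<and> a \<in> ?P k \<and> c \<in> ?Q k}"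
  show "entry2 ((group_middle F G K L)\<^sup>\<dagger>) i l
         (tens (F \<Zcomp>\<^sub>1 (G \<Zcomp>\<^sub>1 K)) L i l m (tens F (G \<Zcomp>\<^sub>1 K) m l j x (tens G K m j k y z)) w) =
       tens (F \<Zcomp>\<^sub>1 G) (K \<Zcomp>\<^sub>1 L) i l k (tens F G k l j x y) (tens K L i k m z w)" (is "entry2 _ _ _ ?r = ?t")
  proof (rule dagger_eqI[OF cell2_group_middle])
    show "cspan ?S = hcarrier (entry1 (F \<Zcomp>\<^sub>1 G \<Zcomp>\<^sub>1 (K \<Zcomp>\<^sub>1 L)) i l)"
      by (intro span_comp1 span_hcarrier hilbert_entry1) simp_all
    show "?t \<in> hcarrier (entry1 (F \<Zcomp>\<^sub>1 G \<Zcomp>\<^sub>1 (K \<Zcomp>\<^sub>1 L)) i l)"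
      by (intro tens_closed) simp_all
    show "?r \<in> hcarrier (entry1 (F \<Zcomp>\<^sub>1 (G \<Zcomp>\<^sub>1 K) \<Zcomp>\<^sub>1 L) i l)"
      by (intro tens_closed) simp_all
    fix s assume "s \<in> ?S"
    then obtain k' j' m' x' y' z' w'
      where s: "s = tens (F \<Zcomp>\<^sub>1 G) (K \<Zcomp>\<^sub>1 L) i l k' (tens F G k' l j' x' y') (tens K L i k' m' z' w')"
      and b': "j' < tgt1 F" "k' < tgt1 G" "m' < tgt1 K" "x' \<in> hcarrier (entry1 F j' l)"
        "y' \<in> hcarrier (entry1 G k' j')" "z' \<in> hcarrier (entry1 K m' k')"
        "w' \<in> hcarrier (entry1 L i m')"
      by auto
    show "hinner (entry1 (F \<Zcomp>\<^sub>1 G \<Zcomp>\<^sub>1 (K \<Zcomp>\<^sub>1 L)) i l) ?t s =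
        hinner (entry1 (F \<Zcomp>\<^sub>1 (G \<Zcomp>\<^sub>1 K) \<Zcomp>\<^sub>1 L) i l) ?r (entry2 (group_middle F G K L) i l s)"
      unfolding s gm[OF b'] using b'
      by (cases "k' = k"; cases "j' = j"; cases "m' = m") (simp_all add: inner_tens tens_closed)
  qed simp_all
qed

section \<open>Orthonormal bases\<close>

text \<open>Families rather than sets: the indices are the measurement outcomes, and coefficients are to be
  compared index by index. Orthonormality is kept apart from spanning since coefficients are also
  compared in the family \<open>e\<^sub>j \<otimes> e\<^sub>i\<close> with \<open>j\<close> fixed, which spans only a part of its space.\<close>

definition orthonormal :: "'a::complex_vector hilb \<Rightarrow> 'i set \<Rightarrow> ('i \<Rightarrow> 'a) \<Rightarrow> bool" where
  "orthonormal V I b \<longleftrightarrow> hilbert_space V \<and> finite I \<and> (\<forall>i\<in>I. b i \<in> hcarrier V) \<and>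
     (\<forall>i\<in>I. \<forall>j\<in>I. hinner V (b i) (b j) = (if i = j then 1 else 0))"

definition orthonormal_basis :: "'a::complex_vector hilb \<Rightarrow> 'i set \<Rightarrow> ('i \<Rightarrow> 'a) \<Rightarrow> bool" where
  "orthonormal_basis V I b \<longleftrightarrow> orthonormal V I b \<and> cspan (b ` I) = hcarrier V"

lemma orthonormalD:
  assumes "orthonormal V I b"
  shows "hilbert_space V" "finite I" "i \<in> I \<Longrightarrow> b i \<in> hcarrier V"
    "i \<in> I \<Longrightarrow> j \<in> I \<Longrightarrow> hinner V (b i) (b j) = (if i = j then 1 else 0)"
  using assms by (auto simp: orthonormal_def)

lemma orthonormal_basisD:
  assumes "orthonormal_basis V I b"
  shows "orthonormal V I b" "hilbert_space V" "finite I" "cspan (b ` I) = hcarrier V"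
    "i \<in> I \<Longrightarrow> b i \<in> hcarrier V"
    "i \<in> I \<Longrightarrow> j \<in> I \<Longrightarrow> hinner V (b i) (b j) = (if i = j then 1 else 0)"
  using assms by (auto simp: orthonormal_basis_def orthonormal_def)

lemma inner_lincomb:
  assumes b: "orthonormal V I b" and i: "i \<in> I"
  shows "hinner V (b i) (\<Sum>j\<in>I. c j *\<^sub>C b j) = c i"
proof -
  note b = orthonormalD[OF b]
  have "hinner V (b i) (\<Sum>j\<in>I. c j *\<^sub>C b j) = (\<Sum>j\<in>I. hinner V (b i) (c j *\<^sub>C b j))"
    by (intro hilbert_space.inner_sum[OF b(1)] hilbert_space.scale_closed[OF b(1)] b(3) i)
  also have "\<dots> = (\<Sum>j\<in>I. if i = j then c i else 0)"
    by (intro sum.cong refl) (simp add: b i hilbert_space.inner_scale[OF b(1)])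
  finally show ?thesis using b(2) i by simp
qed

lemma lincomb_eq_iff:
  assumes b: "orthonormal V I b"
  shows "(\<Sum>i\<in>I. a i *\<^sub>C b i) = (\<Sum>i\<in>I. c i *\<^sub>C b i) \<longleftrightarrow> (\<forall>i\<in>I. a i = c i)"
proof
  assume "(\<Sum>i\<in>I. a i *\<^sub>C b i) = (\<Sum>i\<in>I. c i *\<^sub>C b i)"
  then show "\<forall>i\<in>I. a i = c i"
    using inner_lincomb[OF b, of _ a] inner_lincomb[OF b, of _ c] by metis
qed simp

text \<open>Both sides are linear in \<open>x\<close> and agree on the basis.\<close>

lemma basis_expansion:
  assumes b: "orthonormal_basis V I b" and x: "x \<in> hcarrier V"
  shows "x = (\<Sum>i\<in>I. hinner V (b i) x *\<^sub>C b i)"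
proof -
  note V = orthonormal_basisD[OF b]
  interpret hilbert_space V by (rule V(2))
  have lin: "linear_map V V (\<lambda>x. \<Sum>i\<in>I. hinner V (b i) x *\<^sub>C b i)"
    by (rule linear_map_sum_fun[OF V(2)])
      (simp add: linear_map_def V scale_closed inner_add inner_scale scaleC_add_left scaleC_scaleC)
  show ?thesis
  proof (rule span_eqI[OF V(2,4) x linear_map_id lin])
    fix s assume "s \<in> b ` I"
    then obtain j where j: "j \<in> I" "s = b j" by blast
    have "(\<Sum>i\<in>I. hinner V (b i) (b j) *\<^sub>C b i) = (\<Sum>i\<in>I. if i = j then b j else 0)"
      using j by (intro sum.cong refl) (simp add: V scaleC_one)
    then show "s = (\<Sum>i\<in>I. hinner V (b i) s *\<^sub>C b i)" using j V(3) by simp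
  qed
qed

section \<open>The canonical witness\<close>

lemma W_sel [simp]:
  "src1 (W_L n) = 1" "tgt1 (W_L n) = n" "entry1 (W_L n) i j = complex_hilb"
  "src1 (W_R n) = n" "tgt1 (W_R n) = 1" "entry1 (W_R n) i j = complex_hilb"
  by (simp_all add: W_L_def W_R_def)

lemma is_cell1_W [simp]: "is_cell1 (W_L n)" "is_cell1 (W_R n)"
  by (simp_all add: is_cell1_def hilbert_space_complex)

lemma of_hilb_sel [simp]:
  "src1 (of_hilb H) = 1" "tgt1 (of_hilb H) = 1" "entry1 (of_hilb H) i j = H"
  by (simp_all add: of_hilb_def)

lemma is_cell1_of_hilb [simp]: "hilbert_space H \<Longrightarrow> is_cell1 (of_hilb H)"
  by (simp add: is_cell1_def)

text \<open>The standard basis \<open>e\<^sub>i\<close> of \<open>W_L \<Zcomp> W_R = \<complex>\<^sup>n\<close>.\<close>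

definition ket :: "nat \<Rightarrow> nat \<Rightarrow> nat \<Rightarrow> complex \<Rightarrow> complex \<Rightarrow> complex" where
  "ket n i = tens (W_L n) (W_R n) 0 0 i 1 1"

text \<open>The unit vector \<open>1 \<otimes> 1\<close> that spans the one-dimensional entry \<open>(i, k)\<close> of \<open>W_R \<Zcomp> W_L\<close>.\<close>

definition link :: "nat \<Rightarrow> nat \<Rightarrow> nat \<Rightarrow> nat \<Rightarrow> complex \<Rightarrow> complex \<Rightarrow> complex" where
  "link n i k = tens (W_R n) (W_L n) i k 0 1 1"

lemma basis_ket: "orthonormal_basis (entry1 (W_LR n) 0 0) {..<n} (ket n)"
proof -
  have "{tens (W_L n) (W_R n) 0 0 j x y | j x y. j < tgt1 (W_L n) \<and> x \<in> {1} \<and> y \<in> {1}} = ket n ` {..<n}"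
    by (auto simp: ket_def)
  then have "cspan (ket n ` {..<n}) = hcarrier (entry1 (W_LR n) 0 0)"
    using span_comp1[of "W_L n" "W_R n" 0 0 "\<lambda>_. {1}" "\<lambda>_. {1}"] by (simp add: span_complex)
  then show ?thesis
    by (auto simp: orthonormal_basis_def orthonormal_def ket_def inner_tens intro!: hilbert_entry1 tens_closed)
qed

lemma basis_link:
  assumes "i < n" "k < n"
  shows "orthonormal_basis (entry1 (W_RL n) i k) {()} (\<lambda>_. link n i k)"
proof -
  have "{tens (W_R n) (W_L n) i k j x y | j x y. j < tgt1 (W_R n) \<and> x \<in> {1} \<and> y \<in> {1}} = {link n i k}"
    by (auto simp: link_def)
  then have "cspan {link n i k} = hcarrier (entry1 (W_RL n) i k)"
    using span_comp1[of "W_R n" "W_L n" i k "\<lambda>_. {1}" "\<lambda>_. {1}"] assms by (simp add: span_complex)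
  then show ?thesis
    using assms by (auto simp: orthonormal_basis_def orthonormal_def link_def inner_tens intro!: hilbert_entry1 tens_closed)
qed

lemmas ket_closed = orthonormal_basisD(5)[OF basis_ket, simplified]
lemmas inner_ket = orthonormal_basisD(6)[OF basis_ket, simplified]

lemma
  assumes "i < n" "k < n"
  shows span_link: "cspan {link n i k} = hcarrier (entry1 (W_RL n) i k)"
    and link_closed: "link n i k \<in> hcarrier (entry1 (W_RL n) i k)"
    and inner_link: "hinner (entry1 (W_RL n) i k) (link n i k) (link n i k) = 1"
    and link_expansion: "x \<in> hcarrier (entry1 (W_RL n) i k)
      \<Longrightarrow> x = hinner (entry1 (W_RL n) i k) (link n i k) x *\<^sub>C link n i k"
    and scale_link_eq_iff: "a *\<^sub>C link n i k = b *\<^sub>C link n i k \<longleftrightarrow> a = b"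
  using orthonormal_basisD[OF basis_link[OF assms]] basis_expansion[OF basis_link[OF assms], of x]
    lincomb_eq_iff[OF orthonormal_basisD(1)[OF basis_link[OF assms]], of "\<lambda>_. a" "\<lambda>_. b"] by simp_all

text \<open>This form displays \<open>Create\<close> as a sum of linear maps, from which its type follows.\<close>

lemma entry2_Create: "entry2 (Create n) i j c = (\<Sum>k<n. tens (W_L n) (W_R n) i j k c 1)"
proof
  fix m
  have "(\<Sum>k<n. tens (W_L n) (W_R n) i j k c 1) m = (\<Sum>k<n. tens (W_L n) (W_R n) i j k c 1 m)"
    by (rule sum_apply)
  also have "\<dots> = entry2 (Create n) i j c m"
    by (simp add: tens_def incl_def Create_def)
  finally show "entry2 (Create n) i j c m = (\<Sum>k<n. tens (W_L n) (W_R n) i j k c 1) m" ..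
qed

lemma Create_one: "entry2 (Create n) 0 0 1 = (\<Sum>i<n. ket n i)"
  by (simp add: entry2_Create ket_def)

lemma cell2_Create: "Create n :\<^sub>2 id1 1 \<Rightarrow> W_LR n"
proof -
  have "linear_map complex_hilb (entry1 (W_LR n) 0 0) (\<lambda>c. \<Sum>k<n. tens (W_L n) (W_R n) 0 0 k c 1)"
    using linear_map_tens_left[of "W_L n" "W_R n" 0 0]
    by (intro linear_map_sum_fun hilbert_entry1) simp_all
  then show ?thesis
    by (simp add: is_cell2_def entry2_Create[abs_def] entry1_id1) (simp add: Create_def)
qed

lemma entry2_Copy:
  "entry2 (Copy n) i j = (if i = j then (\<lambda>c. tens (W_R n) (W_L n) i j 0 c 1) else 0)"
  by (auto simp: Copy_def tens_def fun_eq_iff)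

lemma cell2_Copy: "Copy n :\<^sub>2 id1 n \<Rightarrow> W_RL n"
proof -
  have "linear_map (entry1 (id1 n) i j) (entry1 (W_RL n) i j) (entry2 (Copy n) i j)"
    if "i < n" "j < n" for i j
    using linear_map_tens_left[of "W_R n" "W_L n" i j] that
    by (auto simp: entry2_Copy entry1_id1 intro!: linear_map_0 hilbert_entry1)
  then show ?thesis
    by (simp add: is_cell2_def) (simp add: Copy_def)
qed

lemma Copy_one: "entry2 (Copy n) i i 1 = link n i i"
  by (simp add: entry2_Copy link_def)

lemma cell2_Compare: "Compare n :\<^sub>2 W_RL n \<Rightarrow> id1 n"
  unfolding Compare_def by (intro cell2_dagger cell2_Copy)

text \<open>Off the diagonal \<open>Copy\<close> starts from the zero space, so its adjoint vanishes there.\<close>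

lemma Compare_link:
  assumes "i < n" "j < n"
  shows "entry2 (Compare n) i j (link n i j) = (if i = j then 1 else 0)"
  unfolding Compare_def
proof (rule dagger_eqI[OF cell2_Copy])
  show "cspan (if i = j then {1} else {}) = hcarrier (entry1 (id1 n) i j)"
    by (simp add: entry1_id1 span_complex zero_hilb_def)
  fix s :: complex assume "s \<in> (if i = j then {1} else {})"
  then have "s = 1" "i = j" by (auto split: if_splits)
  then show "hinner (entry1 (id1 n) i j) (if i = j then 1 else 0) s =
      hinner (entry1 (W_RL n) i j) (link n i j) (entry2 (Copy n) i j s)"
    using assms by (simp add: Copy_one inner_link entry1_id1)
qed (use assms link_closed in \<open>auto simp: entry1_id1 zero_hilb_def\<close>)

text \<open>The scalar by which \<open>A : W_R \<Zcomp> W_L \<Rightarrow> W_R \<Zcomp> W_L\<close> acts on its one-dimensional entry \<open>(i, k)\<close>.\<close>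

definition coeff where
  "coeff n A i k = hinner (entry1 (W_RL n) i k) (link n i k) (entry2 A i k (link n i k))"

lemma entry2_link:
  assumes "A :\<^sub>2 W_RL n \<Rightarrow> W_RL n" "i < n" "k < n"
  shows "entry2 A i k (link n i k) = coeff n A i k *\<^sub>C link n i k"
  unfolding coeff_def
  by (rule link_expansion[OF assms(2,3)]) (use assms link_closed in \<open>auto intro!: is_cell2_dest(8)[OF assms(1)]\<close>)

text \<open>On a one-dimensional space the adjoint of multiplication by \<open>z\<close> is multiplication by \<open>cnj z\<close>,
  and the two are inverse to each other exactly if \<open>|z| = 1\<close>.\<close>

lemma unitary2_iff_coeff:
  assumes A: "A :\<^sub>2 W_RL n \<Rightarrow> W_RL n"
  shows "unitary2 A \<longleftrightarrow> (\<forall>i<n. \<forall>k<n. cmod (coeff n A i k) = 1)"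
proof -
  note [simp] = link_closed
  have H: "hilbert_space (entry1 (W_RL n) i k)" if "i < n" "k < n" for i k
    using that by (intro hilbert_entry1) simp_all
  have dag: "entry2 (A\<^sup>\<dagger>) i k (link n i k) = cnj (coeff n A i k) *\<^sub>C link n i k"
    if ik: "i < n" "k < n" for i k
  proof (rule dagger_eqI[OF A _ _ span_link[OF ik]])
    fix s assume "s \<in> {link n i k}"
    then show "hinner (entry1 (W_RL n) i k) (cnj (coeff n A i k) *\<^sub>C link n i k) s =
        hinner (entry1 (W_RL n) i k) (link n i k) (entry2 A i k s)"
      using hilbert_space.inner_scale_left[OF H[OF ik]]
      by (simp add: coeff_def inner_link ik)
  qed (use ik hilbert_space.scale_closed[OF H[OF ik]] in simp_all)
  have lin: "linear_map (entry1 (W_RL n) i k) (entry1 (W_RL n) i k) (entry2 A i k)"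
    "linear_map (entry1 (W_RL n) i k) (entry1 (W_RL n) i k) (entry2 (A\<^sup>\<dagger>) i k)"
    if "i < n" "k < n" for i k
    using is_cell2_dest(7)[OF A] is_cell2_dest(7)[OF cell2_dagger[OF A]] that by simp_all
  have norm: "z * cnj z = 1 \<longleftrightarrow> cmod z = 1" for z
    by (metis complex_norm_square norm_ge_zero of_real_1 of_real_eq_iff power2_eq_1_iff
        one_power2 power2_eq_iff_nonneg zero_le_one)
  have "A\<^sup>\<dagger> \<cdot> A \<approx>\<^sub>2 id2 (W_RL n) \<longleftrightarrow> (\<forall>i<n. \<forall>k<n. cmod (coeff n A i k) = 1)"
    by (subst eq2_iff_on_spans[OF cell2_vcomp[OF A cell2_dagger[OF A]] cell2_id2,
          where S = "\<lambda>i k. {link n i k}"])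
      (auto simp: span_link entry2_link[OF A] linear_map_scale[OF lin(2)] dag scaleC_scaleC
        norm scale_link_eq_iff[where b = 1, unfolded scaleC_one])
  moreover have "A \<cdot> A\<^sup>\<dagger> \<approx>\<^sub>2 id2 (W_RL n) \<longleftrightarrow> (\<forall>i<n. \<forall>k<n. cmod (coeff n A i k) = 1)"
    by (subst eq2_iff_on_spans[OF cell2_vcomp[OF cell2_dagger[OF A] A] cell2_id2,
          where S = "\<lambda>i k. {link n i k}"])
      (auto simp: span_link entry2_link[OF A] linear_map_scale[OF lin(1)] dag scaleC_scaleC
        norm mult.commute[of "cnj _"] scale_link_eq_iff[where b = 1, unfolded scaleC_one])
  ultimately show ?thesis
    using A is_cell2_dest(1,2)[OF A] by (simp add: unitary2_def)
qed

section \<open>Bending\<close>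

text \<open>
  Follow the generator of the entry \<open>(i, k)\<close> through the seven layers of \<open>bend\<close>. The unitor and
  \<open>Copy\<close> produce \<open>(1 \<otimes> 1) \<otimes> (1 \<otimes> 1)\<close> in the \<open>i\<close>-th summand, and regrouping makes this \<open>1 \<otimes> e\<^sub>i \<otimes> 1\<close>.
  Now \<open>K\<close> acts on \<open>e\<^sub>i\<close>, which gives the sum of \<open>\<langle>e\<^sub>m, K e\<^sub>i\<rangle> (1 \<otimes> e\<^sub>m \<otimes> 1)\<close> over all \<open>m\<close>. Regrouping
  moves the term of \<open>m\<close> to the \<open>m\<close>-th summand, and \<open>Compare\<close> at the entry \<open>(m, k)\<close> keeps only \<open>m = k\<close>.
\<close>

lemma
  assumes K: "K :\<^sub>2 W_LR n \<Rightarrow> W_LR n"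
  shows cell2_bend: "bend n K :\<^sub>2 W_RL n \<Rightarrow> W_RL n"
    and coeff_bend: "i < n \<Longrightarrow> k < n \<Longrightarrow>
      coeff n (bend n K) i k = hinner (entry1 (W_LR n) 0 0) (ket n k) (entry2 K 0 0 (ket n i))"
proof -
  let ?gm = "group_middle (W_R n) (W_L n) (W_R n) (W_L n)"
  let ?mid = "W_R n \<Zcomp>\<^sub>1 W_LR n \<Zcomp>\<^sub>1 W_L n"
  \<comment> \<open>The layers that follow \<open>K\<close>; by linearity only their effect on \<open>1 \<otimes> e\<^sub>m \<otimes> 1\<close> is needed.\<close>
  define T where "T = (lunit (W_RL n))\<^sup>\<dagger> \<cdot> (Compare n \<Zcomp>\<^sub>2 id2 (W_RL n)) \<cdot> ?gm\<^sup>\<dagger>"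
  have ru: "runit (W_RL n) :\<^sub>2 W_RL n \<Rightarrow> W_RL n \<Zcomp>\<^sub>1 id1 n" by (rule cell2_runit) simp_all
  have lu: "lunit (W_RL n) :\<^sub>2 W_RL n \<Rightarrow> id1 n \<Zcomp>\<^sub>1 W_RL n" by (rule cell2_lunit) simp_all
  have gm: "?gm :\<^sub>2 W_RL n \<Zcomp>\<^sub>1 W_RL n \<Rightarrow> ?mid" by (rule cell2_group_middle) simp_all
  have ids: "id2 (W_RL n) :\<^sub>2 W_RL n \<Rightarrow> W_RL n" "id2 (W_R n) :\<^sub>2 W_R n \<Rightarrow> W_R n"
    "id2 (W_L n) :\<^sub>2 W_L n \<Rightarrow> W_L n" by (simp_all add: cell2_id2)
  have K': "id2 (W_R n) \<Zcomp>\<^sub>2 K :\<^sub>2 W_R n \<Zcomp>\<^sub>1 W_LR n \<Rightarrow> W_R n \<Zcomp>\<^sub>1 W_LR n"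
    by (rule cell2_hcomp[OF ids(2) K]) simp
  have K'': "id2 (W_R n) \<Zcomp>\<^sub>2 K \<Zcomp>\<^sub>2 id2 (W_L n) :\<^sub>2 ?mid \<Rightarrow> ?mid"
    by (rule cell2_hcomp[OF K' ids(3)]) simp
  have copy: "id2 (W_RL n) \<Zcomp>\<^sub>2 Copy n :\<^sub>2 W_RL n \<Zcomp>\<^sub>1 id1 n \<Rightarrow> W_RL n \<Zcomp>\<^sub>1 W_RL n"
    by (rule cell2_hcomp[OF ids(1) cell2_Copy]) simp
  have cmp: "Compare n \<Zcomp>\<^sub>2 id2 (W_RL n) :\<^sub>2 W_RL n \<Zcomp>\<^sub>1 W_RL n \<Rightarrow> id1 n \<Zcomp>\<^sub>1 W_RL n"
    by (rule cell2_hcomp[OF cell2_Compare ids(1)]) simp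
  have T: "T :\<^sub>2 ?mid \<Rightarrow> W_RL n"
    unfolding T_def by (rule cell2_vcomp[OF cell2_vcomp[OF cell2_dagger[OF gm] cmp] cell2_dagger[OF lu]])
  show bend: "bend n K :\<^sub>2 W_RL n \<Rightarrow> W_RL n"
    unfolding bend_def
    by (rule cell2_vcomp[OF cell2_vcomp[OF cell2_vcomp[OF cell2_vcomp[OF cell2_vcomp[OF cell2_vcomp[OF
      ru copy] gm] K''] cell2_dagger[OF gm]] cmp] cell2_dagger[OF lu]])
  assume ik: "i < n" "k < n"
  note [simp] = ik link_closed ket_closed entry1_id1
  let ?c = "\<lambda>m. hinner (entry1 (W_LR n) 0 0) (ket n m) (entry2 K 0 0 (ket n i))"
  let ?emb = "\<lambda>v. tens (W_R n \<Zcomp>\<^sub>1 W_LR n) (W_L n) i k 0 (tens (W_R n) (W_LR n) 0 k 0 1 v) 1"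
  have in_mid: "entry2 ?gm i k (entry2 (id2 (W_RL n) \<Zcomp>\<^sub>2 Copy n) i k (entry2 (runit (W_RL n)) i k (link n i k)))
      = ?emb (ket n i)"
    using group_middle_tens[of "W_R n" "W_L n" "W_R n" "W_L n" i k 0 i 0 1 1 1 1]
    by (simp add: entry2_runit hcomp_tens[OF ids(1) cell2_Copy] Copy_one)
      (simp add: link_def ket_def)
  have Kket: "entry2 K 0 0 (ket n i) \<in> hcarrier (entry1 (W_LR n) 0 0)"
    by (rule is_cell2_dest(8)[OF K]) simp_all
  have apply_K: "entry2 (id2 (W_R n) \<Zcomp>\<^sub>2 K \<Zcomp>\<^sub>2 id2 (W_L n)) i k (?emb (ket n i)) = ?emb (entry2 K 0 0 (ket n i))"
    by (simp add: hcomp_tens[OF K' ids(3)] hcomp_tens[OF ids(2) K] tens_closed)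
  have T_ket: "entry2 T i k (?emb (ket n m)) = (if m = k then link n i k else 0)" if m [simp]: "m < n" for m
  proof -
    have "entry2 (?gm\<^sup>\<dagger>) i k (?emb (ket n m)) = tens (W_RL n) (W_RL n) i k m (link n m k) (link n i m)"
      using group_middle_dagger_tens[of "W_R n" "W_L n" "W_R n" "W_L n" i k 0 m 0 1 1 1 1]
      by (simp add: link_def ket_def)
    then have "entry2 T i k (?emb (ket n m)) = entry2 ((lunit (W_RL n))\<^sup>\<dagger>) i k
        (tens (id1 n) (W_RL n) i k m (if m = k then 1 else 0) (link n i m))"
      by (simp add: T_def hcomp_tens[OF cell2_Compare ids(1)] Compare_link)
    also have "\<dots> = (if m = k then link n i k else 0)"
    proof (cases "m = k")
      case True
      then show ?thesis using lunit_dagger_tens[of "W_RL n" i k "link n i k" 1] by (simp add: scaleC_one)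
    next
      case False
      have "tens (id1 n) (W_RL n) i k m 0 (link n i m) = 0"
        using linear_map_zero[OF _ linear_map_tens_left[of "id1 n" "W_RL n" i k m "link n i m"]]
        by (simp add: hilbert_entry1 hilbert_space_zero hilbert_space_complex)
      then show ?thesis
        using False linear_map_zero[OF _ is_cell2_dest(7)[OF cell2_dagger[OF lu]], of i k]
        by (simp add: hilbert_entry1)
    qed
    finally show ?thesis .
  qed
  have emb: "linear_map (entry1 (W_LR n) 0 0) (entry1 (W_RL n) i k) (\<lambda>v. entry2 T i k (?emb v))"
    by (rule linear_map_comp[OF linear_map_comp[OF linear_map_tens_right linear_map_tens_left]
          is_cell2_dest(7)[OF T]]) simp_all
  have "entry2 (bend n K) i k (link n i k) = entry2 T i k (?emb (entry2 K 0 0 (ket n i)))"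
    by (simp add: bend_def T_def in_mid[simplified] apply_K[simplified])
  also have "\<dots> = entry2 T i k (?emb (\<Sum>m<n. ?c m *\<^sub>C ket n m))"
    using basis_expansion[OF basis_ket Kket] by simp
  also have "\<dots> = (\<Sum>m<n. ?c m *\<^sub>C entry2 T i k (?emb (ket n m)))"
    by (rule linear_map_lincomb[OF _ emb]) (simp_all add: hilbert_entry1)
  also have "\<dots> = (\<Sum>m<n. if m = k then ?c k *\<^sub>C link n i k else 0)"
    by (intro sum.cong refl) (simp add: T_ket)
  also have "\<dots> = ?c k *\<^sub>C link n i k" by simp
  finally have "coeff n (bend n K) i k *\<^sub>C link n i k = ?c k *\<^sub>C link n i k"
    unfolding entry2_link[OF bend ik] .
  then show "coeff n (bend n K) i k = ?c k" unfolding scale_link_eq_iff[OF ik] .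
qed

section \<open>Measurements and their Frobenius algebras\<close>

locale measurement =
  fixes n :: nat and H :: "'h::complex_vector hilb"
    and M :: "('h, nat \<Rightarrow> complex \<Rightarrow> complex \<Rightarrow> complex) cell2"
  assumes hilbert_H: "hilbert_space H" and M: "nondegenerate_measurement n H M"
begin

sublocale H: hilbert_space H by (rule hilbert_H)

lemma cell2_M: "M :\<^sub>2 of_hilb H \<Rightarrow> W_LR n"
  using M by (simp add: nondegenerate_measurement_def)

text \<open>As \<open>M\<close> is unitary, its dagger pulls the standard basis of \<open>\<complex>\<^sup>n\<close> back to an orthonormal basis
  of \<open>H\<close>.\<close>

definition outcome :: "nat \<Rightarrow> 'h" where
  "outcome i = entry2 (M\<^sup>\<dagger>) 0 0 (ket n i)"

lemma M_outcome: "i < n \<Longrightarrow> entry2 M 0 0 (outcome i) = ket n i"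
  and dagger_M: "x \<in> hcarrier H \<Longrightarrow> entry2 (M\<^sup>\<dagger>) 0 0 (entry2 M 0 0 x) = x"
  using M is_cell2_dest(1,2)[OF cell2_M] ket_closed[of i n]
  by (simp_all add: nondegenerate_measurement_def unitary2_def eq2_def outcome_def)
    (simp_all add: vcomp_def dagger_def id2_def)

lemma linear_M: "linear_map H (entry1 (W_LR n) 0 0) (entry2 M 0 0)"
  using is_cell2_dest(7)[OF cell2_M, of 0 0] by simp

lemma linear_dagger_M: "linear_map (entry1 (W_LR n) 0 0) H (entry2 (M\<^sup>\<dagger>) 0 0)"
  using is_cell2_dest(7)[OF cell2_dagger[OF cell2_M], of 0 0] by simp

lemma outcome_closed [simp]: "i < n \<Longrightarrow> outcome i \<in> hcarrier H"
  unfolding outcome_def by (intro linear_map_closed[OF linear_dagger_M] ket_closed)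

lemma inner_outcome:
  assumes "i < n" "x \<in> hcarrier H"
  shows "hinner H (outcome i) x = hinner (entry1 (W_LR n) 0 0) (ket n i) (entry2 M 0 0 x)"
  unfolding outcome_def entry2_dagger[OF cell2_M] of_hilb_sel
  by (intro adj_inner linear_M hilbert_H hilbert_entry1 ket_closed assms) simp_all

lemma basis_outcome: "orthonormal_basis H {..<n} outcome"
proof -
  have "hcarrier H \<subseteq> cspan (outcome ` {..<n})"
  proof
    fix x assume x: "x \<in> hcarrier H"
    then have Mx: "entry2 M 0 0 x \<in> hcarrier (entry1 (W_LR n) 0 0)"
      by (rule linear_map_closed[OF linear_M])
    have "entry2 (M\<^sup>\<dagger>) 0 0 (entry2 M 0 0 x) \<in> cspan (outcome ` {..<n})"
      by (rule linear_preimage_span[OF _ linear_dagger_M orthonormal_basisD(4)[OF basis_ket] _ Mx])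
        (auto simp: hilbert_entry1 outcome_def[symmetric] intro: complex_vector.span_base)
    then show "x \<in> cspan (outcome ` {..<n})" by (simp add: dagger_M x)
  qed
  moreover have "cspan (outcome ` {..<n}) \<subseteq> hcarrier H"
    by (intro complex_vector.span_minimal H.subspace) auto
  ultimately have "cspan (outcome ` {..<n}) = hcarrier H" by (rule subset_antisym[rotated])
  moreover have "orthonormal H {..<n} outcome"
    by (simp add: orthonormal_def hilbert_H inner_outcome M_outcome inner_ket)
  ultimately show ?thesis by (simp add: orthonormal_basis_def)
qed

lemmas span_outcome = orthonormal_basisD(4)[OF basis_outcome]
lemmas outcome_expansion = basis_expansion[OF basis_outcome]

lemma cell2_frob_unit: "frob_unit n M :\<^sub>2 id1 1 \<Rightarrow> of_hilb H"
  unfolding frob_unit_def by (rule cell2_vcomp[OF cell2_Create cell2_dagger[OF cell2_M]])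

lemma frob_unit_one: "entry2 (frob_unit n M) 0 0 1 = (\<Sum>i<n. outcome i)"
  unfolding frob_unit_def entry2_simps Create_one outcome_def
  by (rule linear_map_sum[OF _ linear_dagger_M]) (simp_all add: hilbert_entry1 ket_closed)

text \<open>The counit is the adjoint of \<open>1 \<mapsto> \<Sum>\<^sub>i m\<^sub>i\<close>, and \<open>\<langle>m\<^sub>k, \<Sum>\<^sub>i m\<^sub>i\<rangle> = 1\<close>.\<close>

lemma frob_counit_outcome:
  assumes "k < n"
  shows "entry2 (frob_counit n M) 0 0 (outcome k) = 1"
proof (rule dagger_eqI[OF cell2_frob_unit])
  show "cspan {1} = hcarrier (entry1 (id1 1) 0 0)" by (simp add: entry1_id1 span_complex)
  have "hinner H (outcome k) (\<Sum>i<n. 1 *\<^sub>C outcome i) = 1"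
    by (rule inner_lincomb[OF orthonormal_basisD(1)[OF basis_outcome]]) (simp add: assms)
  then show "hinner (entry1 (id1 1) 0 0) 1 s =
      hinner (entry1 (of_hilb H) 0 0) (outcome k) (entry2 (frob_unit n M) 0 0 s)" if "s \<in> {1}" for s
    using that by (simp add: frob_unit_one entry1_id1 scaleC_one)
qed (use assms in \<open>simp_all add: entry1_id1\<close>)

text \<open>
  \<open>M \<otimes> M\<close> and regrouping turn \<open>m\<^sub>i \<otimes> m\<^sub>j\<close> into \<open>(1 \<otimes> (1 \<otimes> 1)) \<otimes> 1\<close>, whose middle factor lies in the
  entry \<open>(j, i)\<close> of \<open>W_R \<Zcomp> W_L\<close>. There \<open>Compare\<close> is 0 unless \<open>i = j\<close>, in which case \<open>e\<^sub>j\<close> remains and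
  \<open>M\<^sup>\<dagger>\<close> sends it to \<open>m\<^sub>j\<close>.
\<close>

lemma
  shows cell2_frob_mult: "frob_mult n M :\<^sub>2 of_hilb H \<Zcomp>\<^sub>1 of_hilb H \<Rightarrow> of_hilb H"
    and frob_mult_outcome: "i < n \<Longrightarrow> j < n \<Longrightarrow>
      entry2 (frob_mult n M) 0 0 (tens (of_hilb H) (of_hilb H) 0 0 0 (outcome i) (outcome j))
      = (if i = j then outcome i else 0)"
proof -
  let ?gm = "group_middle (W_L n) (W_R n) (W_L n) (W_R n)"
  let ?mid = "W_L n \<Zcomp>\<^sub>1 W_RL n \<Zcomp>\<^sub>1 W_R n"
  have MM: "M \<Zcomp>\<^sub>2 M :\<^sub>2 of_hilb H \<Zcomp>\<^sub>1 of_hilb H \<Rightarrow> W_LR n \<Zcomp>\<^sub>1 W_LR n"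
    by (rule cell2_hcomp[OF cell2_M cell2_M]) simp
  have gm: "?gm :\<^sub>2 W_LR n \<Zcomp>\<^sub>1 W_LR n \<Rightarrow> ?mid" by (rule cell2_group_middle) simp_all
  have ids: "id2 (W_R n) :\<^sub>2 W_R n \<Rightarrow> W_R n" "id2 (W_L n) :\<^sub>2 W_L n \<Rightarrow> W_L n"
    by (simp_all add: cell2_id2)
  have cmp: "id2 (W_L n) \<Zcomp>\<^sub>2 Compare n :\<^sub>2 W_L n \<Zcomp>\<^sub>1 W_RL n \<Rightarrow> W_L n \<Zcomp>\<^sub>1 id1 n"
    by (rule cell2_hcomp[OF ids(2) cell2_Compare]) simp
  have cmp': "id2 (W_L n) \<Zcomp>\<^sub>2 Compare n \<Zcomp>\<^sub>2 id2 (W_R n) :\<^sub>2 ?mid \<Rightarrow> W_L n \<Zcomp>\<^sub>1 id1 n \<Zcomp>\<^sub>1 W_R n"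
    by (rule cell2_hcomp[OF cmp ids(1)]) simp
  have ru: "(runit (W_L n))\<^sup>\<dagger> :\<^sub>2 W_L n \<Zcomp>\<^sub>1 id1 n \<Rightarrow> W_L n"
    by (rule cell2_dagger[OF cell2_runit]) simp_all
  have ru': "(runit (W_L n))\<^sup>\<dagger> \<Zcomp>\<^sub>2 id2 (W_R n) :\<^sub>2 W_L n \<Zcomp>\<^sub>1 id1 n \<Zcomp>\<^sub>1 W_R n \<Rightarrow> W_LR n"
    by (rule cell2_hcomp[OF ru ids(1)]) simp
  show "frob_mult n M :\<^sub>2 of_hilb H \<Zcomp>\<^sub>1 of_hilb H \<Rightarrow> of_hilb H"
    unfolding frob_mult_def
    by (rule cell2_vcomp[OF cell2_vcomp[OF cell2_vcomp[OF cell2_vcomp[OF MM gm] cmp'] ru'] cell2_dagger[OF cell2_M]])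
  assume ij [simp]: "i < n" "j < n"
  note [simp] = link_closed entry1_id1 ket_closed
  let ?in = "tens (of_hilb H) (of_hilb H) 0 0 0 (outcome i) (outcome j)"
  let ?out = "\<lambda>c. entry2 (M\<^sup>\<dagger>) 0 0 (tens (W_L n) (W_R n) 0 0 j c 1)"
  have "entry2 ?gm 0 0 (entry2 (M \<Zcomp>\<^sub>2 M) 0 0 ?in)
      = tens (W_L n \<Zcomp>\<^sub>1 W_RL n) (W_R n) 0 0 j (tens (W_L n) (W_RL n) j 0 i 1 (link n j i)) 1"
    using group_middle_tens[of "W_L n" "W_R n" "W_L n" "W_R n" 0 0 i 0 j 1 1 1 1]
    by (simp add: hcomp_tens[OF cell2_M cell2_M] M_outcome hilbert_H)
      (simp add: link_def ket_def)
  then have eq: "entry2 (frob_mult n M) 0 0 ?in =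
      ?out (entry2 ((runit (W_L n))\<^sup>\<dagger>) j 0 (tens (W_L n) (id1 n) j 0 i 1 (if i = j then 1 else 0)))"
    by (simp add: frob_mult_def hcomp_tens[OF cmp ids(1)] hcomp_tens[OF ids(2) cell2_Compare]
        hcomp_tens[OF ru ids(1)] tens_closed Compare_link
        hilbert_space.zero_closed[OF hilbert_space_zero])
  show "entry2 (frob_mult n M) 0 0 ?in = (if i = j then outcome i else 0)"
  proof (cases "i = j")
    case True
    then show ?thesis
      using runit_dagger_tens[of "W_L n" j 0 1 1] eq by (simp add: scaleC_one outcome_def ket_def)
  next
    case False
    have "tens (W_L n) (id1 n) j 0 i 1 0 = 0"
      using linear_map_zero[OF _ linear_map_tens_right[of "W_L n" "id1 n" j 0 i 1]]
      by (simp add: hilbert_space_zero hilbert_space_complex)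
    moreover have "entry2 ((runit (W_L n))\<^sup>\<dagger>) j 0 0 = 0"
      using linear_map_zero[OF _ is_cell2_dest(7)[OF ru], of j 0] by (simp add: hilbert_entry1)
    moreover have "tens (W_L n) (W_R n) 0 0 j 0 1 = 0"
      using linear_map_zero[OF _ linear_map_tens_left[of "W_L n" "W_R n" 0 0 j 1]]
      by (simp add: hilbert_space_complex)
    ultimately show ?thesis
      using eq False linear_map_zero[OF _ linear_dagger_M] by (simp add: hilbert_entry1)
  qed
qed

text \<open>Both \<open>\<langle>m\<^sub>k \<otimes> m\<^sub>k, m\<^sub>i \<otimes> m\<^sub>j\<rangle>\<close> and \<open>\<langle>m\<^sub>k, \<delta>\<^sub>i\<^sub>j m\<^sub>i\<rangle>\<close> are 1 if \<open>i = j = k\<close> and 0 otherwise.\<close>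

lemma frob_comult_outcome:
  assumes k: "k < n"
  shows "entry2 (frob_comult n M) 0 0 (outcome k) = tens (of_hilb H) (of_hilb H) 0 0 0 (outcome k) (outcome k)"
proof (rule dagger_eqI[OF cell2_frob_mult])
  note [simp] = hilbert_H k
  let ?S = "{tens (of_hilb H) (of_hilb H) 0 0 j x y | j x y.
    j < tgt1 (of_hilb H) \<and> x \<in> outcome ` {..<n} \<and> y \<in> outcome ` {..<n}}"
  show "cspan ?S = hcarrier (entry1 (of_hilb H \<Zcomp>\<^sub>1 of_hilb H) 0 0)"
    by (rule span_comp1) (simp_all add: span_outcome)
  fix s assume "s \<in> ?S"
  then obtain i j where "i < n" "j < n" "s = tens (of_hilb H) (of_hilb H) 0 0 0 (outcome i) (outcome j)"
    by auto
  then show "hinner (entry1 (of_hilb H \<Zcomp>\<^sub>1 of_hilb H) 0 0)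
      (tens (of_hilb H) (of_hilb H) 0 0 0 (outcome k) (outcome k)) s =
    hinner (entry1 (of_hilb H) 0 0) (outcome k) (entry2 (frob_mult n M) 0 0 s)"
    by (simp add: frob_mult_outcome inner_tens orthonormal_basisD(6)[OF basis_outcome] H.inner_zero)
qed (simp_all add: assms hilbert_H tens_closed)

end

section \<open>Complementarity as unbiasedness of bases\<close>

locale measurement_pair = R: measurement n H R + G: measurement n H G
  for n :: nat and H :: "'h::complex_vector hilb"
    and R G :: "('h, nat \<Rightarrow> complex \<Rightarrow> complex \<Rightarrow> complex) cell2"
begin

definition overlap :: "nat \<Rightarrow> nat \<Rightarrow> complex" where
  "overlap k i = hinner H (G.outcome k) (R.outcome i)"

lemma cell2_change: "G \<cdot> R\<^sup>\<dagger> :\<^sub>2 W_LR n \<Rightarrow> W_LR n"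
  by (rule cell2_vcomp[OF cell2_dagger[OF R.cell2_M] G.cell2_M])

text \<open>So \<open>overlap\<close> is the matrix of \<open>G R\<^sup>\<dagger>\<close> in the standard basis.\<close>

lemma overlap_eq: "i < n \<Longrightarrow> k < n \<Longrightarrow>
    overlap k i = hinner (entry1 (W_LR n) 0 0) (ket n k) (entry2 (G \<cdot> R\<^sup>\<dagger>) 0 0 (ket n i))"
  by (simp add: overlap_def G.inner_outcome R.outcome_def[symmetric])

lemma horizontally_unitary_iff:
  "horizontally_unitary n (c *\<^sub>2 (G \<cdot> R\<^sup>\<dagger>)) \<longleftrightarrow> (\<forall>i<n. \<forall>k<n. cmod (c * overlap k i) = 1)"
proof -
  have K: "c *\<^sub>2 (G \<cdot> R\<^sup>\<dagger>) :\<^sub>2 W_LR n \<Rightarrow> W_LR n" by (rule cell2_scale[OF cell2_change])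
  have LR: "hilbert_space (entry1 (W_LR n) 0 0)" by (simp add: hilbert_entry1)
  have "coeff n (bend n (c *\<^sub>2 (G \<cdot> R\<^sup>\<dagger>))) i k = c * overlap k i" if ik: "i < n" "k < n" for i k
  proof -
    have "entry2 (G \<cdot> R\<^sup>\<dagger>) 0 0 (ket n i) \<in> hcarrier (entry1 (W_LR n) 0 0)"
      by (rule is_cell2_dest(8)[OF cell2_change]) (simp_all add: ket_closed ik)
    then show ?thesis
      unfolding coeff_bend[OF K ik] overlap_eq[OF ik] entry2_simps(3)
      by (intro hilbert_space.inner_scale[OF LR] ket_closed ik)
  qed
  then show ?thesis
    using K by (simp add: horizontally_unitary_def unitary2_iff_coeff[OF cell2_bend[OF K]])
qed

text \<open>
  Apply both sides to \<open>r\<^sub>j\<close>. On the left, \<open>R\<close> gives \<open>e\<^sub>j\<close>, which is copied to \<open>e\<^sub>j \<otimes> e\<^sub>j\<close>, and \<open>G R\<^sup>\<dagger>\<close>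
  acts on the second factor. On the right, \<open>R\<close> and \<open>Create\<close> give the sum of all \<open>e\<^sub>j \<otimes> e\<^sub>i\<close>;
  regrouped, the term of \<open>i\<close> has its middle factor in the entry \<open>(i, j)\<close> of \<open>W_R \<Zcomp> W_L\<close>, where \<open>\<phi>\<close>
  multiplies it by \<open>\<phi>\<^sub>i\<^sub>j\<close>. The vectors \<open>e\<^sub>j \<otimes> e\<^sub>i\<close> with \<open>j\<close> fixed are orthonormal, so coefficients can be
  compared.
\<close>

lemma physically_complementary_iff:
  assumes \<phi>: "\<phi> :\<^sub>2 W_RL n \<Rightarrow> W_RL n"
  shows "physically_complementary n H R G \<phi> \<longleftrightarrow>
    (\<forall>j<n. \<forall>i<n. overlap i j = complex_of_real (1 / sqrt (real n)) * coeff n \<phi> i j)"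
proof -
  let ?gm = "group_middle (W_L n) (W_R n) (W_L n) (W_R n)"
  let ?mid = "W_L n \<Zcomp>\<^sub>1 W_RL n \<Zcomp>\<^sub>1 W_R n"
  let ?s = "complex_of_real (1 / sqrt (real n))"
  let ?kk = "\<lambda>j v. tens (W_LR n) (W_LR n) 0 0 0 (ket n j) v"
  have gm: "?gm :\<^sub>2 W_LR n \<Zcomp>\<^sub>1 W_LR n \<Rightarrow> ?mid" by (rule cell2_group_middle) simp_all
  have ids: "id2 (W_LR n) :\<^sub>2 W_LR n \<Rightarrow> W_LR n" "id2 (W_R n) :\<^sub>2 W_R n \<Rightarrow> W_R n"
    "id2 (W_L n) :\<^sub>2 W_L n \<Rightarrow> W_L n" by (simp_all add: cell2_id2)
  have ru: "runit (W_L n) :\<^sub>2 W_L n \<Rightarrow> W_L n \<Zcomp>\<^sub>1 id1 n" by (rule cell2_runit) simp_all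
  have ru': "runit (W_L n) \<Zcomp>\<^sub>2 id2 (W_R n) :\<^sub>2 W_LR n \<Rightarrow> W_L n \<Zcomp>\<^sub>1 id1 n \<Zcomp>\<^sub>1 W_R n"
    by (rule cell2_hcomp[OF ru ids(2)]) simp
  have copy: "id2 (W_L n) \<Zcomp>\<^sub>2 Copy n :\<^sub>2 W_L n \<Zcomp>\<^sub>1 id1 n \<Rightarrow> W_L n \<Zcomp>\<^sub>1 W_RL n"
    by (rule cell2_hcomp[OF ids(3) cell2_Copy]) simp
  have copy': "id2 (W_L n) \<Zcomp>\<^sub>2 Copy n \<Zcomp>\<^sub>2 id2 (W_R n) :\<^sub>2 W_L n \<Zcomp>\<^sub>1 id1 n \<Zcomp>\<^sub>1 W_R n \<Rightarrow> ?mid"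
    by (rule cell2_hcomp[OF copy ids(2)]) simp
  have GR: "id2 (W_LR n) \<Zcomp>\<^sub>2 (G \<cdot> R\<^sup>\<dagger>) :\<^sub>2 W_LR n \<Zcomp>\<^sub>1 W_LR n \<Rightarrow> W_LR n \<Zcomp>\<^sub>1 W_LR n"
    by (rule cell2_hcomp[OF ids(1) cell2_change]) simp
  have ph: "id2 (W_L n) \<Zcomp>\<^sub>2 \<phi> :\<^sub>2 W_L n \<Zcomp>\<^sub>1 W_RL n \<Rightarrow> W_L n \<Zcomp>\<^sub>1 W_RL n"
    by (rule cell2_hcomp[OF ids(3) \<phi>]) simp
  have ph': "id2 (W_L n) \<Zcomp>\<^sub>2 \<phi> \<Zcomp>\<^sub>2 id2 (W_R n) :\<^sub>2 ?mid \<Rightarrow> ?mid"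
    by (rule cell2_hcomp[OF ph ids(2)]) simp
  have ruH: "runit (of_hilb H) :\<^sub>2 of_hilb H \<Rightarrow> of_hilb H \<Zcomp>\<^sub>1 id1 1"
    by (rule cell2_runit) (simp_all add: R.hilbert_H)
  have RC: "R \<Zcomp>\<^sub>2 Create n :\<^sub>2 of_hilb H \<Zcomp>\<^sub>1 id1 1 \<Rightarrow> W_LR n \<Zcomp>\<^sub>1 W_LR n"
    by (rule cell2_hcomp[OF R.cell2_M cell2_Create]) simp
  define L where "L = (id2 (W_LR n) \<Zcomp>\<^sub>2 (G \<cdot> R\<^sup>\<dagger>)) \<cdot> ?gm\<^sup>\<dagger>
     \<cdot> (id2 (W_L n) \<Zcomp>\<^sub>2 Copy n \<Zcomp>\<^sub>2 id2 (W_R n)) \<cdot> (runit (W_L n) \<Zcomp>\<^sub>2 id2 (W_R n)) \<cdot> R"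
  define V where "V = ?gm\<^sup>\<dagger> \<cdot> (id2 (W_L n) \<Zcomp>\<^sub>2 \<phi> \<Zcomp>\<^sub>2 id2 (W_R n)) \<cdot> ?gm"
  define P where "P = ?s *\<^sub>2 ?gm\<^sup>\<dagger> \<cdot> (id2 (W_L n) \<Zcomp>\<^sub>2 \<phi> \<Zcomp>\<^sub>2 id2 (W_R n)) \<cdot> ?gm
       \<cdot> (R \<Zcomp>\<^sub>2 Create n) \<cdot> runit (of_hilb H)"
  have L: "L :\<^sub>2 of_hilb H \<Rightarrow> W_LR n \<Zcomp>\<^sub>1 W_LR n"
    unfolding L_def by (rule cell2_vcomp[OF cell2_vcomp[OF cell2_vcomp[OF cell2_vcomp[OF
      R.cell2_M ru'] copy'] cell2_dagger[OF gm]] GR])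
  have V: "V :\<^sub>2 W_LR n \<Zcomp>\<^sub>1 W_LR n \<Rightarrow> W_LR n \<Zcomp>\<^sub>1 W_LR n"
    unfolding V_def by (rule cell2_vcomp[OF cell2_vcomp[OF gm ph'] cell2_dagger[OF gm]])
  have P: "P :\<^sub>2 of_hilb H \<Rightarrow> W_LR n \<Zcomp>\<^sub>1 W_LR n"
    unfolding P_def by (rule cell2_scale[OF cell2_vcomp[OF cell2_vcomp[OF cell2_vcomp[OF cell2_vcomp[OF
      ruH RC] gm] ph'] cell2_dagger[OF gm]]])
  have LR: "hilbert_space (entry1 (W_LR n) 0 0)" by (simp add: hilbert_entry1)
  note [simp] = ket_closed link_closed entry1_id1 R.hilbert_H
  have lin_kk: "linear_map (entry1 (W_LR n) 0 0) (entry1 (W_LR n \<Zcomp>\<^sub>1 W_LR n) 0 0) (?kk j)" if "j < n" for j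
    by (rule linear_map_tens_right) (simp_all add: that)
  have kk: "orthonormal (entry1 (W_LR n \<Zcomp>\<^sub>1 W_LR n) 0 0) {..<n} (\<lambda>i. ?kk j (ket n i))" if "j < n" for j
    using that by (auto simp: orthonormal_def inner_tens inner_ket intro!: hilbert_entry1 tens_closed)
  have ru_ket: "entry2 ?gm 0 0 (?kk j (ket n i)) =
      tens (W_L n \<Zcomp>\<^sub>1 W_RL n) (W_R n) 0 0 i (tens (W_L n) (W_RL n) i 0 j 1 (link n i j)) 1"
    if [simp]: "i < n" "j < n" for i j
    using group_middle_tens[of "W_L n" "W_R n" "W_L n" "W_R n" 0 0 j 0 i 1 1 1 1]
    by (simp add: link_def ket_def)
  have gmd: "entry2 (?gm\<^sup>\<dagger>) 0 0
      (tens (W_L n \<Zcomp>\<^sub>1 W_RL n) (W_R n) 0 0 i (tens (W_L n) (W_RL n) i 0 j 1 (link n i j)) 1) = ?kk j (ket n i)"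
    if [simp]: "i < n" "j < n" for i j
    using group_middle_dagger_tens[of "W_L n" "W_R n" "W_L n" "W_R n" 0 0 j 0 i 1 1 1 1]
    by (simp add: link_def ket_def)
  have L_outcome: "entry2 L 0 0 (R.outcome j) = (\<Sum>i<n. overlap i j *\<^sub>C ?kk j (ket n i))"
    if [simp]: "j < n" for j
  proof -
    have "entry2 (runit (W_L n) \<Zcomp>\<^sub>2 id2 (W_R n)) 0 0 (ket n j)
        = tens (W_L n \<Zcomp>\<^sub>1 id1 n) (W_R n) 0 0 j (tens (W_L n) (id1 n) j 0 j 1 1) 1"
      unfolding ket_def by (simp add: hcomp_tens[OF ru ids(2)] entry2_runit)
    then have "entry2 L 0 0 (R.outcome j) = ?kk j (entry2 (G \<cdot> R\<^sup>\<dagger>) 0 0 (ket n j))"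
      by (simp add: L_def R.M_outcome hcomp_tens[OF copy ids(2)] hcomp_tens[OF ids(3) cell2_Copy]
          tens_closed Copy_one gmd hcomp_tens[OF ids(1) cell2_change])
    also have "entry2 (G \<cdot> R\<^sup>\<dagger>) 0 0 (ket n j) = (\<Sum>i<n. overlap i j *\<^sub>C ket n i)"
    proof -
      have "entry2 (G \<cdot> R\<^sup>\<dagger>) 0 0 (ket n j) \<in> hcarrier (entry1 (W_LR n) 0 0)"
        by (rule is_cell2_dest(8)[OF cell2_change]) simp_all
      note basis_expansion[OF basis_ket this]
      also have "(\<Sum>i<n. hinner (entry1 (W_LR n) 0 0) (ket n i) (entry2 (G \<cdot> R\<^sup>\<dagger>) 0 0 (ket n j)) *\<^sub>C ket n i)
          = (\<Sum>i<n. overlap i j *\<^sub>C ket n i)"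
        by (intro sum.cong refl) (simp only: overlap_eq[OF that] lessThan_iff)
      finally show ?thesis .
    qed
    also have "?kk j (\<Sum>i<n. overlap i j *\<^sub>C ket n i) = (\<Sum>i<n. overlap i j *\<^sub>C ?kk j (ket n i))"
      by (rule linear_map_lincomb[OF LR lin_kk]) simp_all
    finally show ?thesis .
  qed
  have P_outcome: "entry2 P 0 0 (R.outcome j) = (\<Sum>i<n. (?s * coeff n \<phi> i j) *\<^sub>C ?kk j (ket n i))"
    if [simp]: "j < n" for j
  proof -
    have V_kk: "entry2 V 0 0 (?kk j (ket n i)) = coeff n \<phi> i j *\<^sub>C ?kk j (ket n i)" if [simp]: "i < n" for i
    proof -
      let ?emb = "\<lambda>v. tens (W_L n \<Zcomp>\<^sub>1 W_RL n) (W_R n) 0 0 i (tens (W_L n) (W_RL n) i 0 j 1 v) 1"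
      have emb: "linear_map (entry1 (W_RL n) i j) (entry1 (W_LR n \<Zcomp>\<^sub>1 W_LR n) 0 0) (\<lambda>v. entry2 (?gm\<^sup>\<dagger>) 0 0 (?emb v))"
        by (rule linear_map_comp[OF linear_map_comp[OF linear_map_tens_right linear_map_tens_left]
              is_cell2_dest(7)[OF cell2_dagger[OF gm]]]) simp_all
      have "entry2 V 0 0 (?kk j (ket n i)) = entry2 (?gm\<^sup>\<dagger>) 0 0 (?emb (entry2 \<phi> i j (link n i j)))"
        by (simp add: V_def ru_ket hcomp_tens[OF ph ids(2)] hcomp_tens[OF ids(3) \<phi>] tens_closed)
      also have "\<dots> = coeff n \<phi> i j *\<^sub>C ?kk j (ket n i)"
        unfolding entry2_link[OF \<phi> \<open>i < n\<close> \<open>j < n\<close>]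
        using linear_map_scale[OF emb] by (simp add: gmd)
      finally show ?thesis .
    qed
    have "entry2 (R \<Zcomp>\<^sub>2 Create n) 0 0 (entry2 (runit (of_hilb H)) 0 0 (R.outcome j)) = ?kk j (\<Sum>i<n. ket n i)"
      by (simp add: entry2_runit hcomp_tens[OF R.cell2_M cell2_Create] R.M_outcome Create_one
          del: One_nat_def)
    also have "\<dots> = (\<Sum>i<n. ?kk j (ket n i))"
      by (rule linear_map_sum[OF LR lin_kk]) simp_all
    finally have "entry2 P 0 0 (R.outcome j) = ?s *\<^sub>C entry2 V 0 0 (\<Sum>i<n. ?kk j (ket n i))"
      by (simp add: P_def V_def)
    also have "entry2 V 0 0 (\<Sum>i<n. ?kk j (ket n i)) = (\<Sum>i<n. entry2 V 0 0 (?kk j (ket n i)))"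
      by (rule linear_map_sum[OF _ is_cell2_dest(7)[OF V]]) (simp_all add: hilbert_entry1 tens_closed)
    finally show ?thesis by (simp add: V_kk complex_vector.scale_sum_right scaleC_scaleC)
  qed
  have eq: "entry2 L 0 0 (R.outcome j) = entry2 P 0 0 (R.outcome j) \<longleftrightarrow>
      (\<forall>i<n. overlap i j = ?s * coeff n \<phi> i j)" if "j < n" for j
    unfolding L_outcome[OF that] P_outcome[OF that] lincomb_eq_iff[OF kk[OF that]] by auto
  show ?thesis
    unfolding physically_complementary_def L_def[symmetric] P_def[symmetric]
    by (subst eq2_iff_on_spans[OF L P, where S = "\<lambda>_ _. R.outcome ` {..<n}"])
      (auto simp: R.span_outcome eq)
qed

text \<open>
  The cup \<open>\<delta>\<^sub>R \<circ> \<eta>\<^sub>R\<close> is \<open>\<Sum>\<^sub>i r\<^sub>i \<otimes> r\<^sub>i\<close>. The cap \<open>\<epsilon>\<^sub>G \<circ> \<mu>\<^sub>G\<close> is the bilinear form with \<open>g\<^sub>l \<otimes> g\<^sub>k \<mapsto> \<delta>\<^sub>l\<^sub>k\<close>, so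
  expanding \<open>r\<^sub>i\<close> in the basis of \<open>G\<close> shows that it sends \<open>r\<^sub>i \<otimes> g\<^sub>k\<close> to \<open>\<langle>g\<^sub>k, r\<^sub>i\<rangle>\<close>.
\<close>

lemma
  shows cell2_cd_map: "cd_map n H R G :\<^sub>2 of_hilb H \<Rightarrow> of_hilb H"
    and cd_map_outcome: "k < n \<Longrightarrow>
      entry2 (cd_map n H R G) 0 0 (G.outcome k) = (\<Sum>i<n. overlap k i *\<^sub>C R.outcome i)"
proof -
  note [simp] = R.hilbert_H
  let ?H = "of_hilb H"
  let ?cap = "frob_counit n G \<cdot> frob_mult n G"
  let ?cup = "frob_comult n R \<cdot> frob_unit n R"
  \<comment> \<open>The part of \<open>S\<close> after the cup; it is applied to each summand of the cup separately.\<close>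
  define U where "U = (runit ?H)\<^sup>\<dagger> \<cdot> (id2 ?H \<Zcomp>\<^sub>2 ?cap) \<cdot> assoc ?H ?H ?H"
  have id: "id2 ?H :\<^sub>2 ?H \<Rightarrow> ?H" by (simp add: cell2_id2)
  have cap: "?cap :\<^sub>2 ?H \<Zcomp>\<^sub>1 ?H \<Rightarrow> id1 1"
    by (rule cell2_vcomp[OF G.cell2_frob_mult cell2_dagger[OF G.cell2_frob_unit]])
  have cup: "?cup :\<^sub>2 id1 1 \<Rightarrow> ?H \<Zcomp>\<^sub>1 ?H"
    by (rule cell2_vcomp[OF R.cell2_frob_unit cell2_dagger[OF R.cell2_frob_mult]])
  have ru: "runit ?H :\<^sub>2 ?H \<Rightarrow> ?H \<Zcomp>\<^sub>1 id1 1" by (rule cell2_runit) simp_all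
  have lu: "lunit ?H :\<^sub>2 ?H \<Rightarrow> id1 1 \<Zcomp>\<^sub>1 ?H" by (rule cell2_lunit) simp_all
  have as: "assoc ?H ?H ?H :\<^sub>2 ?H \<Zcomp>\<^sub>1 ?H \<Zcomp>\<^sub>1 ?H \<Rightarrow> ?H \<Zcomp>\<^sub>1 (?H \<Zcomp>\<^sub>1 ?H)" by (rule cell2_assoc) simp_all
  have cup': "?cup \<Zcomp>\<^sub>2 id2 ?H :\<^sub>2 id1 1 \<Zcomp>\<^sub>1 ?H \<Rightarrow> ?H \<Zcomp>\<^sub>1 ?H \<Zcomp>\<^sub>1 ?H"
    by (rule cell2_hcomp[OF cup id]) simp
  have cap': "id2 ?H \<Zcomp>\<^sub>2 ?cap :\<^sub>2 ?H \<Zcomp>\<^sub>1 (?H \<Zcomp>\<^sub>1 ?H) \<Rightarrow> ?H \<Zcomp>\<^sub>1 id1 1"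
    by (rule cell2_hcomp[OF id cap]) simp
  have U: "U :\<^sub>2 ?H \<Zcomp>\<^sub>1 ?H \<Zcomp>\<^sub>1 ?H \<Rightarrow> ?H"
    unfolding U_def by (rule cell2_vcomp[OF cell2_vcomp[OF as cap'] cell2_dagger[OF ru]])
  show "cd_map n H R G :\<^sub>2 ?H \<Rightarrow> ?H"
    unfolding cd_map_def
    by (rule cell2_vcomp[OF cell2_vcomp[OF cell2_vcomp[OF cell2_vcomp[OF lu cup'] as] cap'] cell2_dagger[OF ru]])
  assume k [simp]: "k < n"
  let ?t = "tens ?H ?H 0 0 0"
  have HH: "hilbert_space (entry1 (?H \<Zcomp>\<^sub>1 ?H) 0 0)" by (simp add: hilbert_entry1)
  have cap_outcome: "entry2 ?cap 0 0 (?t (R.outcome i) (G.outcome k)) = overlap k i"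
    if [simp]: "i < n" for i
  proof -
    have z: "entry2 (frob_counit n G) 0 0 0 = 0"
      using linear_map_zero[OF _ is_cell2_dest(7)[OF cell2_dagger[OF G.cell2_frob_unit]], of 0 0] by simp
    have lin: "linear_map H complex_hilb (\<lambda>v. entry2 ?cap 0 0 (?t v (G.outcome k)))"
    proof -
      have "linear_map (entry1 ?H 0 0) (entry1 (id1 1) 0 0) (\<lambda>v. entry2 ?cap 0 0 (?t v (G.outcome k)))"
        by (rule linear_map_comp[OF linear_map_tens_left is_cell2_dest(7)[OF cap]]) simp_all
      then show ?thesis by (simp add: entry1_id1)
    qed
    have "entry2 ?cap 0 0 (?t (R.outcome i) (G.outcome k))
        = entry2 ?cap 0 0 (?t (\<Sum>l<n. overlap l i *\<^sub>C G.outcome l) (G.outcome k))"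
      using G.outcome_expansion[of "R.outcome i"] by (simp add: overlap_def)
    also have "\<dots> = (\<Sum>l<n. overlap l i *\<^sub>C entry2 ?cap 0 0 (?t (G.outcome l) (G.outcome k)))"
      by (rule linear_map_lincomb[OF R.hilbert_H lin]) simp
    also have "\<dots> = (\<Sum>l<n. if l = k then overlap k i else 0)"
      by (intro sum.cong refl) (simp add: G.frob_mult_outcome G.frob_counit_outcome z scaleC_complex_def)
    finally show ?thesis by simp
  qed
  have U_outcome: "entry2 U 0 0 (tens (?H \<Zcomp>\<^sub>1 ?H) ?H 0 0 0 (?t (R.outcome i) (R.outcome i)) (G.outcome k))
      = overlap k i *\<^sub>C R.outcome i" if [simp]: "i < n" for i
    using runit_dagger_tens[of ?H 0 0 "R.outcome i" "overlap k i"] cap_outcome[OF that]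
    by (simp add: U_def assoc_tens hcomp_tens[OF id cap] tens_closed)
  have "linear_map (entry1 (?H \<Zcomp>\<^sub>1 ?H) 0 0) (entry1 ?H 0 0)
      (\<lambda>v. entry2 U 0 0 (tens (?H \<Zcomp>\<^sub>1 ?H) ?H 0 0 0 v (G.outcome k)))"
    by (rule linear_map_comp[OF linear_map_tens_left is_cell2_dest(7)[OF U]]) simp_all
  then have lin: "linear_map (entry1 (?H \<Zcomp>\<^sub>1 ?H) 0 0) H
      (\<lambda>v. entry2 U 0 0 (tens (?H \<Zcomp>\<^sub>1 ?H) ?H 0 0 0 v (G.outcome k)))" by simp
  have "entry2 ?cup 0 0 1 = (\<Sum>i<n. entry2 (frob_comult n R) 0 0 (R.outcome i))"
    unfolding entry2_simps R.frob_unit_one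
    by (rule linear_map_sum[OF _ is_cell2_dest(7)[OF cell2_dagger[OF R.cell2_frob_mult]]]) simp_all
  then have "entry2 ?cup 0 0 1 = (\<Sum>i<n. ?t (R.outcome i) (R.outcome i))"
    by (simp add: R.frob_comult_outcome)
  then have "entry2 (cd_map n H R G) 0 0 (G.outcome k)
      = entry2 U 0 0 (tens (?H \<Zcomp>\<^sub>1 ?H) ?H 0 0 0 (\<Sum>i<n. ?t (R.outcome i) (R.outcome i)) (G.outcome k))"
    using hcomp_tens[OF cup id, of 0 0 0 1 "G.outcome k"]
    by (simp add: cd_map_def U_def entry2_lunit entry1_id1)
  also have "\<dots> = (\<Sum>i<n. entry2 U 0 0
      (tens (?H \<Zcomp>\<^sub>1 ?H) ?H 0 0 0 (?t (R.outcome i) (R.outcome i)) (G.outcome k)))"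
    by (rule linear_map_sum[OF HH lin]) (simp add: tens_closed)
  finally show "entry2 (cd_map n H R G) 0 0 (G.outcome k) = (\<Sum>i<n. overlap k i *\<^sub>C R.outcome i)"
    by (simp add: U_outcome)
qed

text \<open>
  On \<open>g\<^sub>k\<close> the left-hand side is \<open>n \<mu>\<^sub>R (S g\<^sub>k \<otimes> g\<^sub>k)\<close>. Expanding \<open>g\<^sub>k\<close> in the basis of \<open>R\<close> gives
  \<open>\<mu>\<^sub>R (r\<^sub>i \<otimes> g\<^sub>k) = \<langle>r\<^sub>i, g\<^sub>k\<rangle> r\<^sub>i\<close>; the coefficient \<open>\<langle>g\<^sub>k, r\<^sub>i\<rangle>\<close> of \<open>r\<^sub>i\<close> in \<open>S g\<^sub>k\<close> is its conjugate, so
  squared moduli arise.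
\<close>

lemma coecke_duncan_iff:
  "coecke_duncan n H R G \<longleftrightarrow>
    (\<forall>k<n. \<forall>i<n. complex_of_nat n * (overlap k i * cnj (overlap k i)) = 1)"
proof -
  note [simp] = R.hilbert_H
  let ?H = "of_hilb H"
  let ?t = "tens ?H ?H 0 0 0"
  define A where "A = complex_of_nat n *\<^sub>2
       frob_mult n R \<cdot> (cd_map n H R G \<Zcomp>\<^sub>2 id2 (of_hilb H)) \<cdot> frob_comult n G"
  define B where "B = frob_unit n R \<cdot> frob_counit n G"
  have id: "id2 ?H :\<^sub>2 ?H \<Rightarrow> ?H" by (simp add: cell2_id2)
  have S: "cd_map n H R G \<Zcomp>\<^sub>2 id2 ?H :\<^sub>2 ?H \<Zcomp>\<^sub>1 ?H \<Rightarrow> ?H \<Zcomp>\<^sub>1 ?H"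
    by (rule cell2_hcomp[OF cell2_cd_map id]) simp
  have A: "A :\<^sub>2 ?H \<Rightarrow> ?H"
    unfolding A_def
    by (rule cell2_scale[OF cell2_vcomp[OF cell2_vcomp[OF cell2_dagger[OF G.cell2_frob_mult] S] R.cell2_frob_mult]])
  have B: "B :\<^sub>2 ?H \<Rightarrow> ?H"
    unfolding B_def by (rule cell2_vcomp[OF cell2_dagger[OF G.cell2_frob_unit] R.cell2_frob_unit])
  have mult: "linear_map (entry1 (?H \<Zcomp>\<^sub>1 ?H) 0 0) H (entry2 (frob_mult n R) 0 0)"
    using is_cell2_dest(7)[OF R.cell2_frob_mult, of 0 0] by simp
  have A_outcome: "entry2 A 0 0 (G.outcome k) =
      (\<Sum>i<n. (complex_of_nat n * (overlap k i * cnj (overlap k i))) *\<^sub>C R.outcome i)" if k [simp]: "k < n" for k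
  proof -
    have lin1: "linear_map H H (\<lambda>v. entry2 (frob_mult n R) 0 0 (?t v (G.outcome k)))"
      using linear_map_comp[OF linear_map_tens_left mult, of 0 "G.outcome k"] by simp
    have "entry2 (frob_mult n R) 0 0 (?t (R.outcome i) (G.outcome k)) = cnj (overlap k i) *\<^sub>C R.outcome i"
      if [simp]: "i < n" for i
    proof -
      have lin2: "linear_map H H (\<lambda>v. entry2 (frob_mult n R) 0 0 (?t (R.outcome i) v))"
        using linear_map_comp[OF linear_map_tens_right mult, of 0 "R.outcome i"] by simp
      have "entry2 (frob_mult n R) 0 0 (?t (R.outcome i) (G.outcome k)) =
          entry2 (frob_mult n R) 0 0 (?t (R.outcome i) (\<Sum>l<n. cnj (overlap k l) *\<^sub>C R.outcome l))"
        using R.outcome_expansion[of "G.outcome k"] R.H.inner_commute[of "G.outcome k"]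
        by (simp add: overlap_def)
      also have "\<dots> = (\<Sum>l<n. cnj (overlap k l) *\<^sub>C entry2 (frob_mult n R) 0 0 (?t (R.outcome i) (R.outcome l)))"
        by (rule linear_map_lincomb[OF R.hilbert_H lin2]) simp
      also have "\<dots> = (\<Sum>l<n. if l = i then cnj (overlap k i) *\<^sub>C R.outcome i else 0)"
        by (intro sum.cong refl) (simp add: R.frob_mult_outcome)
      finally show ?thesis by simp
    qed
    then have "entry2 (frob_mult n R) 0 0 (?t (\<Sum>i<n. overlap k i *\<^sub>C R.outcome i) (G.outcome k))
        = (\<Sum>i<n. overlap k i *\<^sub>C cnj (overlap k i) *\<^sub>C R.outcome i)"
      by (subst linear_map_lincomb[OF R.hilbert_H lin1]) simp_all
    then show ?thesis
      by (simp add: A_def G.frob_comult_outcome hcomp_tens[OF cell2_cd_map id] cd_map_outcome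
          complex_vector.scale_sum_right scaleC_scaleC mult.assoc)
  qed
  have B_outcome: "entry2 B 0 0 (G.outcome k) = (\<Sum>i<n. 1 *\<^sub>C R.outcome i)" if "k < n" for k
    by (simp add: B_def G.frob_counit_outcome[OF that] R.frob_unit_one scaleC_one)
  have "entry2 A 0 0 (G.outcome k) = entry2 B 0 0 (G.outcome k) \<longleftrightarrow>
      (\<forall>i<n. complex_of_nat n * (overlap k i * cnj (overlap k i)) = 1)" if "k < n" for k
    unfolding A_outcome[OF that] B_outcome[OF that]
      lincomb_eq_iff[OF orthonormal_basisD(1)[OF R.basis_outcome]] by auto
  then show ?thesis
    unfolding coecke_duncan_def A_def[symmetric] B_def[symmetric]
    by (subst eq2_iff_on_spans[OF A B, where S = "\<lambda>_ _. G.outcome ` {..<n}"])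
      (auto simp: G.span_outcome)
qed

lemma complementarity_equivalences:
  assumes n: "n \<ge> 1"
  shows "(\<exists>\<phi>. controlled_phase n \<phi> \<and> physically_complementary n H R G \<phi>) \<longleftrightarrow>
           horizontally_unitary n (complex_of_real (sqrt (real n)) *\<^sub>2 (G \<cdot> R\<^sup>\<dagger>))" (is "?phys \<longleftrightarrow> ?horiz")
    and "horizontally_unitary n (complex_of_real (sqrt (real n)) *\<^sub>2 (G \<cdot> R\<^sup>\<dagger>)) \<longleftrightarrow>
           coecke_duncan n H R G"
proof -
  let ?r = "complex_of_real (sqrt (real n))"
  have r: "?r \<noteq> 0" "?r * ?r = of_nat n"
    using n by (simp_all flip: of_real_mult)
  have horiz: "?horiz \<longleftrightarrow> (\<forall>i<n. \<forall>k<n. cmod (?r * overlap k i) = 1)"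
    by (rule horizontally_unitary_iff)
  show "?phys \<longleftrightarrow> ?horiz"
  proof
    assume ?phys
    then obtain \<phi> where \<phi>: "\<phi> :\<^sub>2 W_RL n \<Rightarrow> W_RL n" "unitary2 \<phi>" and "physically_complementary n H R G \<phi>"
      by (auto simp: controlled_phase_def)
    then have "?r * overlap i j = coeff n \<phi> i j" if "i < n" "j < n" for i j
      using that r by (simp add: physically_complementary_iff[OF \<phi>(1)] field_simps)
    then show ?horiz using \<phi>(2) by (simp add: horiz unitary2_iff_coeff[OF \<phi>(1)])
  next
    assume ?horiz
    \<comment> \<open>The only candidate, by \<open>physically_complementary_iff\<close>.\<close>
    define \<phi> where "\<phi> = \<lparr>src2 = W_RL n, tgt2 = W_RL n, entry2 = (\<lambda>i j x. (?r * overlap i j) *\<^sub>C x)\<rparr>"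
    have \<phi>: "\<phi> :\<^sub>2 W_RL n \<Rightarrow> W_RL n"
      by (auto simp: \<phi>_def is_cell2_def intro!: linear_map_scaled linear_map_id hilbert_entry1)
    have "coeff n \<phi> i j = ?r * overlap i j" if "i < n" "j < n" for i j
      unfolding coeff_def \<phi>_def cell2.simps
      by (subst hilbert_space.inner_scale) (simp_all add: hilbert_entry1 that link_closed inner_link)
    then have "unitary2 \<phi>" "physically_complementary n H R G \<phi>"
      using \<open>?horiz\<close> r
      by (simp_all add: horiz unitary2_iff_coeff[OF \<phi>] physically_complementary_iff[OF \<phi>])
    then show ?phys using \<phi> by (auto simp: controlled_phase_def)
  qed
  have "cmod (?r * z) = 1 \<longleftrightarrow> complex_of_nat n * (z * cnj z) = 1" for z
  proof -
    have "complex_of_real ((cmod (?r * z))\<^sup>2) = (?r * z) * cnj (?r * z)"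
      by (rule complex_norm_square)
    also have "\<dots> = (?r * ?r) * (z * cnj z)" by simp
    finally have "complex_of_nat n * (z * cnj z) = complex_of_real ((cmod (?r * z))\<^sup>2)"
      by (simp only: r)
    then show ?thesis
      by (smt (verit) norm_ge_zero of_real_1 of_real_eq_iff one_power2 power2_eq_iff_nonneg)
  qed
  then show "?horiz \<longleftrightarrow> coecke_duncan n H R G"
    unfolding horiz coecke_duncan_iff by auto
qed

end

theorem theorem4p5:
  fixes n :: nat and H :: "'h::complex_vector hilb"
    and R G :: "('h, nat \<Rightarrow> complex \<Rightarrow> complex \<Rightarrow> complex) cell2"
  assumes "hilbert_space H" and "n \<ge> 1"
    and "nondegenerate_measurement n H R"
    and "nondegenerate_measurement n H G"
  shows "((\<exists>\<phi>. controlled_phase n \<phi> \<and> physically_complementary n H R G \<phi>) \<longleftrightarrow>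
           horizontally_unitary n (complex_of_real (sqrt (real n)) *\<^sub>2 (G \<cdot> R\<^sup>\<dagger>)))
       \<and> (horizontally_unitary n (complex_of_real (sqrt (real n)) *\<^sub>2 (G \<cdot> R\<^sup>\<dagger>)) \<longleftrightarrow>
           coecke_duncan n H R G)"
proof -
  interpret measurement_pair n H R G
    by (intro measurement_pair.intro measurement.intro assms)
  show ?thesis using complementarity_equivalences[OF \<open>n \<ge> 1\<close>] by blast
qed

end
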